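(* Let $(M,g)$ be a smooth pseudo-Riemannian manifold, and let $(V,\varphi,A_0,\ldots,A_r)$ be a model space, where $\varphi$ is a nondegenerate inner product on $V$ and $A_k \in \otimes^{4+k}V^*$ for all $k=0,\ldots,r$. The manifold $(M,g)$ is strongly $r$-curvature homogeneous of type $(1,3)$ if and only if there exists a smooth positive function $\psi: M \to \mathbb{R}$ and for each $P \in M$ there are isomorphisms of model spaces $$ (T_PM, g_P, R_P, \nabla R_P, \ldots, \nabla^r R_P) \cong \left(V, \varphi, \psi(P)A_0, \psi(P)^{3/2}A_1, \ldots, \psi(P)^{\frac12(r+2)}A_r\right). $$
   Context: $\nabla$ is the Levi-Civita connection of $(M,g)$. The curvature operator is $\mathcal{R}(X,Y)Z = \nabla_X\nabla_YZ-\nabla_Y\nabla_XZ-\nabla_{[X,Y]}Z$ and the curvature tensor is $R(X,Y,Z,W)=g(\mathcal{R}(X,Y)Z,W)$. $\nabla^k\mathcal{R}_P$ and $\nabla^kR_P$ denote their $k$-th covariant derivatives at $P$, and $g_P$ is the metric at $P$. Inner products may be indefinite. A homothety $h:T_PM\to T_QM$ is a linear isometry followed by a dilation, i.e. $h=\lambda F$ with $\lambda>0$ and $F$ a linear isometry. The pullback by an invertible linear map $h$ is $$h^*\nabla^k\mathcal{R}_Q(x,y,z;v_1,\ldots,v_k)=h^{-1}\nabla^k\mathcal{R}_Q(hx,hy,hz;hv_1,\ldots,hv_k).$$ $(M,g)$ is strongly $r$-curvature homogeneous of type $(1,3)$ if for every $P,Q\in M$ there is a single homothety $h:T_PM\to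 T_QM$ such that $h^*\nabla^k\mathcal{R}_Q=\nabla^k\mathcal{R}_P$ for all $k=0,\ldots,r$. A model space is a tuple $(V,\alpha_1,\ldots,\alpha_m)$ with $V$ a finite dimensional real vector space, $V^*$ its dual, and $\alpha_i\in\otimes^{n_i}V^*$ for nonnegative integers $n_i$. Model spaces $(V,\alpha_1,\ldots,\alpha_m)$ and $(W,\beta_1,\ldots,\beta_m)$ are isomorphic if there is a vector space isomorphism $F:V\to W$ with $F^*\beta_i=\alpha_i$ for all $i$, where $F^*$ denotes precomposition with $F$ in every input.
   Formalization: The model space is not fixed in advance: the right side asserts that some model space on V (dim V = dim M ≥ 1) and some ψ exist, since for an arbitrary fixed model space the forward direction fails (e.g. M flat and A_0 nonzero). *)

theory Defs
  imports "HOL-Analysis.Analysis"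
begin

subsection \<open>Smooth manifolds\<close>

text \<open>On an open set \<open>S\<close>, \<open>Ck_on k S f\<close> is the usual \<open>C\<^sup>k\<close> condition: all iterated directional
  derivatives of order less than \<open>k\<close> are differentiable, and those of order \<open>k\<close> are continuous.\<close>

primrec Ck_on ::
  "nat \<Rightarrow> 'e::euclidean_space set \<Rightarrow> ('e \<Rightarrow> 'f::real_normed_vector) \<Rightarrow> bool" where
  "Ck_on 0 S f \<longleftrightarrow> continuous_on S f"
| "Ck_on (Suc k) S f \<longleftrightarrow> (\<forall>x\<in>S. f differentiable (at x)) \<and>
     (\<forall>v. Ck_on k S (\<lambda>x. frechet_derivative f (at x) v))"

definition Cinf_on ::
  "'e::euclidean_space set \<Rightarrow> ('e \<Rightarrow> 'f::real_normed_vector) \<Rightarrow> bool" where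
  "Cinf_on S f \<longleftrightarrow> (\<forall>k. Ck_on k S f)"

text \<open>The manifold \<open>M\<close> is a whole type \<open>'a\<close> (Hausdorff and second countable), its dimension is
  \<open>DIM('e)\<close>. A chart is a domain together with a coordinate map, whose values outside the domain
  are irrelevant.\<close>

type_synonym ('a, 'e) chart = "'a set \<times> ('a \<Rightarrow> 'e)"

definition chart_inv :: "('a, 'e) chart \<Rightarrow> 'e \<Rightarrow> 'a" where
  "chart_inv c = inv_into (fst c) (snd c)"

definition smooth_atlas ::
  "('a::{t2_space,second_countable_topology}, 'e::euclidean_space) chart set \<Rightarrow> bool" where
  "smooth_atlas \<A> \<longleftrightarrow>
     (\<Union>c\<in>\<A>. fst c) = UNIV \<and>
     (\<forall>c\<in>\<A>. open (fst c) \<and> open (snd c ` fst c) \<and>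
        homeomorphism (fst c) (snd c ` fst c) (snd c) (chart_inv c)) \<and>
     (\<forall>c\<in>\<A>. \<forall>d\<in>\<A>. Cinf_on (snd c ` (fst c \<inter> fst d)) (snd d \<circ> chart_inv c))"

definition smooth_fun ::
  "('a::topological_space, 'e::euclidean_space) chart set \<Rightarrow> 'a set \<Rightarrow> ('a \<Rightarrow> real) \<Rightarrow> bool" where
  "smooth_fun \<A> U f \<longleftrightarrow> (\<forall>c\<in>\<A>. Cinf_on (snd c ` (U \<inter> fst c)) (f \<circ> chart_inv c))"

subsection \<open>Tangent vectors and vector fields\<close>

text \<open>A preferred chart is chosen at each point. The tangent space \<open>T\<^sub>PM\<close> is represented by \<open>'e\<close>,
  an element \<open>v\<close> standing for the tangent vector at \<open>P\<close> with coordinates \<open>v\<close> in the preferred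
  chart at \<open>P\<close>; \<open>chart_coord \<A> c P v\<close> are the coordinates of this vector in another chart \<open>c\<close>
  around \<open>P\<close>.\<close>

definition chart_at :: "('a, 'e) chart set \<Rightarrow> 'a \<Rightarrow> ('a, 'e) chart" where
  "chart_at \<A> P = (SOME c. c \<in> \<A> \<and> P \<in> fst c)"

definition chart_coord ::
  "('a, 'e::euclidean_space) chart set \<Rightarrow> ('a, 'e) chart \<Rightarrow> 'a \<Rightarrow> 'e \<Rightarrow> 'e" where
  "chart_coord \<A> c P v =
     frechet_derivative (snd c \<circ> chart_inv (chart_at \<A> P)) (at (snd (chart_at \<A> P) P)) v"

type_synonym ('a, 'e) vfield = "'a \<Rightarrow> 'e"

definition vfield_coord ::
  "('a, 'e::euclidean_space) chart set \<Rightarrow> ('a, 'e) chart \<Rightarrow> ('a, 'e) vfield \<Rightarrow> 'e \<Rightarrow> 'e" where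
  "vfield_coord \<A> c X = (\<lambda>y. chart_coord \<A> c (chart_inv c y) (X (chart_inv c y)))"

definition smooth_vfield ::
  "('a::topological_space, 'e::euclidean_space) chart set \<Rightarrow> 'a set \<Rightarrow> ('a, 'e) vfield \<Rightarrow> bool" where
  "smooth_vfield \<A> U X \<longleftrightarrow> (\<forall>c\<in>\<A>. Cinf_on (snd c ` (U \<inter> fst c)) (vfield_coord \<A> c X))"

definition dir_deriv ::
  "('a, 'e::euclidean_space) chart set \<Rightarrow> ('a, 'e) vfield \<Rightarrow> ('a \<Rightarrow> real) \<Rightarrow> 'a \<Rightarrow> real" where
  "dir_deriv \<A> X f P =
     frechet_derivative (f \<circ> chart_inv (chart_at \<A> P)) (at (snd (chart_at \<A> P) P)) (X P)"

text \<open>The Lie bracket \<open>[X,Y] = dY(X) - dX(Y)\<close>, computed at \<open>P\<close> in the preferred chart at \<open>P\<close>.\<close>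

definition lie_bracket ::
  "('a, 'e::euclidean_space) chart set \<Rightarrow> ('a, 'e) vfield \<Rightarrow> ('a, 'e) vfield \<Rightarrow> ('a, 'e) vfield" where
  "lie_bracket \<A> X Y P =
     (let c = chart_at \<A> P; p = snd c P in
        frechet_derivative (vfield_coord \<A> c Y) (at p) (X P)
      - frechet_derivative (vfield_coord \<A> c X) (at p) (Y P))"

subsection \<open>Pseudo-Riemannian metrics and the Levi-Civita connection\<close>

definition nondegenerate_inner_product :: "('v::real_vector \<Rightarrow> 'v \<Rightarrow> real) \<Rightarrow> bool" where
  "nondegenerate_inner_product \<phi> \<longleftrightarrow>
     (\<forall>x. linear (\<phi> x)) \<and> (\<forall>x y. \<phi> x y = \<phi> y x) \<and> (\<forall>x. (\<forall>y. \<phi> x y = 0) \<longrightarrow> x = 0)"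

definition pseudo_riemannian_metric ::
  "('a::topological_space, 'e::euclidean_space) chart set \<Rightarrow> ('a \<Rightarrow> 'e \<Rightarrow> 'e \<Rightarrow> real) \<Rightarrow> bool" where
  "pseudo_riemannian_metric \<A> g \<longleftrightarrow>
     (\<forall>P. nondegenerate_inner_product (g P)) \<and>
     (\<forall>U X Y. open U \<and> smooth_vfield \<A> U X \<and> smooth_vfield \<A> U Y \<longrightarrow>
        smooth_fun \<A> U (\<lambda>P. g P (X P) (Y P)))"

type_synonym ('a, 'e) connection = "('a, 'e) vfield \<Rightarrow> ('a, 'e) vfield \<Rightarrow> ('a, 'e) vfield"

text \<open>An affine connection, acting on the smooth vector fields over every open set, compatibly
  with restriction (first conjunct). Every connection on global vector fields extends uniquely in
  this way, by locality. The value \<open>D X Y P\<close> is unconstrained when \<open>X\<close>, \<open>Y\<close> are not smooth near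
  \<open>P\<close>.\<close>

definition affine_connection ::
  "('a::topological_space, 'e::euclidean_space) chart set \<Rightarrow> ('a, 'e) connection \<Rightarrow> bool" where
  "affine_connection \<A> D \<longleftrightarrow> (\<forall>U. open U \<longrightarrow>
     (\<forall>X X' Y Y'. smooth_vfield \<A> U X \<and> smooth_vfield \<A> U X' \<and>
                  smooth_vfield \<A> U Y \<and> smooth_vfield \<A> U Y' \<longrightarrow>
        ((\<forall>P\<in>U. X P = X' P \<and> Y P = Y' P) \<longrightarrow> (\<forall>P\<in>U. D X Y P = D X' Y' P)) \<and>
        smooth_vfield \<A> U (D X Y) \<and>
        (\<forall>P\<in>U. D (\<lambda>p. X p + X' p) Y P = D X Y P + D X' Y P) \<and>
        (\<forall>P\<in>U. D X (\<lambda>p. Y p + Y' p) P = D X Y P + D X Y' P) \<and>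
        (\<forall>f. smooth_fun \<A> U f \<longrightarrow> (\<forall>P\<in>U.
           D (\<lambda>p. f p *\<^sub>R X p) Y P = f P *\<^sub>R D X Y P \<and>
           D X (\<lambda>p. f p *\<^sub>R Y p) P = dir_deriv \<A> X f P *\<^sub>R Y P + f P *\<^sub>R D X Y P))))"

definition levi_civita_connection ::
  "('a::topological_space, 'e::euclidean_space) chart set \<Rightarrow> ('a \<Rightarrow> 'e \<Rightarrow> 'e \<Rightarrow> real) \<Rightarrow>
   ('a, 'e) connection \<Rightarrow> bool" where
  "levi_civita_connection \<A> g D \<longleftrightarrow> affine_connection \<A> D \<and> (\<forall>U. open U \<longrightarrow>
     (\<forall>X Y Z. smooth_vfield \<A> U X \<and> smooth_vfield \<A> U Y \<and> smooth_vfield \<A> U Z \<longrightarrow> (\<forall>P\<in>U.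
        D X Y P - D Y X P = lie_bracket \<A> X Y P \<and>
        dir_deriv \<A> X (\<lambda>p. g p (Y p) (Z p)) P
          = g P (D X Y P) (Z P) + g P (Y P) (D X Z P))))"

subsection \<open>Curvature and its covariant derivatives\<close>

definition curvature_operator ::
  "('a, 'e::euclidean_space) chart set \<Rightarrow> ('a, 'e) connection \<Rightarrow>
   ('a, 'e) vfield \<Rightarrow> ('a, 'e) vfield \<Rightarrow> ('a, 'e) vfield \<Rightarrow> ('a, 'e) vfield" where
  "curvature_operator \<A> D X Y Z =
     (\<lambda>P. D X (D Y Z) P - D Y (D X Z) P - D (lie_bracket \<A> X Y) Z P)"

text \<open>Tensor fields of type \<open>(0,n)\<close> and \<open>(1,n)\<close> act on lists of \<open>n\<close> vector fields. The covariant
  derivative takes the direction of differentiation as an additional last argument.\<close>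

type_synonym ('a, 'e) tensor_field0 = "('a, 'e) vfield list \<Rightarrow> 'a \<Rightarrow> real"
type_synonym ('a, 'e) tensor_field1 = "('a, 'e) vfield list \<Rightarrow> ('a, 'e) vfield"

definition curv13 ::
  "('a, 'e::euclidean_space) chart set \<Rightarrow> ('a, 'e) connection \<Rightarrow> ('a, 'e) tensor_field1" where
  "curv13 \<A> D Xs = curvature_operator \<A> D (Xs ! 0) (Xs ! 1) (Xs ! 2)"

definition curv04 ::
  "('a, 'e::euclidean_space) chart set \<Rightarrow> ('a \<Rightarrow> 'e \<Rightarrow> 'e \<Rightarrow> real) \<Rightarrow> ('a, 'e) connection \<Rightarrow>
   ('a, 'e) tensor_field0" where
  "curv04 \<A> g D Xs =
     (\<lambda>P. g P (curvature_operator \<A> D (Xs ! 0) (Xs ! 1) (Xs ! 2) P) ((Xs ! 3) P))"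

definition cov_deriv0 ::
  "('a, 'e::euclidean_space) chart set \<Rightarrow> ('a, 'e) connection \<Rightarrow>
   ('a, 'e) tensor_field0 \<Rightarrow> ('a, 'e) tensor_field0" where
  "cov_deriv0 \<A> D T Xs = (let V = last Xs; Ys = butlast Xs in
     (\<lambda>P. dir_deriv \<A> V (T Ys) P - (\<Sum>i<length Ys. T (Ys[i := D V (Ys ! i)]) P)))"

definition cov_deriv1 ::
  "('a, 'e::euclidean_space) connection \<Rightarrow> ('a, 'e) tensor_field1 \<Rightarrow> ('a, 'e) tensor_field1" where
  "cov_deriv1 D S Xs = (let V = last Xs; Ys = butlast Xs in
     (\<lambda>P. D V (S Ys) P - (\<Sum>i<length Ys. S (Ys[i := D V (Ys ! i)]) P)))"

text \<open>Tensor fields are evaluated on tangent vectors at \<open>P\<close> by extending these to vector fields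
  that are smooth near \<open>P\<close>; by tensoriality the result does not depend on the extensions.\<close>

definition extend_vector ::
  "('a::topological_space, 'e::euclidean_space) chart set \<Rightarrow> 'a \<Rightarrow> 'e \<Rightarrow> ('a, 'e) vfield" where
  "extend_vector \<A> P x =
     (SOME X. X P = x \<and> (\<exists>U. open U \<and> P \<in> U \<and> smooth_vfield \<A> U X))"

definition nabla_curv13 ::
  "('a::topological_space, 'e::euclidean_space) chart set \<Rightarrow> ('a, 'e) connection \<Rightarrow> nat \<Rightarrow>
   'a \<Rightarrow> 'e list \<Rightarrow> 'e" where
  "nabla_curv13 \<A> D k P xs =
     (cov_deriv1 D ^^ k) (curv13 \<A> D) (map (extend_vector \<A> P) xs) P"

definition nabla_curv04 ::
  "('a::topological_space, 'e::euclidean_space) chart set \<Rightarrow> ('a \<Rightarrow> 'e \<Rightarrow> 'e \<Rightarrow> real) \<Rightarrow>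
   ('a, 'e) connection \<Rightarrow> nat \<Rightarrow> 'a \<Rightarrow> 'e list \<Rightarrow> real" where
  "nabla_curv04 \<A> g D k P xs =
     (cov_deriv0 \<A> D ^^ k) (curv04 \<A> g D) (map (extend_vector \<A> P) xs) P"

subsection \<open>Strong curvature homogeneity\<close>

definition linear_isometry ::
  "('v::real_vector \<Rightarrow> 'v \<Rightarrow> real) \<Rightarrow> ('w::real_vector \<Rightarrow> 'w \<Rightarrow> real) \<Rightarrow> ('v \<Rightarrow> 'w) \<Rightarrow> bool" where
  "linear_isometry \<phi> \<eta> F \<longleftrightarrow> linear F \<and> bij F \<and> (\<forall>x y. \<eta> (F x) (F y) = \<phi> x y)"

definition homothety ::
  "('v::real_vector \<Rightarrow> 'v \<Rightarrow> real) \<Rightarrow> ('w::real_vector \<Rightarrow> 'w \<Rightarrow> real) \<Rightarrow> ('v \<Rightarrow> 'w) \<Rightarrow> bool" where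
  "homothety \<phi> \<eta> h \<longleftrightarrow> (\<exists>c F. c > 0 \<and> linear_isometry \<phi> \<eta> F \<and> h = (\<lambda>x. c *\<^sub>R F x))"

definition pullback1 :: "('v \<Rightarrow> 'w) \<Rightarrow> ('w list \<Rightarrow> 'w) \<Rightarrow> 'v list \<Rightarrow> 'v" where
  "pullback1 h S xs = inv h (S (map h xs))"

definition strongly_curvature_homogeneous13 ::
  "('a::topological_space, 'e::euclidean_space) chart set \<Rightarrow> ('a \<Rightarrow> 'e \<Rightarrow> 'e \<Rightarrow> real) \<Rightarrow>
   ('a, 'e) connection \<Rightarrow> nat \<Rightarrow> bool" where
  "strongly_curvature_homogeneous13 \<A> g D r \<longleftrightarrow>
     (\<forall>P Q. \<exists>h. homothety (g P) (g Q) h \<and>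
        (\<forall>k\<le>r. \<forall>xs. length xs = 3 + k \<longrightarrow>
           pullback1 h (nabla_curv13 \<A> D k Q) xs = nabla_curv13 \<A> D k P xs))"

subsection \<open>Model spaces\<close>

text \<open>An element of \<open>\<otimes>\<^sup>n V\<^sup>*\<close> is a multilinear function on lists of length \<open>n\<close>, with irrelevant
  values on other lists. A model space on \<open>V\<close> is given by its list of tensors, each with its
  rank.\<close>

definition multilinear :: "nat \<Rightarrow> ('v::real_vector list \<Rightarrow> real) \<Rightarrow> bool" where
  "multilinear n \<alpha> \<longleftrightarrow>
     (\<forall>xs i. length xs = n \<and> i < n \<longrightarrow> linear (\<lambda>x. \<alpha> (xs[i := x])))"

type_synonym 'v model = "(nat \<times> ('v list \<Rightarrow> real)) list"

definition model_space :: "'v::real_vector model \<Rightarrow> bool" where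
  "model_space ts \<longleftrightarrow> (\<exists>B :: 'v set. finite B \<and> span B = UNIV) \<and>
     (\<forall>(n, \<alpha>) \<in> set ts. multilinear n \<alpha>)"

definition model_isomorphic :: "'v::real_vector model \<Rightarrow> 'w::real_vector model \<Rightarrow> bool" where
  "model_isomorphic ts us \<longleftrightarrow> (\<exists>F. linear F \<and> bij F \<and>
     list_all2 (\<lambda>(n, \<alpha>) (m, \<beta>). n = m \<and> (\<forall>xs. length xs = n \<longrightarrow> \<beta> (map F xs) = \<alpha> xs)) ts us)"

definition curvature_model ::
  "nat \<Rightarrow> ('v \<Rightarrow> 'v \<Rightarrow> real) \<Rightarrow> (nat \<Rightarrow> 'v list \<Rightarrow> real) \<Rightarrow> 'v model" where
  "curvature_model r \<phi> A =
     (2, \<lambda>xs. \<phi> (xs ! 0) (xs ! 1)) # map (\<lambda>k. (4 + k, A k)) [0..<Suc r]"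

end

theory Submission
  imports Defs "HOL-Computational_Algebra.Fundamental_Theorem_Algebra"
begin

text \<open>Lowering the last index turns a homothety with factor \<open>c\<close> that preserves all \<open>\<nabla>\<^sup>k\<R>\<close> into a linear
  bijection scaling \<open>g\<close> and all \<open>\<nabla>\<^sup>kR\<close> by the common factor \<open>a = c\<^sup>2\<close>, and dividing by \<open>c\<close> gives the
  isomorphism of model spaces with \<open>\<psi> = a\<close>. The difficulty is to choose the factors \<open>a(P)\<close> of bijections
  from \<open>T\<^sub>PM\<close> to a fixed \<open>T\<^sub>QM\<close> smoothly in \<open>P\<close>; in indefinite signature scalar invariants do not determine
  them. If some self-map of \<open>T\<^sub>QM\<close> has a factor other than 1, then the flow of its positive part realizes
  every positive factor, and \<open>\<psi> = 1\<close> works. Otherwise \<open>a(P)\<close> is unique. The tensors at nearby points, in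
  a local frame, lie in one orbit of a representation of \<open>GL(n) \<times> \<real>\<close>. A slice through this orbit
  meets it in a countable set, so a continuous family of points in the orbit has constant projection to the
  slice. Hence it is moved back to the base point by group elements depending smoothly on \<open>P\<close>, whose
  scalar parts are the factors.\<close>

section \<open>Calculus of smooth functions\<close>

text \<open>The orbit need not be embedded: it may return to its own points infinitely often, so two
  nearby tensors in it need not be related by a group element near the identity. Countability of the
  intersection with the slice replaces embeddedness. It comes from a rank argument: stabilizer
  algebras along an orbit are conjugate, hence of one dimension, and a complement chosen at the base
  point stays transversal nearby; so the projection to the slice, seen as a map on the group, has
  zero derivative and is locally constant. Second countability of the group leaves countably many
  values.

  A self-map with factor \<open>a \<noteq> 1\<close> by itself yields only the powers of
  \<open>a\<close>, which do not normalize an arbitrary factor; along the flow a form scaled by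
  \<open>a\<close> is scaled by \<open>a powr t\<close>, and this fills the gaps.

  The exponents in the statement come from one computation: a bijection scaling \<open>g\<close> by
  \<open>a\<close> becomes isometric after division by the square root of \<open>a\<close>, and this
  multiplies a form with 4+k arguments by a^(-(4+k)/2). Together with the factor \<open>a\<close>
  there remains a^(-(k+2)/2).\<close>

lemma linear_euclidean_expansion:
  fixes f :: "'a::euclidean_space \<Rightarrow> 'b::real_vector"
  assumes "linear f"
  shows "f w = (\<Sum>b\<in>Basis. (w \<bullet> b) *\<^sub>R f b)"
proof -
  have "f w = f (\<Sum>b\<in>Basis. (w \<bullet> b) *\<^sub>R b)"
    by (simp add: euclidean_representation)
  then show ?thesis
    using assms by (simp add: linear_sum linear_scale)
qed

lemma linear_inv:
  fixes F :: "'v::real_vector \<Rightarrow> 'w::real_vector"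
  assumes "linear F" "bij F"
  shows "linear (inv F)"
proof (rule linearI)
  have s: "F (inv F x) = x" for x using assms(2) by (simp add: bij_is_surj surj_f_inv_f)
  have i: "F x = F y \<Longrightarrow> x = y" for x y using assms(2) by (simp add: bij_is_inj inj_eq)
  show "inv F (x + y) = inv F x + inv F y" for x y by (rule i) (simp add: s linear_add[OF assms(1)])
  show "inv F (c *\<^sub>R x) = c *\<^sub>R inv F x" for c x by (rule i) (simp add: s linear_scale[OF assms(1)])
qed

section \<open>The classes \<open>Ck_on\<close>: locality, algebraic operations, composition\<close>

lemma Ck_on_cong:
  assumes "open S" "\<And>x. x \<in> S \<Longrightarrow> f x = g x" "Ck_on k S f"
  shows "Ck_on k S g"
  using assms(2,3)
proof (induction k arbitrary: f g)
  case 0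
  then show ?case by (simp cong: continuous_on_cong)
next
  case (Suc k)
  have ev: "\<forall>\<^sub>F y in nhds x. f y = g y" if "x \<in> S" for x
    using Suc.prems(1) assms(1) that eventually_nhds by blast
  have d: "(g has_derivative frechet_derivative f (at x)) (at x)" if "x \<in> S" for x
  proof -
    have "(f has_derivative frechet_derivative f (at x)) (at x)"
      using Suc.prems(2) that by (simp add: frechet_derivative_works)
    then show ?thesis
      using has_derivative_transform_within_open[OF _ assms(1) that] Suc.prems(1) by blast
  qed
  have e: "frechet_derivative f (at x) = frechet_derivative g (at x)" if "x \<in> S" for x
    using d[OF that] by (rule frechet_derivative_at)
  show ?case unfolding Ck_on.simps(2)
  proof (intro conjI allI ballI)
    show "g differentiable at x" if "x \<in> S" for x
      using d[OF that] unfolding differentiable_def by blast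
    show "Ck_on k S (\<lambda>x. frechet_derivative g (at x) v)" for v
      by (rule Suc.IH[of "\<lambda>x. frechet_derivative f (at x) v"]) (use Suc.prems(2) e in simp_all)
  qed
qed

lemma Ck_on_SucI:
  assumes "open S" "\<And>x. x \<in> S \<Longrightarrow> (f has_derivative f' x) (at x)"
    "\<And>v. Ck_on k S (\<lambda>x. f' x v)"
  shows "Ck_on (Suc k) S f"
proof -
  have e: "f' x = frechet_derivative f (at x)" if "x \<in> S" for x
    using assms(2)[OF that] by (rule frechet_derivative_at)
  show ?thesis unfolding Ck_on.simps(2)
  proof (intro conjI allI ballI)
    show "f differentiable at x" if "x \<in> S" for x
      using assms(2)[OF that] unfolding differentiable_def by blast
    show "Ck_on k S (\<lambda>x. frechet_derivative f (at x) v)" for v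
      by (rule Ck_on_cong[OF assms(1) _ assms(3)[of v]]) (simp add: e)
  qed
qed

lemma Ck_on_Suc_imp_has_derivative:
  "Ck_on (Suc k) S f \<Longrightarrow> x \<in> S \<Longrightarrow> (f has_derivative frechet_derivative f (at x)) (at x)"
  by (simp add: frechet_derivative_works)

lemma Ck_on_Suc_imp: "Ck_on (Suc k) S f \<Longrightarrow> Ck_on k S f"
proof (induction k arbitrary: f)
  case 0
  then show ?case unfolding Ck_on.simps continuous_on_eq_continuous_within
    using continuous_at_imp_continuous_at_within differentiable_imp_continuous_within by blast
qed auto

lemma Ck_on_subset: "Ck_on k S f \<Longrightarrow> T \<subseteq> S \<Longrightarrow> Ck_on k T f"
  by (induction k arbitrary: f) (auto intro: continuous_on_subset)

lemma Ck_on_local: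
  assumes "\<And>x. x \<in> S \<Longrightarrow> \<exists>T. open T \<and> x \<in> T \<and> Ck_on k T f"
  shows "Ck_on k S f"
  using assms
proof (induction k arbitrary: f)
  case 0
  show ?case unfolding Ck_on.simps(1) continuous_on_eq_continuous_within
  proof
    fix x assume "x \<in> S"
    then obtain T where "open T" "x \<in> T" "continuous_on T f"
      using 0 by auto
    then have "isCont f x" by (simp add: continuous_on_eq_continuous_at)
    then show "continuous (at x within S) f" by (rule continuous_at_imp_continuous_at_within)
  qed
next
  case (Suc k)
  show ?case unfolding Ck_on.simps(2)
  proof (intro conjI allI ballI)
    show "f differentiable at x" if "x \<in> S" for x using Suc.prems[OF that] by auto
    show "Ck_on k S (\<lambda>x. frechet_derivative f (at x) v)" for v
      by (rule Suc.IH) (use Suc.prems in force)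
  qed
qed

lemma Ck_on_imp_continuous_on: "Ck_on k S f \<Longrightarrow> continuous_on S f"
  by (induction k) (simp, metis Ck_on_Suc_imp)

lemma Ck_on_const [simp]: "Ck_on k S (\<lambda>x. c)"
  by (induction k arbitrary: c) auto

lemma Ck_on_bounded_linear_compose:
  assumes L: "bounded_linear L" and S: "open S"
  shows "Ck_on k S f \<Longrightarrow> Ck_on k S (\<lambda>x. L (f x))"
proof (induction k arbitrary: f)
  case 0
  then show ?case using bounded_linear.continuous_on[OF L] by simp
next
  case (Suc k)
  show ?case
  proof (rule Ck_on_SucI[OF S])
    show "((\<lambda>x. L (f x)) has_derivative (\<lambda>v. L (frechet_derivative f (at x) v))) (at x)"
      if "x \<in> S" for x
      using bounded_linear.has_derivative[OF L Ck_on_Suc_imp_has_derivative[OF Suc.prems that]] .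
  qed (use Suc in auto)
qed

lemma Ck_on_id: "open S \<Longrightarrow> Ck_on k S (\<lambda>x. x)"
  by (cases k) (simp_all add: Ck_on_SucI[where f' = "\<lambda>x v. v"] del: Ck_on.simps(2))

lemma Ck_on_add:
  assumes S: "open S"
  shows "Ck_on k S f \<Longrightarrow> Ck_on k S g \<Longrightarrow> Ck_on k S (\<lambda>x. f x + g x)"
proof (induction k arbitrary: f g)
  case (Suc k)
  show ?case
  proof (rule Ck_on_SucI[OF S])
    show "((\<lambda>x. f x + g x) has_derivative
        (\<lambda>v. frechet_derivative f (at x) v + frechet_derivative g (at x) v)) (at x)"
      if "x \<in> S" for x
      using Suc.prems that by (intro has_derivative_add Ck_on_Suc_imp_has_derivative)
  qed (use Suc in auto)
qed (auto intro: continuous_on_add)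

lemma Ck_on_sum:
  assumes "open S" "\<And>i. i \<in> A \<Longrightarrow> Ck_on k S (f i)"
  shows "Ck_on k S (\<lambda>x. \<Sum>i\<in>A. f i x)"
  using assms(2) by (induction A rule: infinite_finite_induct) (auto intro: Ck_on_add[OF assms(1)])

lemma Ck_on_bilinear:
  assumes B: "bounded_bilinear B" and S: "open S"
  shows "Ck_on k S f \<Longrightarrow> Ck_on k S g \<Longrightarrow> Ck_on k S (\<lambda>x. B (f x) (g x))"
proof (induction k arbitrary: f g)
  case 0
  then show ?case using bounded_bilinear.continuous_on[OF B] by simp
next
  case (Suc k)
  note fg = Ck_on_Suc_imp[OF Suc.prems(1)] Ck_on_Suc_imp[OF Suc.prems(2)]
  show ?case
  proof (rule Ck_on_SucI[OF S])
    show "((\<lambda>x. B (f x) (g x)) has_derivative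
        (\<lambda>v. B (f x) (frechet_derivative g (at x) v) + B (frechet_derivative f (at x) v) (g x))) (at x)"
      if "x \<in> S" for x
      using bounded_bilinear.FDERIV[OF B Ck_on_Suc_imp_has_derivative[OF Suc.prems(1) that]
          Ck_on_Suc_imp_has_derivative[OF Suc.prems(2) that]] .
  qed (use Suc fg in \<open>auto intro!: Ck_on_add[OF S]\<close>)
qed

lemmas Ck_on_scaleR = Ck_on_bilinear[OF bounded_bilinear_scaleR]
lemmas Ck_on_mult = Ck_on_bilinear[OF bounded_bilinear_mult]
lemmas Ck_on_inner_const = Ck_on_bounded_linear_compose[OF bounded_linear_inner_left]

lemma Ck_on_compose:
  fixes f :: "'b::euclidean_space \<Rightarrow> 'c::real_normed_vector" and g :: "'a::euclidean_space \<Rightarrow> 'b"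
  assumes S: "open S" and sub: "g ` S \<subseteq> T"
  shows "Ck_on k T f \<Longrightarrow> Ck_on k S g \<Longrightarrow> Ck_on k S (\<lambda>x. f (g x))"
proof (induction k arbitrary: f)
  case 0
  then show ?case using sub by (auto intro: continuous_on_compose2)
next
  case (Suc k)
  let ?f' = "\<lambda>y. frechet_derivative f (at y)" and ?g' = "\<lambda>x. frechet_derivative g (at x)"
  have f': "(f has_derivative ?f' (g x)) (at (g x))" if "x \<in> S" for x
    using Suc.prems(1) sub that by (intro Ck_on_Suc_imp_has_derivative) auto
  show ?case
  proof (rule Ck_on_SucI[OF S])
    fix x assume x: "x \<in> S"
    have d: "((\<lambda>x. f (g x)) has_derivative (\<lambda>v. ?f' (g x) (?g' x v))) (at x)"
      using has_derivative_compose[OF Ck_on_Suc_imp_has_derivative[OF Suc.prems(2) x] f'[OF x]] .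
    \<comment> \<open>The derivative of the composite is written in a basis because
      \<open>Ck_on\<close> only speaks of derivatives in a fixed direction; it becomes a sum of
      products of functions to which the induction hypothesis applies.\<close>
    have "?f' (g x) w = (\<Sum>b\<in>Basis. (w \<bullet> b) *\<^sub>R ?f' (g x) b)" for w
      by (rule linear_euclidean_expansion[OF has_derivative_linear[OF f'[OF x]]])
    then have "(\<lambda>v. ?f' (g x) (?g' x v)) = (\<lambda>v. \<Sum>b\<in>Basis. (?g' x v \<bullet> b) *\<^sub>R ?f' (g x) b)"
      by blast
    with d show "((\<lambda>x. f (g x)) has_derivative
        (\<lambda>v. \<Sum>b\<in>Basis. (?g' x v \<bullet> b) *\<^sub>R ?f' (g x) b)) (at x)"
      by (simp only:)
  next
    fix v
    show "Ck_on k S (\<lambda>x. \<Sum>b\<in>Basis. (?g' x v \<bullet> b) *\<^sub>R ?f' (g x) b)"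
      using Suc.IH[of "\<lambda>y. ?f' y b" for b] Suc.prems Ck_on_Suc_imp[OF Suc.prems(2)]
      by (intro Ck_on_sum[OF S] Ck_on_scaleR[OF S] Ck_on_inner_const[OF S]) auto
  qed
qed

section \<open>Transfer from \<open>Ck_on\<close> to smooth maps\<close>

lemma Cinf_onD: "Cinf_on S f \<Longrightarrow> Ck_on k S f"
  by (simp add: Cinf_on_def)

lemma Cinf_on_cong:
  "open S \<Longrightarrow> (\<And>x. x \<in> S \<Longrightarrow> f x = g x) \<Longrightarrow> Cinf_on S f \<Longrightarrow> Cinf_on S g"
  unfolding Cinf_on_def using Ck_on_cong by metis

lemma Cinf_on_subset: "Cinf_on S f \<Longrightarrow> T \<subseteq> S \<Longrightarrow> Cinf_on T f"
  unfolding Cinf_on_def using Ck_on_subset by metis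

lemma Cinf_on_local:
  "(\<And>x. x \<in> S \<Longrightarrow> \<exists>T. open T \<and> x \<in> T \<and> Cinf_on T f) \<Longrightarrow> Cinf_on S f"
  unfolding Cinf_on_def by (metis Ck_on_local)

lemma Cinf_on_const [simp]: "Cinf_on S (\<lambda>x. c)"
  by (simp add: Cinf_on_def)

lemma Cinf_on_id: "open S \<Longrightarrow> Cinf_on S (\<lambda>x. x)"
  by (simp add: Cinf_on_def Ck_on_id)

lemma Cinf_on_bounded_linear_compose:
  "bounded_linear L \<Longrightarrow> open S \<Longrightarrow> Cinf_on S f \<Longrightarrow> Cinf_on S (\<lambda>x. L (f x))"
  by (simp add: Cinf_on_def Ck_on_bounded_linear_compose)

lemma Cinf_on_bounded_linear: "bounded_linear L \<Longrightarrow> open S \<Longrightarrow> Cinf_on S L"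
  using Cinf_on_bounded_linear_compose[OF _ _ Cinf_on_id] by metis

lemma Cinf_on_add:
  "open S \<Longrightarrow> Cinf_on S f \<Longrightarrow> Cinf_on S g \<Longrightarrow> Cinf_on S (\<lambda>x. f x + g x)"
  by (simp add: Cinf_on_def Ck_on_add)

lemma Cinf_on_sum:
  "open S \<Longrightarrow> (\<And>i. i \<in> A \<Longrightarrow> Cinf_on S (f i)) \<Longrightarrow> Cinf_on S (\<lambda>x. \<Sum>i\<in>A. f i x)"
  by (simp add: Cinf_on_def Ck_on_sum)

lemma Cinf_on_scaleR:
  "open S \<Longrightarrow> Cinf_on S f \<Longrightarrow> Cinf_on S g \<Longrightarrow> Cinf_on S (\<lambda>x. f x *\<^sub>R g x)"
  by (simp add: Cinf_on_def Ck_on_scaleR)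

lemma Cinf_on_mult:
  fixes f g :: "'a::euclidean_space \<Rightarrow> real"
  shows "open S \<Longrightarrow> Cinf_on S f \<Longrightarrow> Cinf_on S g \<Longrightarrow> Cinf_on S (\<lambda>x. f x * g x)"
  by (simp add: Cinf_on_def Ck_on_mult)

lemma Cinf_on_prod:
  fixes f :: "'i \<Rightarrow> 'a::euclidean_space \<Rightarrow> real"
  assumes "open S" "\<And>i. i \<in> A \<Longrightarrow> Cinf_on S (f i)"
  shows "Cinf_on S (\<lambda>x. \<Prod>i\<in>A. f i x)"
  using assms(2) by (induction A rule: infinite_finite_induct) (auto intro: Cinf_on_mult[OF assms(1)])

lemma Cinf_on_inner_const: "open S \<Longrightarrow> Cinf_on S f \<Longrightarrow> Cinf_on S (\<lambda>x. f x \<bullet> b)"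
  by (simp add: Cinf_on_def Ck_on_inner_const)

lemma Cinf_on_compose:
  fixes f :: "'b::euclidean_space \<Rightarrow> 'c::real_normed_vector" and g :: "'a::euclidean_space \<Rightarrow> 'b"
  shows "open S \<Longrightarrow> g ` S \<subseteq> T \<Longrightarrow> Cinf_on T f \<Longrightarrow> Cinf_on S g \<Longrightarrow> Cinf_on S (\<lambda>x. f (g x))"
  by (simp add: Cinf_on_def Ck_on_compose)

lemma Cinf_on_has_derivative:
  "Cinf_on S f \<Longrightarrow> x \<in> S \<Longrightarrow> (f has_derivative frechet_derivative f (at x)) (at x)"
  unfolding Cinf_on_def using Ck_on_Suc_imp_has_derivative by blast

lemma Cinf_on_derivative: "Cinf_on S f \<Longrightarrow> Cinf_on S (\<lambda>x. frechet_derivative f (at x) v)"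
  unfolding Cinf_on_def by (metis Ck_on.simps(2))

lemma Cinf_on_imp_continuous_on: "Cinf_on S f \<Longrightarrow> continuous_on S f"
  unfolding Cinf_on_def using Ck_on_imp_continuous_on by blast

lemma Cinf_on_derivative_apply:
  fixes f :: "'a::euclidean_space \<Rightarrow> 'b::real_normed_vector" and g :: "'c::euclidean_space \<Rightarrow> 'a"
  assumes S: "open S" and f: "Cinf_on T f" and g: "Cinf_on S g" "g ` S \<subseteq> T" and w: "Cinf_on S w"
  shows "Cinf_on S (\<lambda>x. frechet_derivative f (at (g x)) (w x))"
proof (rule Cinf_on_cong[OF S])
  show "Cinf_on S (\<lambda>x. \<Sum>b\<in>Basis. (w x \<bullet> b) *\<^sub>R frechet_derivative f (at (g x)) b)"
    by (intro Cinf_on_sum Cinf_on_scaleR Cinf_on_inner_const w S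
        Cinf_on_compose[OF S g(2) _ g(1)] Cinf_on_derivative[OF f])
  show "(\<Sum>b\<in>Basis. (w x \<bullet> b) *\<^sub>R frechet_derivative f (at (g x)) b)
      = frechet_derivative f (at (g x)) (w x)" if "x \<in> S" for x
    using linear_euclidean_expansion[OF has_derivative_linear[OF Cinf_on_has_derivative[OF f]]] g(2) that
    by (metis image_subset_iff)
qed

section \<open>Symmetry of the second derivative\<close>

lemma has_derivative_along_line:
  fixes f :: "'a::real_normed_vector \<Rightarrow> real"
  assumes "(f has_derivative f') (at (y + s *\<^sub>R u))"
  shows "((\<lambda>s. f (y + s *\<^sub>R u)) has_derivative (\<lambda>r. r * f' u)) (at s)"
proof -
  have "((\<lambda>s. y + s *\<^sub>R u) has_derivative (\<lambda>r. r *\<^sub>R u)) (at s)"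
    by (auto intro!: derivative_eq_intros)
  from has_derivative_compose[OF this assms] show ?thesis
    using has_derivative_linear[OF assms] by (simp add: linear_scale)
qed

text \<open>The mean value theorem is used twice: along \<open>u\<close> for the difference of
  \<open>f\<close> across \<open>h *\<^sub>R v\<close>, then along \<open>v\<close> for the
  derivative that results. Only one order of differentiation occurs, and exchanging \<open>u\<close>
  and \<open>v\<close> yields the other order for the same second difference.\<close>

lemma mixed_difference_mean_value:
  fixes f :: "'a::euclidean_space \<Rightarrow> real"
  assumes f: "Ck_on 2 S f" and h: "h > 0"
    and sub: "\<And>s t. s \<in> {0..h} \<Longrightarrow> t \<in> {0..h} \<Longrightarrow> x + s *\<^sub>R u + t *\<^sub>R v \<in> S"
  obtains s t where "s \<in> {0..h}" "t \<in> {0..h}"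
    "f (x + h *\<^sub>R u + h *\<^sub>R v) - f (x + h *\<^sub>R u) - f (x + h *\<^sub>R v) + f x
     = h * (h * frechet_derivative (\<lambda>y. frechet_derivative f (at y) u) (at (x + s *\<^sub>R u + t *\<^sub>R v)) v)"
proof -
  let ?f' = "\<lambda>y. frechet_derivative f (at y)"
  let ?fu = "\<lambda>y. ?f' y u"
  have fS: "Ck_on (Suc (Suc 0)) S f" using f by (simp only: numeral_2_eq_2)
  have d1: "(f has_derivative ?f' y) (at y)" if "y \<in> S" for y
    using Ck_on_Suc_imp_has_derivative[OF fS that] .
  have "Ck_on (Suc 0) S ?fu" using fS unfolding Ck_on.simps(2)[of "Suc 0"] by blast
  then have d2: "(?fu has_derivative frechet_derivative ?fu (at y)) (at y)" if "y \<in> S" for y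
    using Ck_on_Suc_imp_has_derivative that by blast
  let ?F = "\<lambda>s. f (x + s *\<^sub>R u + h *\<^sub>R v) - f (x + s *\<^sub>R u)"
  have "(?F has_derivative (\<lambda>r. r * (?fu (x + s *\<^sub>R u + h *\<^sub>R v) - ?fu (x + s *\<^sub>R u)))) (at s)"
    if "s \<in> {0..h}" for s
  proof -
    have S: "x + s *\<^sub>R u + h *\<^sub>R v \<in> S" "x + s *\<^sub>R u \<in> S"
      using sub[OF that, of h] sub[OF that, of 0] h by auto
    have "((\<lambda>s. f ((x + h *\<^sub>R v) + s *\<^sub>R u)) has_derivative
        (\<lambda>r. r * ?fu ((x + h *\<^sub>R v) + s *\<^sub>R u))) (at s)"
      by (rule has_derivative_along_line) (use d1[OF S(1)] in \<open>simp add: add_ac\<close>)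
    moreover have "((\<lambda>s. f (x + s *\<^sub>R u)) has_derivative (\<lambda>r. r * ?fu (x + s *\<^sub>R u))) (at s)"
      by (rule has_derivative_along_line[OF d1[OF S(2)]])
    ultimately show ?thesis
      using has_derivative_diff by (force simp: right_diff_distrib add_ac)
  qed
  then have "\<exists>s\<in>{0..h}. ?F h - ?F 0 = (h - 0) * (?fu (x + s *\<^sub>R u + h *\<^sub>R v) - ?fu (x + s *\<^sub>R u))"
    using h by (intro mvt_very_simple) (auto intro: has_derivative_at_withinI)
  then obtain s where s: "s \<in> {0..h}"
    "?F h - ?F 0 = h * (?fu (x + s *\<^sub>R u + h *\<^sub>R v) - ?fu (x + s *\<^sub>R u))"
    by auto
  let ?G = "\<lambda>t. ?fu (x + s *\<^sub>R u + t *\<^sub>R v)"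
  have "(?G has_derivative (\<lambda>r. r * frechet_derivative ?fu (at (x + s *\<^sub>R u + t *\<^sub>R v)) v)) (at t)"
    if "t \<in> {0..h}" for t
    by (rule has_derivative_along_line[OF d2[OF sub[OF s(1) that]]])
  then have "\<exists>t\<in>{0..h}. ?G h - ?G 0 = (h - 0) * frechet_derivative ?fu (at (x + s *\<^sub>R u + t *\<^sub>R v)) v"
    using h by (intro mvt_very_simple) (auto intro: has_derivative_at_withinI)
  then obtain t where t: "t \<in> {0..h}"
    "?G h - ?G 0 = h * frechet_derivative ?fu (at (x + s *\<^sub>R u + t *\<^sub>R v)) v"
    by auto
  show thesis
    using that[OF s(1) t(1)] s(2) t(2) by simp
qed

lemma second_derivative_symmetric:
  fixes f :: "'a::euclidean_space \<Rightarrow> real"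
  assumes S: "open S" and f: "Cinf_on S f" and x: "x \<in> S"
  shows "frechet_derivative (\<lambda>y. frechet_derivative f (at y) u) (at x) v
       = frechet_derivative (\<lambda>y. frechet_derivative f (at y) v) (at x) u"
proof -
  define A where "A y = frechet_derivative (\<lambda>y. frechet_derivative f (at y) u) (at y) v" for y
  define B where "B y = frechet_derivative (\<lambda>y. frechet_derivative f (at y) v) (at y) u" for y
  have "continuous_on S A" "continuous_on S B"
    unfolding A_def B_def by (intro Cinf_on_imp_continuous_on Cinf_on_derivative f)+
  then have "isCont A x" "isCont B x"
    using S x by (auto simp: continuous_on_eq_continuous_at)
  have "dist (A x) (B x) \<le> e" if "e > 0" for e
  proof -
    have "\<forall>\<^sub>F y in nhds x. dist (A y) (A x) < e/2" "\<forall>\<^sub>F y in nhds x. dist (B y) (B x) < e/2"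
      using \<open>isCont A x\<close> \<open>isCont B x\<close> \<open>e > 0\<close>
        tendstoD[of A "A x" "nhds x" "e/2"] tendstoD[of B "B x" "nhds x" "e/2"]
      by (simp_all only: isCont_def tendsto_at_iff_tendsto_nhds half_gt_zero)
    moreover have "\<forall>\<^sub>F y in nhds x. y \<in> S" using S x by (rule eventually_nhds_in_open)
    ultimately have "\<forall>\<^sub>F y in nhds x. y \<in> S \<and> dist (A y) (A x) < e/2 \<and> dist (B y) (B x) < e/2"
      by eventually_elim simp
    then obtain d where d: "d > 0"
      "\<And>y. dist y x < d \<Longrightarrow> y \<in> S \<and> dist (A y) (A x) < e/2 \<and> dist (B y) (B x) < e/2"
      unfolding eventually_nhds_metric by auto
    define N where "N = norm u + norm v"
    have N: "N \<ge> 0" by (simp add: N_def)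
    \<comment> \<open>Small enough that the whole parallelogram with sides
      \<open>h *\<^sub>R u\<close> and \<open>h *\<^sub>R v\<close> stays within distance
      \<open>d\<close> of \<open>x\<close>; the added 1 covers the case that both vectors
      vanish.\<close>
    define h where "h = d / (2 * (N + 1))"
    have h: "h > 0" using d(1) N by (simp add: h_def)
    have near: "dist (x + s *\<^sub>R u + t *\<^sub>R v) x < d" if "s \<in> {0..h}" "t \<in> {0..h}" for s t
    proof -
      have "norm (s *\<^sub>R u + t *\<^sub>R v) \<le> h * norm u + h * norm v"
        using that by (intro norm_triangle_mono) (auto intro: mult_right_mono)
      also have "\<dots> = h * N" by (simp add: N_def distrib_left)
      also have "\<dots> < h * (2 * (N + 1))"
        using h N by (intro mult_strict_left_mono) auto
      also have "\<dots> = d" using N by (simp add: h_def)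
      finally show ?thesis by (simp add: dist_norm add.assoc)
    qed
    have near': "dist (x + s *\<^sub>R v + t *\<^sub>R u) x < d" if "s \<in> {0..h}" "t \<in> {0..h}" for s t
      using near[OF that(2,1)] by (simp add: add_ac)
    obtain s t where st: "s \<in> {0..h}" "t \<in> {0..h}"
      "f (x + h *\<^sub>R u + h *\<^sub>R v) - f (x + h *\<^sub>R u) - f (x + h *\<^sub>R v) + f x
       = h * (h * A (x + s *\<^sub>R u + t *\<^sub>R v))"
      unfolding A_def
      by (rule mixed_difference_mean_value[OF Cinf_onD[OF f] h, of x u v]) (use d(2) near in auto)
    obtain s' t' where st': "s' \<in> {0..h}" "t' \<in> {0..h}"
      "f (x + h *\<^sub>R v + h *\<^sub>R u) - f (x + h *\<^sub>R v) - f (x + h *\<^sub>R u) + f x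
       = h * (h * B (x + s' *\<^sub>R v + t' *\<^sub>R u))"
      unfolding B_def
      by (rule mixed_difference_mean_value[OF Cinf_onD[OF f] h, of x v u]) (use d(2) near' in auto)
    have "x + h *\<^sub>R v + h *\<^sub>R u = x + h *\<^sub>R u + h *\<^sub>R v" by (simp add: add_ac)
    then have "h * (h * A (x + s *\<^sub>R u + t *\<^sub>R v)) = h * (h * B (x + s' *\<^sub>R v + t' *\<^sub>R u))"
      using st(3) st'(3) by (metis (no_types, opaque_lifting) add.commute diff_diff_eq)
    then have "A (x + s *\<^sub>R u + t *\<^sub>R v) = B (x + s' *\<^sub>R v + t' *\<^sub>R u)" using h by simp
    moreover have "dist (A (x + s *\<^sub>R u + t *\<^sub>R v)) (A x) < e/2"
      "dist (B (x + s' *\<^sub>R v + t' *\<^sub>R u)) (B x) < e/2"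
      using d(2) near[OF st(1,2)] near'[OF st'(1,2)] by auto
    ultimately show ?thesis
      by (metis dist_triangle_half_r less_imp_le)
  qed
  then have "A x = B x" by (metis dist_le_zero_iff field_le_epsilon add_0)
  then show ?thesis by (simp add: A_def B_def)
qed

section \<open>Multilinear forms\<close>

lemma multilinear_Suc_iff:
  "multilinear (Suc n) T \<longleftrightarrow>
    (\<forall>xs. length xs = n \<longrightarrow> linear (\<lambda>x. T (x # xs))) \<and> (\<forall>x. multilinear n (\<lambda>xs. T (x # xs)))"
proof (intro iffI conjI allI impI)
  fix xs :: "'a list" assume T: "multilinear (Suc n) T" and "length xs = n"
  then show "linear (\<lambda>x. T (x # xs))"
    using T[unfolded multilinear_def, rule_format, of "undefined # xs" 0] by simp
next
  fix x assume T: "multilinear (Suc n) T"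
  show "multilinear n (\<lambda>xs. T (x # xs))"
    unfolding multilinear_def
  proof (intro allI impI)
    fix xs :: "'a list" and i assume "length xs = n \<and> i < n"
    then have "linear (\<lambda>y. T ((x # xs)[Suc i := y]))"
      using T[unfolded multilinear_def, rule_format, of "x # xs" "Suc i"] by simp
    then show "linear (\<lambda>y. T (x # xs[i := y]))" by simp
  qed
next
  assume *: "(\<forall>xs. length xs = n \<longrightarrow> linear (\<lambda>x. T (x # xs))) \<and> (\<forall>x. multilinear n (\<lambda>xs. T (x # xs)))"
  show "multilinear (Suc n) T"
    unfolding multilinear_def
  proof (intro allI impI)
    fix xs :: "'a list" and i assume xs: "length xs = Suc n \<and> i < Suc n"
    then obtain y ys where ys: "xs = y # ys" "length ys = n" by (metis length_Suc_conv)
    show "linear (\<lambda>x. T (xs[i := x]))"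
      using * xs ys by (cases i) (auto simp: multilinear_def)
  qed
qed

lemma multilinear_map:
  assumes "multilinear n T" "linear f"
  shows "multilinear n (\<lambda>xs. T (map f xs))"
  unfolding multilinear_def
proof (intro allI impI)
  fix xs :: "'b list" and i assume xs: "length xs = n \<and> i < n"
  then have "linear (\<lambda>y. T ((map f xs)[i := y]))"
    using assms(1) unfolding multilinear_def by simp
  from linear_compose[OF assms(2) this] show "linear (\<lambda>x. T (map f (xs[i := x])))"
    by (simp add: o_def map_update)
qed

lemma multilinear_scale: "multilinear n T \<Longrightarrow> multilinear n (\<lambda>xs. c * T xs)"
  unfolding multilinear_def
proof (intro allI impI)
  fix xs :: "'a list" and i
  assume "\<forall>xs i. length xs = n \<and> i < n \<longrightarrow> linear (\<lambda>x. T (xs[i := x]))" "length xs = n \<and> i < n"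
  then have l: "linear (\<lambda>x. T (xs[i := x]))" by blast
  show "linear (\<lambda>x. c * T (xs[i := x]))"
    by (intro linearI) (simp_all add: linear_add[OF l] linear_scale[OF l] distrib_left)
qed

lemma multilinear_eq_on_span:
  assumes "multilinear n T" "multilinear n U" "span B = UNIV"
    and "\<And>xs. length xs = n \<Longrightarrow> set xs \<subseteq> B \<Longrightarrow> T xs = U xs" and "length xs = n"
  shows "T xs = U xs"
  using assms(1,2,4,5)
proof (induction n arbitrary: T U xs)
  case (Suc n)
  obtain y ys where ys: "xs = y # ys" "length ys = n" using Suc.prems(4) by (metis length_Suc_conv)
  have "T (b # ys) = U (b # ys)" if "b \<in> B" for b
  proof (rule Suc.IH[of "\<lambda>xs. T (b # xs)" "\<lambda>xs. U (b # xs)"])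
    show "T (b # zs) = U (b # zs)" if "length zs = n" "set zs \<subseteq> B" for zs
      using Suc.prems(3)[of "b # zs"] that \<open>b \<in> B\<close> by simp
  qed (use Suc.prems(1,2) ys in \<open>simp_all add: multilinear_Suc_iff\<close>)
  moreover have "linear (\<lambda>x. T (x # ys))" "linear (\<lambda>x. U (x # ys))"
    using Suc.prems(1,2) ys by (simp_all add: multilinear_Suc_iff)
  ultimately show ?case
    using linear_eq_on_span[of "\<lambda>x. T (x # ys)" "\<lambda>x. U (x # ys)" B y] assms(3) ys by auto
qed simp

lemma multilinear_map_scaleR:
  "multilinear (length xs) T \<Longrightarrow> T (map (\<lambda>x. c x *\<^sub>R x) xs) = prod_list (map c xs) * T xs"
proof (induction xs arbitrary: T)
  case (Cons x xs)
  have l: "linear (\<lambda>y. T (y # map (\<lambda>x. c x *\<^sub>R x) xs))" and m: "multilinear (length xs) (\<lambda>xs. T (x # xs))"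
    using Cons.prems by (simp_all add: multilinear_Suc_iff)
  show ?case
    using linear_scale[OF l, of "c x" x] Cons.IH[OF m] by simp
qed simp

section \<open>Coordinates and bounds for multilinear forms\<close>

abbreviation basis_lists :: "nat \<Rightarrow> 'e::euclidean_space list set" where
  "basis_lists n \<equiv> {bs. length bs = n \<and> set bs \<subseteq> Basis}"

lemma finite_basis_lists: "finite (basis_lists n)"
  using finite_lists_length_eq[OF finite_Basis, of n] by (simp add: conj_commute)

lemma sum_basis_lists_Suc:
  "(\<Sum>bs\<in>basis_lists (Suc n). f bs) = (\<Sum>b\<in>Basis. \<Sum>bs\<in>basis_lists n. f (b # bs))"
proof -
  have e: "basis_lists (Suc n) = (\<lambda>(b, bs). b # bs) ` (Basis \<times> basis_lists n)"
    by (force simp: image_iff length_Suc_conv)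
  have i: "inj_on (\<lambda>(b, bs). b # bs) (Basis \<times> basis_lists n)"
    by (auto simp: inj_on_def)
  show ?thesis
    unfolding e sum.reindex[OF i] sum.cartesian_product by (simp add: case_prod_unfold o_def)
qed

lemma multilinear_expand:
  assumes "multilinear n T" "length xs = n"
  shows "T xs = (\<Sum>bs\<in>basis_lists n. (\<Prod>i<n. xs ! i \<bullet> bs ! i) * T bs)"
  using assms
proof (induction n arbitrary: T xs)
  case 0
  have "basis_lists 0 = {[] :: 'a list}" by auto
  with 0 show ?case by simp
next
  case (Suc n)
  obtain y ys where ys: "xs = y # ys" "length ys = n" using Suc.prems(2) by (metis length_Suc_conv)
  have "linear (\<lambda>x. T (x # ys))" using Suc.prems(1) ys by (simp add: multilinear_Suc_iff)
  then have "T (y # ys) = (\<Sum>b\<in>Basis. (y \<bullet> b) *\<^sub>R T (b # ys))"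
    by (rule linear_euclidean_expansion)
  also have "\<dots> = (\<Sum>b\<in>Basis. \<Sum>bs\<in>basis_lists n. (\<Prod>i<Suc n. xs ! i \<bullet> (b # bs) ! i) * T (b # bs))"
  proof (rule sum.cong[OF refl])
    fix b :: 'a
    have "multilinear n (\<lambda>xs. T (b # xs))" using Suc.prems(1) by (simp add: multilinear_Suc_iff)
    from Suc.IH[OF this ys(2)]
    show "(y \<bullet> b) *\<^sub>R T (b # ys) = (\<Sum>bs\<in>basis_lists n. (\<Prod>i<Suc n. xs ! i \<bullet> (b # bs) ! i) * T (b # bs))"
      unfolding prod.lessThan_Suc_shift by (simp add: ys sum_distrib_left mult.assoc del: prod.lessThan_Suc)
  qed
  also have "\<dots> = (\<Sum>bs\<in>basis_lists (Suc n). (\<Prod>i<Suc n. xs ! i \<bullet> bs ! i) * T bs)"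
    by (rule sum_basis_lists_Suc[symmetric])
  finally show ?case by (simp only: ys)
qed

lemma multilinear_bounded:
  fixes T :: "'e::euclidean_space list \<Rightarrow> real"
  assumes "multilinear n T"
  shows "\<exists>M\<ge>0. \<forall>xs. length xs = n \<longrightarrow> \<bar>T xs\<bar> \<le> M * prod_list (map norm xs)"
  using assms
proof (induction n arbitrary: T)
  case 0
  then show ?case by (intro exI[of _ "\<bar>T []\<bar>"]) simp
next
  case (Suc n)
  have "\<forall>b. \<exists>M\<ge>0. \<forall>xs. length xs = n \<longrightarrow> \<bar>T (b # xs)\<bar> \<le> M * prod_list (map norm xs)"
    using Suc.IH Suc.prems by (simp add: multilinear_Suc_iff)
  then obtain M where M: "\<And>b. M b \<ge> 0"
    "\<And>b xs. length xs = n \<Longrightarrow> \<bar>T (b # xs)\<bar> \<le> M b * prod_list (map norm xs)" by metis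
  have "\<bar>T (x # xs)\<bar> \<le> (\<Sum>b\<in>Basis. M b) * prod_list (map norm (x # xs))" if "length xs = n" for x xs
  proof -
    have "linear (\<lambda>x. T (x # xs))" using Suc.prems that by (simp add: multilinear_Suc_iff)
    then have "T (x # xs) = (\<Sum>b\<in>Basis. (x \<bullet> b) *\<^sub>R T (b # xs))"
      by (rule linear_euclidean_expansion)
    then have "\<bar>T (x # xs)\<bar> \<le> (\<Sum>b\<in>Basis. \<bar>(x \<bullet> b) *\<^sub>R T (b # xs)\<bar>)" by (simp only: sum_abs)
    also have "\<dots> \<le> (\<Sum>b\<in>Basis. norm x * (M b * prod_list (map norm xs)))"
      unfolding real_scaleR_def abs_mult
      by (intro sum_mono mult_mono Basis_le_norm M(2)[OF that]) auto
    also have "\<dots> = (\<Sum>b\<in>Basis. M b) * prod_list (map norm (x # xs))"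
      by (simp add: sum_distrib_left sum_distrib_right mult_ac)
    finally show ?thesis .
  qed
  moreover have "(\<Sum>b\<in>Basis. M b) \<ge> 0" using M(1) by (simp add: sum_nonneg)
  ultimately show ?case by (metis length_Suc_conv)
qed

section \<open>Slices for smooth linear representations\<close>

text \<open>\<open>P\<close> is the orthogonal projection onto the common kernel of the forms, and
  \<open>L\<close>, the sum of the rank one maps given by the gradients plus \<open>P\<close>, is
  symmetric and positive definite. The vectors \<open>q x\<close> are the images of the gradients
  under the inverse of \<open>L\<close>. Since \<open>L\<close> is symmetric and fixes the kernel,
  they are orthogonal to it. The forms may be linearly dependent, so \<open>q\<close> is not a dual
  basis.\<close>

lemma left_inverse_modulo_kernel:
  fixes l :: "'x \<Rightarrow> 'm::euclidean_space \<Rightarrow> real"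
  assumes I: "finite I" and lin: "\<And>x. x \<in> I \<Longrightarrow> linear (l x)"
  shows "\<exists>q P. linear P \<and> (\<forall>Z. (\<Sum>x\<in>I. l x Z *\<^sub>R q x) + P Z = Z) \<and>
    (\<forall>x\<in>I. \<forall>Z. l x (P Z) = 0 \<and> q x \<bullet> P Z = 0)"
proof -
  define K where "K = {Z. \<forall>x\<in>I. l x Z = 0}"
  have "subspace K"
    using lin unfolding K_def subspace_def by (auto simp: linear_0 linear_add linear_scale)
  then obtain B where B: "B \<subseteq> K" "pairwise orthogonal B" "\<And>b. b \<in> B \<Longrightarrow> norm b = 1"
      "independent B" "span B = K"
    using orthonormal_basis_subspace by metis
  have fB: "finite B" using B(4) by (rule independent_imp_finite)
  define P where "P Z = (\<Sum>b\<in>B. (Z \<bullet> b) *\<^sub>R b)" for Z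
  have linP: "linear P"
    unfolding P_def by (intro linearI) (simp_all add: inner_add_left scaleR_left_distrib sum.distrib scaleR_sum_right)
  have PK: "P Z \<in> K" for Z
    unfolding P_def B(5)[symmetric] by (intro span_sum span_scale span_base)
  have P_id: "P Z = Z" if "Z \<in> K" for Z
    unfolding P_def using orthonormal_basis_expand[OF B(2,3) _ fB] that B(5) by blast
  have Psym: "P U \<bullet> V = U \<bullet> P V" for U V
    unfolding P_def by (simp add: inner_sum_left inner_sum_right mult.commute inner_commute)
  define grad where "grad x = (\<Sum>e\<in>Basis. l x e *\<^sub>R e)" for x
  have grad: "Z \<bullet> grad x = l x Z" if "x \<in> I" for x Z
    using linear_euclidean_expansion[OF lin[OF that], of Z]
    by (simp add: grad_def inner_sum_right mult.commute)
  define L where "L Z = (\<Sum>x\<in>I. l x Z *\<^sub>R grad x) + P Z" for Z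
  have linL: "linear L"
    unfolding L_def using lin linP
    by (intro linearI)
      (simp_all add: linear_add linear_scale sum.distrib scaleR_left_distrib scaleR_sum_right scaleR_add_right)
  have Lsym: "L U \<bullet> V = U \<bullet> L V" for U V
    unfolding L_def
    by (simp add: inner_add_left inner_add_right inner_sum_left inner_sum_right Psym grad
        inner_commute[of "grad _"] mult.commute)
  have LK: "L Z = Z" if "Z \<in> K" for Z
    using that P_id[OF that] by (simp add: L_def K_def)
  have "Z = 0" if "L Z = 0" for Z
  proof -
    have "0 = Z \<bullet> L Z" using that by simp
    also have "\<dots> = (\<Sum>x\<in>I. (l x Z)\<^sup>2) + (\<Sum>b\<in>B. (Z \<bullet> b)\<^sup>2)"
      by (simp add: L_def P_def inner_add_right inner_sum_right grad power2_eq_square)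
    finally have s: "(\<Sum>x\<in>I. (l x Z)\<^sup>2) + (\<Sum>b\<in>B. (Z \<bullet> b)\<^sup>2) = 0" by simp
    then have "(\<Sum>x\<in>I. (l x Z)\<^sup>2) = 0"
      by (metis add_nonneg_eq_0_iff sum_nonneg zero_le_power2)
    then have "Z \<in> K" using I by (simp add: sum_nonneg_eq_0_iff K_def)
    with LK that show "Z = 0" by simp
  qed
  then have injL: "inj L" using linear_injective_0[OF linL] by blast
  then obtain M where M: "linear M" "\<And>Z. M (L Z) = Z" "\<And>Z. L (M Z) = Z"
    using linear_injective_isomorphism[OF linL] by blast
  show ?thesis
  proof (intro exI[of _ "\<lambda>x. M (grad x)"] exI[of _ P] conjI allI ballI linP)
    fix Z
    have "L ((\<Sum>x\<in>I. l x Z *\<^sub>R M (grad x)) + P Z) = L Z"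
      using LK[OF PK] by (simp add: linear_add[OF linL] linear_sum[OF linL] linear_scale[OF linL] M(3) L_def[of Z])
    then show "(\<Sum>x\<in>I. l x Z *\<^sub>R M (grad x)) + P Z = Z"
      using injL by (simp add: inj_eq)
  next
    fix x Z assume x: "x \<in> I"
    show l0: "l x (P Z) = 0" using PK[of Z] x by (simp add: K_def)
    have "M (grad x) \<bullet> P Z = L (P Z) \<bullet> M (grad x)" by (simp add: LK[OF PK] inner_commute)
    also have "\<dots> = P Z \<bullet> grad x" by (simp only: Lsym M(3))
    also have "\<dots> = 0" using l0 grad[OF x] by simp
    finally show "M (grad x) \<bullet> P Z = 0" .
  qed
qed

lemma linear_scaleR_const: "linear f \<Longrightarrow> linear (\<lambda>x. f x *\<^sub>R c)" for f :: "'a::real_vector \<Rightarrow> real"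
  by (intro linearI) (simp_all add: linear_add linear_scale scaleR_left_distrib)

section \<open>Derivatives of implicitly defined maps and of inverse operators\<close>

lemma has_derivative_zero_bound:
  fixes f :: "'a::real_normed_vector \<Rightarrow> 'b::real_normed_vector" and h :: "'a \<Rightarrow> 'c::real_normed_vector"
  assumes h: "(h has_derivative (\<lambda>_. 0)) (at a)" "h a = 0"
    and bound: "\<forall>\<^sub>F x in nhds a. norm (f x) \<le> C * norm (h x)"
  shows "(f has_derivative (\<lambda>_. 0)) (at a)"
proof -
  have fa: "f a = 0" using eventually_nhds_x_imp_x[OF bound] h(2) by simp
  have "((\<lambda>x. C * (norm (h x) / norm (x - a))) \<longlongrightarrow> C * 0) (at a)"
    using h by (intro tendsto_mult tendsto_const) (simp add: has_derivative_iff_norm)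
  moreover have "\<forall>\<^sub>F x in at a. norm (norm (f x) / norm (x - a)) \<le> C * (norm (h x) / norm (x - a))"
    using bound unfolding eventually_at_filter
  proof eventually_elim
    case (elim x)
    then show ?case using divide_right_mono[of "norm (f x)" "C * norm (h x)" "norm (x - a)"] by simp
  qed
  ultimately have "((\<lambda>x. norm (f x) / norm (x - a)) \<longlongrightarrow> 0) (at a)"
    using Lim_null_comparison[of "\<lambda>x. norm (f x) / norm (x - a)"] by simp
  then show ?thesis using fa by (simp add: has_derivative_iff_norm bounded_linear_zero)
qed

text \<open>\<open>Y\<close> is a first order guess for the solution \<open>\<Psi>\<close> of an
  equation and \<open>h\<close> is the residual of the guess. If the residual vanishes to first
  order and controls the error, then the guess has the right derivative. This serves for inverse
  operators and for \<open>sol\<close>.\<close>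

lemma implicit_has_derivative:
  fixes Y \<Psi> :: "'a::real_normed_vector \<Rightarrow> 'b::real_normed_vector"
  assumes Y: "(Y has_derivative Y') (at a)" "Y a = \<Psi> a"
    and h: "(h has_derivative (\<lambda>_. 0)) (at a)" "h a = 0"
    and bound: "\<forall>\<^sub>F x in nhds a. norm (\<Psi> x - Y x) \<le> C * norm (h x)"
  shows "(\<Psi> has_derivative Y') (at a)"
  using has_derivative_add[OF Y(1) has_derivative_zero_bound[OF h bound]] by simp

lemma lower_bound_imp_bij:
  fixes B :: "'m::euclidean_space \<Rightarrow> 'm"
  assumes "linear B" "\<And>Z. norm Z \<le> C * norm (B Z)"
  shows "bij B" "linear (inv B)" "norm (inv B Z) \<le> C * norm Z" "B (inv B Z) = Z"
proof -
  have "inj B" using linear_injective_0[OF assms(1)] assms(2) by (metis mult_zero_right norm_le_zero_iff norm_zero)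
  then show b: "bij B" using linear_injective_imp_surjective[OF assms(1)] by (simp add: bij_def)
  show "linear (inv B)" by (rule linear_inv[OF assms(1) b])
  show e: "B (inv B Z) = Z" using b by (simp add: bij_is_surj surj_f_inv_f)
  show "norm (inv B Z) \<le> C * norm Z" using assms(2)[of "inv B Z"] e by simp
qed

text \<open>The derivative of the inverse is, up to sign, the inverse composed with the derivative
  of \<open>B\<close> and with the inverse again; hence smoothness of the inverse of order
  \<open>k\<close> gives order \<open>k + 1\<close>. The factor 2 is what an operator at distance at
  most one half from the identity satisfies.\<close>

lemma Ck_on_inverse_operator:
  fixes B :: "'p::euclidean_space \<Rightarrow> 'm::euclidean_space \<Rightarrow> 'm"
  assumes S: "open S" and lin: "\<And>p. p \<in> S \<Longrightarrow> linear (B p)"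
    and lower: "\<And>p Z. p \<in> S \<Longrightarrow> norm Z \<le> 2 * norm (B p Z)"
  shows "(\<And>Z. Ck_on k S (\<lambda>p. B p Z)) \<Longrightarrow> Ck_on k S (\<lambda>p. inv (B p) Z)"
proof (induction k arbitrary: Z)
  case 0
  have "isCont (\<lambda>p. inv (B p) Z) p1" if p1: "p1 \<in> S" for p1
  proof -
    note b1 = lower_bound_imp_bij[OF lin lower, OF p1 p1]
    have "isCont (\<lambda>p. B p (inv (B p1) Z)) p1"
      using 0 S p1 by (simp add: continuous_on_eq_continuous_at)
    then have "((\<lambda>p. 2 * norm (Z - B p (inv (B p1) Z))) \<longlongrightarrow> 2 * norm (Z - B p1 (inv (B p1) Z))) (at p1)"
      by (intro tendsto_intros) (simp add: isCont_def)
    then have "((\<lambda>p. 2 * norm (Z - B p (inv (B p1) Z))) \<longlongrightarrow> 0) (at p1)"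
      using b1(4) by simp
    moreover have "\<forall>\<^sub>F p in at p1. norm (inv (B p) Z - inv (B p1) Z) \<le> 2 * norm (Z - B p (inv (B p1) Z))"
    proof -
      have "\<forall>\<^sub>F p in at p1. p \<in> S" using S p1 by (simp add: eventually_at_in_open')
      then show ?thesis
      proof eventually_elim
        case (elim p)
        then show ?case
          using lower[of p "inv (B p) Z - inv (B p1) Z"] lower_bound_imp_bij(4)[OF lin lower, of p Z]
          by (simp add: linear_diff[OF lin])
      qed
    qed
    ultimately have "((\<lambda>p. inv (B p) Z - inv (B p1) Z) \<longlongrightarrow> 0) (at p1)"
      by (rule Lim_null_comparison[rotated])
    then show ?thesis by (simp add: isCont_def LIM_zero_iff)
  qed
  then show ?case by (simp add: continuous_at_imp_continuous_on)
next
  case (Suc k)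
  have IH: "Ck_on k S (\<lambda>p. inv (B p) Z)" for Z
    by (rule Suc.IH) (rule Ck_on_Suc_imp[OF Suc.prems])
  define D where "D p v Z = frechet_derivative (\<lambda>p. B p Z) (at p) v" for p v Z
  have D: "((\<lambda>p. B p Z) has_derivative (\<lambda>v. D p v Z)) (at p)" if "p \<in> S" for p Z
    unfolding D_def using Ck_on_Suc_imp_has_derivative[OF Suc.prems that] .
  \<comment> \<open>The derivative of \<open>B\<close> in direction \<open>v\<close> applied to
    \<open>W\<close>, written in coordinates so that \<open>W\<close> may vary with the point
    without leaving \<open>Ck_on\<close>.\<close>
  define E where "E p v W = (\<Sum>b\<in>Basis. (W \<bullet> b) *\<^sub>R D p v b)" for p v W
  have inv_expand: "inv (B p) W = (\<Sum>b\<in>Basis. (W \<bullet> b) *\<^sub>R inv (B p) b)" if "p \<in> S" for p W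
    using linear_euclidean_expansion lower_bound_imp_bij(2)[OF lin lower, OF that that] by blast
  show ?case
  proof (rule Ck_on_SucI[OF S])
    fix p1 assume p1: "p1 \<in> S"
    note b1 = lower_bound_imp_bij[OF lin lower, OF p1 p1]
    define W where "W = inv (B p1) Z"
    let ?T = "\<lambda>v. - inv (B p1) (E p1 v W)"
    have linE: "linear (\<lambda>v. E p1 v W)"
      unfolding E_def using D[OF p1, THEN has_derivative_linear]
      by (intro linear_compose_sum ballI linear_compose_scale_right) auto
    have linT: "linear ?T"
      using linear_compose[OF linE b1(2)] by (intro linear_compose_neg) (simp add: o_def)
    have bT: "bounded_linear ?T" using linT by (rule linear_conv_bounded_linear[THEN iffD1])
    \<comment> \<open>The affine guess whose residual \<open>h\<close> vanishes to first order;
      \<open>lower\<close> turns the residual into a bound for the error.\<close>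
    define Y where "Y p = W + ?T (p - p1)" for p
    have Y': "(Y has_derivative ?T) (at p1)"
      unfolding Y_def
      by (rule has_derivative_eq_rhs[OF has_derivative_add[OF has_derivative_const
            bounded_linear.has_derivative[OF bT has_derivative_diff[OF has_derivative_ident has_derivative_const]]]]) simp
    have T0: "?T 0 = 0" using linT by (rule linear_0)
    have Yp1: "Y p1 = W" using T0 by (simp add: Y_def)
    define h where "h p = (\<Sum>b\<in>Basis. (Y p \<bullet> b) *\<^sub>R B p b) - Z" for p
    have h: "h p = B p (Y p) - Z" if "p \<in> S" for p
      using linear_euclidean_expansion[OF lin[OF that]] unfolding h_def by metis
    have "(h has_derivative (\<lambda>v. (\<Sum>b\<in>Basis. (Y p1 \<bullet> b) *\<^sub>R D p1 v b + (?T v \<bullet> b) *\<^sub>R B p1 b) - 0)) (at p1)"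
      unfolding h_def
      by (intro has_derivative_diff has_derivative_sum has_derivative_scaleR has_derivative_inner_left
          Y' D[OF p1] has_derivative_const)
    moreover have "(\<Sum>b\<in>Basis. (Y p1 \<bullet> b) *\<^sub>R D p1 v b + (?T v \<bullet> b) *\<^sub>R B p1 b) - 0 = 0" for v
    proof -
      have "(\<Sum>b\<in>Basis. (?T v \<bullet> b) *\<^sub>R B p1 b) = B p1 (?T v)"
        using linear_euclidean_expansion[OF lin[OF p1]] by metis
      also have "\<dots> = - E p1 v W" using b1(4) by (simp add: linear_neg[OF lin[OF p1]])
      finally have e: "(\<Sum>b\<in>Basis. (?T v \<bullet> b) *\<^sub>R B p1 b) = - E p1 v W" .
      show ?thesis unfolding sum.distrib e Yp1 by (simp add: E_def)
    qed
    ultimately have h': "(h has_derivative (\<lambda>_. 0)) (at p1)" by (simp only:)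
    have h0: "h p1 = 0" using h[OF p1] b1(4) Yp1 W_def by simp
    have "norm (inv (B p) Z - Y p) \<le> 2 * norm (h p)" if "p \<in> S" for p
      using lower[OF that, of "inv (B p) Z - Y p"] lower_bound_imp_bij(4)[OF lin lower, OF that that, of Z]
      by (simp add: h[OF that] linear_diff[OF lin[OF that]] norm_minus_commute)
    then have bd: "\<forall>\<^sub>F p in nhds p1. norm (inv (B p) Z - Y p) \<le> 2 * norm (h p)"
      using eventually_nhds_in_open[OF S p1] by (rule eventually_mono[rotated])
    have "((\<lambda>p. inv (B p) Z) has_derivative ?T) (at p1)"
      using implicit_has_derivative[OF Y' _ h' h0 bd] Yp1 W_def by simp
    moreover have "?T v = - (\<Sum>b\<in>Basis. (E p1 v W \<bullet> b) *\<^sub>R inv (B p1) b)" for v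
      by (subst inv_expand[OF p1, of "E p1 v W"]) (rule refl)
    ultimately show "((\<lambda>p. inv (B p) Z) has_derivative
        (\<lambda>v. - (\<Sum>b\<in>Basis. (E p1 v (inv (B p1) Z) \<bullet> b) *\<^sub>R inv (B p1) b))) (at p1)"
      by (simp only: W_def)
  next
    fix v
    have "Ck_on k S (\<lambda>p. D p v b)" for b
      using Suc.prems unfolding D_def by simp
    then have "Ck_on k S (\<lambda>p. E p v (inv (B p) Z))"
      unfolding E_def by (intro Ck_on_sum[OF S] Ck_on_scaleR[OF S] Ck_on_inner_const[OF S] IH)
    then show "Ck_on k S (\<lambda>p. - (\<Sum>b\<in>Basis. (E p v (inv (B p) Z) \<bullet> b) *\<^sub>R inv (B p) b))"
      by (intro Ck_on_bounded_linear_compose[OF bounded_linear_minus[OF bounded_linear_ident] S]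
          Ck_on_sum[OF S] Ck_on_scaleR[OF S] Ck_on_inner_const[OF S] IH)
  qed
qed

text \<open>The fibres are disjoint nonempty open sets, and a second countable space has only
  countably many of these.\<close>

lemma countable_image_locally_constant:
  fixes f :: "'a::second_countable_topology \<Rightarrow> 'b"
  assumes "\<And>x. x \<in> S \<Longrightarrow> \<exists>U. open U \<and> x \<in> U \<and> U \<subseteq> S \<and> (\<forall>y\<in>U. f y = f x)"
  shows "countable (f ` S)"
proof -
  let ?F = "\<lambda>c. {x\<in>S. f x = c}"
  have "countable (?F ` f ` S)"
  proof (rule countable_disjoint_open_subsets)
    fix T assume "T \<in> ?F ` f ` S"
    then obtain c where T: "T = ?F c" by blast
    show "open T" unfolding T
    proof (rule Topological_Spaces.openI)
      fix x assume x: "x \<in> ?F c"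
      then obtain U where "open U" "x \<in> U" "U \<subseteq> S" "\<forall>y\<in>U. f y = f x" using assms by blast
      moreover from this x have "U \<subseteq> ?F c" by blast
      ultimately show "\<exists>U. open U \<and> x \<in> U \<and> U \<subseteq> ?F c" by blast
    qed
  next
    show "pairwise disjnt (?F ` f ` S)" by (auto simp: pairwise_def disjnt_def)
  qed
  moreover have "inj_on ?F (f ` S)" by (auto simp: inj_on_def)
  ultimately show ?thesis by (simp add: countable_image_inj_eq)
qed

section \<open>Smooth linear representations of the units of an algebra\<close>

text \<open>The group consists of the units of an associative algebra on a Euclidean space, so that
  derivatives along the group are ordinary derivatives in a vector space. \<open>\<rho>\<close>
  holds the matrix entries of the representation, as functions on the whole algebra.\<close>

locale smooth_representation =
  fixes mul :: "'m::euclidean_space \<Rightarrow> 'm \<Rightarrow> 'm" and one :: 'm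
    and I :: "'x set" and \<rho> :: "'x \<Rightarrow> 'x \<Rightarrow> 'm \<Rightarrow> real"
  assumes bilin: "bounded_bilinear mul"
    and assoc: "mul (mul a b) c = mul a (mul b c)"
    and one_left [simp]: "mul one a = a" and one_right [simp]: "mul a one = a"
    and finite_I: "finite I"
    and smooth: "x \<in> I \<Longrightarrow> y \<in> I \<Longrightarrow> Cinf_on UNIV (\<rho> x y)"
    and rho_mul: "x \<in> I \<Longrightarrow> z \<in> I \<Longrightarrow> \<rho> x z (mul a b) = (\<Sum>y\<in>I. \<rho> x y a * \<rho> y z b)"
    and rho_one: "x \<in> I \<Longrightarrow> z \<in> I \<Longrightarrow> \<rho> x z one = (if x = z then 1 else 0)"
begin

definition act :: "'m \<Rightarrow> ('x \<Rightarrow> real) \<Rightarrow> 'x \<Rightarrow> real" where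
  "act a y x = (if x \<in> I then \<Sum>z\<in>I. \<rho> x z a * y z else 0)"

text \<open>The derivative at \<open>a\<close> in direction \<open>Z\<close> of coordinate
  \<open>x\<close> of the orbit map through \<open>y\<close>. At \<open>a = one\<close> this is the
  infinitesimal action, whose kernel is the Lie algebra of the stabilizer.\<close>

definition dact :: "'m \<Rightarrow> ('x \<Rightarrow> real) \<Rightarrow> 'x \<Rightarrow> 'm \<Rightarrow> real" where
  "dact a y x Z = (\<Sum>z\<in>I. frechet_derivative (\<rho> x z) (at a) Z * y z)"

lemma act_outside [simp]: "x \<notin> I \<Longrightarrow> act a y x = 0"
  by (simp add: act_def)

lemma act_mul: "act (mul a b) y = act a (act b y)"
proof
  fix x
  have "(\<Sum>z\<in>I. (\<Sum>v\<in>I. \<rho> x v a * \<rho> v z b) * y z) = (\<Sum>v\<in>I. \<rho> x v a * (\<Sum>z\<in>I. \<rho> v z b * y z))"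
    by (simp add: sum_distrib_left sum_distrib_right mult.assoc) (rule sum.swap)
  then show "act (mul a b) y x = act a (act b y) x"
    by (simp add: act_def rho_mul)
qed

lemma act_one: "(\<And>x. x \<notin> I \<Longrightarrow> y x = 0) \<Longrightarrow> act one y = y"
  using finite_I by (auto simp: act_def rho_one fun_eq_iff if_distrib[of "\<lambda>c. c * _"] cong: if_cong)

lemma rho_has_derivative:
  "x \<in> I \<Longrightarrow> z \<in> I \<Longrightarrow> (\<rho> x z has_derivative frechet_derivative (\<rho> x z) (at a)) (at a)"
  using Cinf_on_has_derivative[OF smooth] by blast

lemma act_has_derivative:
  assumes "x \<in> I"
  shows "((\<lambda>a. act a y x) has_derivative dact a y x) (at a)"
  unfolding act_def dact_def using assms
  by (auto intro!: has_derivative_sum has_derivative_mult_left rho_has_derivative)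

lemma linear_dact: "x \<in> I \<Longrightarrow> linear (dact a y x)"
  using act_has_derivative has_derivative_linear by blast

text \<open>Differentiation of \<open>act a (act c y) = act (mul a c) y\<close> in \<open>a\<close>.
  It moves the point along the orbit at the price of translating the direction, and so reduces
  derivatives at any unit to derivatives at \<open>one\<close>.\<close>

lemma dact_translate_right:
  assumes "x \<in> I"
  shows "dact b (act c y) x Z = dact (mul b c) y x (mul Z c)"
proof -
  have "((\<lambda>a. act a (act c y) x) has_derivative (\<lambda>Z. dact (mul b c) y x (mul Z c))) (at b)"
    unfolding act_mul[symmetric]
    using has_derivative_compose[OF _ act_has_derivative[OF assms], of "\<lambda>a. mul a c"]
      bounded_linear_imp_has_derivative[OF bounded_bilinear.bounded_linear_left[OF bilin]] by blast
  then show ?thesis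
    using has_derivative_unique[OF act_has_derivative[OF assms]] by metis
qed

lemma dact_translate_left:
  assumes "x \<in> I"
  shows "dact (mul c a) y x (mul c Z) = (\<Sum>z\<in>I. \<rho> x z c * dact a y z Z)"
proof -
  have d: "((\<lambda>a. act (mul c a) y x) has_derivative (\<lambda>Z. dact (mul c a) y x (mul c Z))) (at a)"
    using has_derivative_compose[OF _ act_has_derivative[OF assms], of "\<lambda>a. mul c a"]
      bounded_linear_imp_has_derivative[OF bounded_bilinear.bounded_linear_right[OF bilin]] by blast
  have e: "(\<lambda>a. act (mul c a) y x) = (\<lambda>a. \<Sum>z\<in>I. \<rho> x z c * act a y z)"
    using assms by (simp add: act_mul act_def[of c])
  have "((\<lambda>a. \<Sum>z\<in>I. \<rho> x z c * act a y z) has_derivative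
      (\<lambda>Z. \<Sum>z\<in>I. \<rho> x z c * dact a y z Z)) (at a)"
    by (intro has_derivative_sum has_derivative_mult_right act_has_derivative)
  from has_derivative_unique[OF d this[folded e]] show ?thesis by (rule fun_cong)
qed

text \<open>Conjugation by \<open>c\<close> carries the Lie algebra of the stabilizer of \<open>w\<close> to that of \<open>c w\<close>.\<close>

lemma dact_conjugate:
  assumes "x \<in> I" "mul c' c = one"
  shows "dact one (act c w) x (mul (mul c U) c') = (\<Sum>z\<in>I. \<rho> x z c * dact one w z U)"
  using dact_translate_right[OF assms(1), of one c w "mul (mul c U) c'"]
    dact_translate_left[OF assms(1), of c one w U] assms(2) by (simp add: assoc)

text \<open>If \<open>X\<close> is small, left and right multiplication by \<open>one + X\<close>
  differ from the identity by at most one half, so both are bijective; a left and a right inverse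
  agree by associativity. \<open>K\<close> is a norm bound for \<open>mul\<close>, whence the radius
  \<open>1 / (2 * K)\<close>.\<close>

lemma unit_near_one:
  obtains e where "e > 0" "\<And>X. norm X \<le> e \<Longrightarrow> \<exists>b. mul (one + X) b = one \<and> mul b (one + X) = one"
proof -
  obtain K where K: "K > 0" "\<And>a b. norm (mul a b) \<le> norm a * norm b * K"
    using bounded_bilinear.pos_bounded[OF bilin] by blast
  interpret mul: bounded_bilinear mul by (rule bilin)
  have "\<exists>b. mul (one + X) b = one \<and> mul b (one + X) = one" if X: "norm X \<le> 1 / (2 * K)" for X
  proof -
    have small: "norm X * K \<le> 1/2" using X K(1) by (simp add: field_simps)
    have "norm Z \<le> 2 * norm (mul (one + X) Z)" "norm Z \<le> 2 * norm (mul Z (one + X))" for Z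
    proof -
      have *: "norm X * norm Z * K \<le> norm Z / 2" "norm Z * norm X * K \<le> norm Z / 2"
        using mult_right_mono[OF small, of "norm Z"] by (simp_all add: algebra_simps)
      have "norm (mul X Z) \<le> norm Z / 2" "norm (mul Z X) \<le> norm Z / 2"
        using K(2)[of X Z] K(2)[of Z X] * by linarith+
      moreover have "norm Z \<le> norm (Z + mul X Z) + norm (mul X Z)" "norm Z \<le> norm (Z + mul Z X) + norm (mul Z X)"
        using norm_triangle_ineq4[of "Z + mul X Z" "mul X Z"] norm_triangle_ineq4[of "Z + mul Z X" "mul Z X"] by simp_all
      ultimately show "norm Z \<le> 2 * norm (mul (one + X) Z)" "norm Z \<le> 2 * norm (mul Z (one + X))"
        by (simp_all add: mul.add_left mul.add_right)
    qed
    note bounds = this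
    have l: "linear (\<lambda>Z. mul (one + X) Z)" "linear (\<lambda>Z. mul Z (one + X))"
      by (auto intro!: linearI simp: mul.add_left mul.add_right mul.scaleR_left mul.scaleR_right algebra_simps)
    obtain b where b: "mul (one + X) b = one"
      using lower_bound_imp_bij(4)[OF l(1) bounds(1)] by blast
    obtain c where c: "mul c (one + X) = one"
      using lower_bound_imp_bij(4)[OF l(2) bounds(2)] by blast
    have "c = mul c (mul (one + X) b)" using b by simp
    also have "\<dots> = b" using c by (simp add: assoc[symmetric])
    finally show ?thesis using b c by blast
  qed
  then show thesis using that[of "1 / (2 * K)"] K(1) by simp
qed

end

text \<open>The data from which a slice through \<open>w\<close> is built: \<open>P\<close> is the projection onto the Lie algebra of
  the stabilizer of \<open>w\<close>, and \<open>q\<close> selects coordinates that are transversal to it. For \<open>y\<close> in \<open>V\<close> the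
  equation \<open>\<Gamma> y X = 0\<close> has a unique small solution \<open>X\<close>, and \<open>act (one + X) y\<close> is the projection of \<open>y\<close>
  to the slice along the orbits.\<close>

locale representation_slice = smooth_representation mul one I \<rho>
  for mul :: "'m::euclidean_space \<Rightarrow> 'm \<Rightarrow> 'm" and one :: 'm
    and I :: "'x set" and \<rho> :: "'x \<Rightarrow> 'x \<Rightarrow> 'm \<Rightarrow> real" +
  fixes w :: "'x \<Rightarrow> real" and q :: "'x \<Rightarrow> 'm" and P :: "'m \<Rightarrow> 'm" and \<epsilon> :: real and V :: "('x \<Rightarrow> real) set"
  assumes w_outside: "x \<notin> I \<Longrightarrow> w x = 0"
    and linear_P: "linear P"
    and dact_P: "x \<in> I \<Longrightarrow> dact one w x (P Z) = 0"
    and q_orthogonal: "x \<in> I \<Longrightarrow> q x \<bullet> P Z = 0"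
    and eps: "\<epsilon> > 0"
    and open_V: "open V" and w_in_V: "w \<in> V"
    and near_id: "norm X \<le> \<epsilon> \<Longrightarrow> y \<in> V \<Longrightarrow>
      norm (Z - ((\<Sum>x\<in>I. dact (one + X) y x Z *\<^sub>R q x) + P Z)) \<le> norm Z / 2"
    and start: "y \<in> V \<Longrightarrow> norm (\<Sum>x\<in>I. (act one y x - w x) *\<^sub>R q x) < \<epsilon> / 2"
    and unit: "norm X \<le> \<epsilon> \<Longrightarrow> \<exists>b. mul (one + X) b = one \<and> mul b (one + X) = one"
begin

section \<open>The projection to the slice: existence, uniqueness and smoothness\<close>

definition \<Gamma> :: "('x \<Rightarrow> real) \<Rightarrow> 'm \<Rightarrow> 'm" where
  "\<Gamma> y X = (\<Sum>x\<in>I. (act (one + X) y x - w x) *\<^sub>R q x) + P X"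

text \<open>The derivative of \<open>\<Gamma> y\<close> at \<open>X\<close>. At \<open>X = 0\<close>
  and \<open>y = w\<close> it would be the identity for the \<open>q\<close> and \<open>P\<close>
  that are constructed later; the locale only records that it stays within one half of it.\<close>

definition B :: "('x \<Rightarrow> real) \<Rightarrow> 'm \<Rightarrow> 'm \<Rightarrow> 'm" where
  "B y X Z = (\<Sum>x\<in>I. dact (one + X) y x Z *\<^sub>R q x) + P Z"

definition sol :: "('x \<Rightarrow> real) \<Rightarrow> 'm" where
  "sol y = (SOME X. norm X < \<epsilon> \<and> \<Gamma> y X = 0)"

definition \<nu> :: "('x \<Rightarrow> real) \<Rightarrow> 'x \<Rightarrow> real" where
  "\<nu> y = act (one + sol y) y"

lemma bounded_linear_P: "bounded_linear P"
  using linear_P by (rule linear_conv_bounded_linear[THEN iffD1])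

lemma linear_B: "linear (B y X)"
  unfolding B_def
  by (intro linear_compose_add linear_compose_sum ballI linear_scaleR_const linear_dact linear_P)

lemma B_near_id: "norm X \<le> \<epsilon> \<Longrightarrow> y \<in> V \<Longrightarrow> norm (Z - B y X Z) \<le> norm Z / 2"
  unfolding B_def by (rule near_id)

lemma B_lower:
  assumes "norm X \<le> \<epsilon>" "y \<in> V"
  shows "norm Z \<le> 2 * norm (B y X Z)"
  using B_near_id[OF assms, of Z] norm_triangle_sub[of Z "B y X Z"] by simp

lemma \<Gamma>_has_derivative: "(\<Gamma> y has_derivative B y X) (at X)"
proof -
  have "((\<lambda>X. act (one + X) y x) has_derivative dact (one + X) y x) (at X)" if "x \<in> I" for x
  proof -
    have "((\<lambda>X. one + X) has_derivative (\<lambda>Z. Z)) (at X)" by (auto intro!: derivative_eq_intros)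
    from has_derivative_compose[OF this act_has_derivative[OF that]] show ?thesis .
  qed
  then show ?thesis
    unfolding \<Gamma>_def[abs_def] B_def[abs_def]
    by (intro has_derivative_add has_derivative_sum has_derivative_scaleR_left
        bounded_linear_imp_has_derivative[OF bounded_linear_P])
      (auto intro!: derivative_eq_intros)
qed

text \<open>The derivative of \<open>X - \<Gamma> y X\<close> is the identity minus
  \<open>B y X\<close>, of norm at most one half on the ball, which is convex.\<close>

lemma contraction:
  assumes "y \<in> V" "norm X \<le> \<epsilon>" "norm X' \<le> \<epsilon>"
  shows "norm ((X - \<Gamma> y X) - (X' - \<Gamma> y X')) \<le> norm (X - X') / 2"
proof -
  have "norm ((\<lambda>X. X - \<Gamma> y X) X - (\<lambda>X. X - \<Gamma> y X) X') \<le> 1/2 * norm (X - X')"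
  proof (rule differentiable_bound[where S = "cball 0 \<epsilon>" and f' = "\<lambda>X Z. Z - B y X Z"])
    fix X :: 'm assume "X \<in> cball 0 \<epsilon>"
    then have X: "norm X \<le> \<epsilon>" by simp
    show "((\<lambda>X. X - \<Gamma> y X) has_derivative (\<lambda>Z. Z - B y X Z)) (at X within cball 0 \<epsilon>)"
      by (intro has_derivative_diff has_derivative_ident has_derivative_at_withinI[OF \<Gamma>_has_derivative])
    show "onorm (\<lambda>Z. Z - B y X Z) \<le> 1/2"
      by (rule onorm_le) (use B_near_id[OF X assms(1)] in simp)
  qed (use assms in auto)
  then show ?thesis by simp
qed

text \<open>When \<open>X\<close> is a zero of \<open>\<Gamma> y\<close>, this bounds the error of
  an approximate solution by twice its residual. It identifies \<open>sol w\<close> and supplies the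
  error bound for the derivative of \<open>sol\<close>.\<close>

lemma \<Gamma>_lower:
  assumes "y \<in> V" "norm X \<le> \<epsilon>" "norm X' \<le> \<epsilon>"
  shows "norm (X - X') \<le> 2 * norm (\<Gamma> y X - \<Gamma> y X')"
proof -
  have "norm (X - X') - norm (\<Gamma> y X - \<Gamma> y X') \<le> norm ((X - X') - (\<Gamma> y X - \<Gamma> y X'))"
    by (rule norm_triangle_ineq2)
  also have "\<dots> \<le> norm (X - X') / 2"
    using contraction[OF assms] by (simp add: algebra_simps)
  finally show ?thesis by simp
qed

lemma \<Gamma>_zero: "\<Gamma> y 0 = (\<Sum>x\<in>I. (act one y x - w x) *\<^sub>R q x)"
  by (simp add: \<Gamma>_def linear_0[OF linear_P])

lemma ex_sol:
  assumes "y \<in> V"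
  shows "\<exists>X. norm X < \<epsilon> \<and> \<Gamma> y X = 0"
proof -
  \<comment> \<open>Strictness matters: the ball is mapped into its interior, so the fixed point
    satisfies \<open>norm X < \<epsilon>\<close>, which leaves room to move \<open>X\<close> when
    the derivative of \<open>sol\<close> is computed.\<close>
  have bound: "norm (X - \<Gamma> y X) < norm X / 2 + \<epsilon> / 2" if "norm X \<le> \<epsilon>" for X
  proof -
    have "norm (X - \<Gamma> y X) \<le> norm ((X - \<Gamma> y X) - (0 - \<Gamma> y 0)) + norm (\<Gamma> y 0)"
      using norm_triangle_ineq[of "(X - \<Gamma> y X) - (0 - \<Gamma> y 0)" "0 - \<Gamma> y 0"] by simp
    also have "\<dots> < norm X / 2 + \<epsilon> / 2"
      using contraction[OF assms that, of 0] eps start[OF assms] by (simp add: \<Gamma>_zero)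
    finally show ?thesis .
  qed
  have "\<exists>!X\<in>cball 0 \<epsilon>. X - \<Gamma> y X = X"
  proof (rule Banach_fix[where c = "1/2"])
    show "complete (cball (0::'m) \<epsilon>)" by (simp add: complete_eq_closed)
    show "(\<lambda>X. X - \<Gamma> y X) ` cball 0 \<epsilon> \<subseteq> cball 0 \<epsilon>"
      using bound by (auto simp: less_imp_le) (smt (verit) bound field_sum_of_halves)
    show "dist (X - \<Gamma> y X) (X' - \<Gamma> y X') \<le> 1/2 * dist X X'" if "X \<in> cball 0 \<epsilon>" "X' \<in> cball 0 \<epsilon>" for X X'
      using contraction[OF assms, of X X'] that by (simp add: dist_norm)
  qed (use eps in auto)
  then obtain X where X: "norm X \<le> \<epsilon>" "X - \<Gamma> y X = X" by auto
  then have "norm X < \<epsilon>" "\<Gamma> y X = 0" using bound[OF X(1)] by auto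
  then show ?thesis by blast
qed

lemma sol:
  assumes "y \<in> V"
  shows "norm (sol y) < \<epsilon>" "\<Gamma> y (sol y) = 0"
  using someI_ex[OF ex_sol[OF assms]] by (simp_all add: sol_def)

lemma sol_w: "sol w = 0"
proof -
  have "\<Gamma> w 0 = 0" by (simp add: \<Gamma>_zero act_one w_outside)
  then show ?thesis
    using \<Gamma>_lower[OF w_in_V, of "sol w" 0] sol[OF w_in_V] eps by simp
qed

lemma \<nu>_w: "\<nu> w = w"
  by (simp add: \<nu>_def sol_w act_one w_outside)

text \<open>The vectors \<open>q x\<close> are orthogonal to the range of \<open>P\<close>, so the
  single equation \<open>\<Gamma> y X = 0\<close> makes both of its summands vanish. The vanishing
  of the first one is the equation of the slice.\<close>

lemma \<nu>_in_slice:
  assumes "y \<in> V"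
  shows "(\<Sum>x\<in>I. (\<nu> y x - w x) *\<^sub>R q x) = 0"
proof -
  let ?s = "\<Sum>x\<in>I. (\<nu> y x - w x) *\<^sub>R q x"
  have "?s + P (sol y) = 0" using sol(2)[OF assms] by (simp add: \<Gamma>_def \<nu>_def)
  moreover have "?s \<bullet> P (sol y) = 0"
    by (simp add: inner_sum_left q_orthogonal)
  ultimately show ?thesis
    by (metis add_eq_0_iff2 inner_eq_zero_iff inner_minus_right neg_equal_0_iff_equal)
qed

text \<open>The derivative is obtained by solving the linearized equation: \<open>A\<close> is the
  derivative of \<open>\<Gamma>\<close> caused by the motion of \<open>u p\<close>, and
  \<open>B\<close> compensates it. The affine map \<open>Y\<close> with this derivative has a
  residual of higher order, and \<open>\<Gamma>_lower\<close> bounds its distance to the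
  solution.\<close>

lemma sol_has_derivative:
  fixes u :: "'p::euclidean_space \<Rightarrow> 'x \<Rightarrow> real"
  assumes S: "open S" and p1: "p1 \<in> S" and uV: "u ` S \<subseteq> V"
    and u: "\<And>z. z \<in> I \<Longrightarrow> ((\<lambda>p. u p z) has_derivative u' z) (at p1)"
  shows "((\<lambda>p. sol (u p)) has_derivative
    (\<lambda>v. - inv (B (u p1) (sol (u p1))) (\<Sum>x\<in>I. (\<Sum>z\<in>I. \<rho> x z (one + sol (u p1)) * u' z v) *\<^sub>R q x))) (at p1)"
proof -
  define X1 where "X1 = sol (u p1)"
  have V1: "u p1 \<in> V" using uV p1 by blast
  have X1: "norm X1 < \<epsilon>" "\<Gamma> (u p1) X1 = 0" using sol[OF V1] by (simp_all add: X1_def)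
  let ?B = "B (u p1) X1"
  note Binv = lower_bound_imp_bij[OF linear_B B_lower[OF less_imp_le[OF X1(1)] V1]]
  define A where "A v = (\<Sum>x\<in>I. (\<Sum>z\<in>I. \<rho> x z (one + X1) * u' z v) *\<^sub>R q x)" for v
  have "linear A"
    unfolding A_def using u[THEN has_derivative_linear]
    by (intro linear_compose_sum ballI linear_scaleR_const linearI)
       (simp_all add: linear_add linear_scale sum.distrib distrib_left sum_distrib_left mult.left_commute)
  define T where "T v = - inv ?B (A v)" for v
  have "linear T"
    unfolding T_def using linear_compose[OF \<open>linear A\<close> Binv(2)] by (intro linear_compose_neg) (simp add: o_def)
  then have bT: "bounded_linear T" by (rule linear_conv_bounded_linear[THEN iffD1])
  define Y where "Y p = X1 + T (p - p1)" for p
  have Y': "(Y has_derivative T) (at p1)"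
    unfolding Y_def
    by (rule has_derivative_eq_rhs[OF has_derivative_add[OF has_derivative_const
          bounded_linear.has_derivative[OF bT has_derivative_diff[OF has_derivative_ident has_derivative_const]]]]) simp
  have Yp1: "Y p1 = X1" using linear_0[OF \<open>linear T\<close>] by (simp add: Y_def)
  define h where "h p = \<Gamma> (u p) (Y p)" for p
  have rho': "((\<lambda>p. \<rho> x z (one + Y p)) has_derivative
      (\<lambda>v. frechet_derivative (\<rho> x z) (at (one + X1)) (T v))) (at p1)" if "x \<in> I" "z \<in> I" for x z
  proof -
    have "((\<lambda>p. one + Y p) has_derivative T) (at p1)"
      using has_derivative_add[OF has_derivative_const Y'] by simp
    then show ?thesis
      using has_derivative_compose[of "\<lambda>p. one + Y p" T p1 UNIV "\<rho> x z"] rho_has_derivative[OF that] Yp1 by simp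
  qed
  have "(h has_derivative (\<lambda>v. (\<Sum>x\<in>I. (\<Sum>z\<in>I. \<rho> x z (one + Y p1) * u' z v
      + frechet_derivative (\<rho> x z) (at (one + X1)) (T v) * u p1 z) *\<^sub>R q x) + P (T v))) (at p1)"
  proof -
    have "((\<lambda>p. (\<Sum>z\<in>I. \<rho> x z (one + Y p) * u p z) - w x) has_derivative (\<lambda>v. (\<Sum>z\<in>I. \<rho> x z (one + Y p1) * u' z v
      + frechet_derivative (\<rho> x z) (at (one + X1)) (T v) * u p1 z) - 0)) (at p1)" if "x \<in> I" for x
      by (intro has_derivative_diff has_derivative_sum has_derivative_mult rho' that u has_derivative_const)
    note this[unfolded diff_zero]
    then have "((\<lambda>p. (\<Sum>x\<in>I. ((\<Sum>z\<in>I. \<rho> x z (one + Y p) * u p z) - w x) *\<^sub>R q x) + P (Y p)) has_derivative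
     (\<lambda>v. (\<Sum>x\<in>I. (\<Sum>z\<in>I. \<rho> x z (one + Y p1) * u' z v
      + frechet_derivative (\<rho> x z) (at (one + X1)) (T v) * u p1 z) *\<^sub>R q x) + P (T v))) (at p1)"
      by (intro has_derivative_add has_derivative_sum has_derivative_scaleR_left
          bounded_linear.has_derivative[OF bounded_linear_P Y'])
    then show ?thesis by (simp add: h_def[abs_def] \<Gamma>_def act_def)
  qed
  moreover have "(\<Sum>x\<in>I. (\<Sum>z\<in>I. \<rho> x z (one + Y p1) * u' z v
      + frechet_derivative (\<rho> x z) (at (one + X1)) (T v) * u p1 z) *\<^sub>R q x) + P (T v) = 0" for v
  proof -
    have "(\<Sum>x\<in>I. (\<Sum>z\<in>I. \<rho> x z (one + Y p1) * u' z v
      + frechet_derivative (\<rho> x z) (at (one + X1)) (T v) * u p1 z) *\<^sub>R q x) + P (T v) = A v + ?B (T v)"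
      by (simp add: A_def B_def dact_def Yp1 sum.distrib scaleR_left_distrib)
    also have "?B (T v) = - A v" using Binv(4) by (simp add: T_def linear_neg[OF linear_B])
    finally show ?thesis by simp
  qed
  ultimately have h': "(h has_derivative (\<lambda>_. 0)) (at p1)" by (simp only:)
  have h0: "h p1 = 0" using X1(2) by (simp add: h_def Yp1)
  have "isCont Y p1" using Y' has_derivative_continuous by blast
  then have "(Y \<longlongrightarrow> Y p1) (nhds p1)"
    by (simp only: isCont_def tendsto_at_iff_tendsto_nhds)
  from tendsto_norm[OF this] have "((\<lambda>p. norm (Y p)) \<longlongrightarrow> norm X1) (nhds p1)"
    by (simp only: Yp1)
  then have "\<forall>\<^sub>F p in nhds p1. norm (Y p) < \<epsilon>" using X1(1) by (rule order_tendstoD)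
  moreover have "\<forall>\<^sub>F p in nhds p1. p \<in> S" using S p1 by (rule eventually_nhds_in_open)
  ultimately have bd: "\<forall>\<^sub>F p in nhds p1. norm (sol (u p) - Y p) \<le> 2 * norm (h p)"
  proof eventually_elim
    case (elim p)
    then have "u p \<in> V" using uV by blast
    then show ?case
      using \<Gamma>_lower[of "u p" "sol (u p)" "Y p"] sol[of "u p"] elim by (simp add: h_def)
  qed
  show ?thesis
    using implicit_has_derivative[OF Y' _ h' h0 bd] Yp1 unfolding X1_def T_def A_def by simp
qed

text \<open>The formula for the derivative contains only the data, \<open>sol\<close> and an inverse
  operator depending on \<open>sol\<close>, so each order of smoothness produces the next.\<close>

lemma Ck_on_sol:
  fixes u :: "'p::euclidean_space \<Rightarrow> 'x \<Rightarrow> real"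
  assumes S: "open S" and uV: "u ` S \<subseteq> V" and u: "\<And>z. z \<in> I \<Longrightarrow> Cinf_on S (\<lambda>p. u p z)"
  shows "Ck_on k S (\<lambda>p. sol (u p))"
proof (induction k)
  let ?u' = "\<lambda>p z. frechet_derivative (\<lambda>p. u p z) (at p)"
  have der: "((\<lambda>p. sol (u p)) has_derivative
    (\<lambda>v. - inv (B (u p) (sol (u p))) (\<Sum>x\<in>I. (\<Sum>z\<in>I. \<rho> x z (one + sol (u p)) * ?u' p z v) *\<^sub>R q x))) (at p)"
    if "p \<in> S" for p
    by (rule sol_has_derivative[OF S that uV]) (rule Cinf_on_has_derivative[OF u that])
  case 0
  show ?case unfolding Ck_on.simps
    by (intro continuous_at_imp_continuous_on ballI) (rule has_derivative_continuous[OF der])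
next
  case (Suc k)
  let ?u' = "\<lambda>p z. frechet_derivative (\<lambda>p. u p z) (at p)"
  let ?B = "\<lambda>p. B (u p) (sol (u p))"
  let ?A = "\<lambda>p v. \<Sum>x\<in>I. (\<Sum>z\<in>I. \<rho> x z (one + sol (u p)) * ?u' p z v) *\<^sub>R q x"
  have inV: "u p \<in> V" if "p \<in> S" for p using uV that by blast
  have small: "norm (sol (u p)) \<le> \<epsilon>" if "p \<in> S" for p using sol(1)[OF inV[OF that]] by simp
  have one_sol: "Ck_on k S (\<lambda>p. one + sol (u p))"
    by (rule Ck_on_add[OF S Ck_on_const Suc])
  have CB: "Ck_on k S (\<lambda>p. ?B p Z)" for Z
    unfolding B_def dact_def
    by (intro Ck_on_add[OF S] Ck_on_sum[OF S] Ck_on_scaleR[OF S] Ck_on_mult[OF S] Ck_on_const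
        Ck_on_compose[OF S subset_UNIV _ one_sol] Cinf_onD[OF Cinf_on_derivative[OF smooth]]
        Cinf_onD[OF u])
  have CA: "Ck_on k S (\<lambda>p. ?A p v)" for v
    by (intro Ck_on_sum[OF S] Ck_on_scaleR[OF S] Ck_on_mult[OF S] Ck_on_const
        Ck_on_compose[OF S subset_UNIV _ one_sol] Cinf_onD[OF smooth]
        Cinf_onD[OF Cinf_on_derivative[OF u]])
  have Cinv: "Ck_on k S (\<lambda>p. inv (?B p) Z)" for Z
    by (rule Ck_on_inverse_operator[OF S linear_B B_lower CB]) (use small inV in auto)
  show ?case
  proof (rule Ck_on_SucI[OF S])
    fix p assume p: "p \<in> S"
    have e: "- inv (?B p) W = - (\<Sum>b\<in>Basis. (W \<bullet> b) *\<^sub>R inv (?B p) b)" for W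
      using linear_euclidean_expansion[OF lower_bound_imp_bij(2)[OF linear_B B_lower, OF small[OF p] inV[OF p]]]
      by (rule arg_cong)
    have "((\<lambda>p. sol (u p)) has_derivative (\<lambda>v. - inv (?B p) (?A p v))) (at p)"
      by (rule sol_has_derivative[OF S p uV]) (rule Cinf_on_has_derivative[OF u p])
    then show "((\<lambda>p. sol (u p)) has_derivative
        (\<lambda>v. - (\<Sum>b\<in>Basis. (?A p v \<bullet> b) *\<^sub>R inv (?B p) b))) (at p)"
      unfolding e .
  next
    fix v
    show "Ck_on k S (\<lambda>p. - (\<Sum>b\<in>Basis. (?A p v \<bullet> b) *\<^sub>R inv (?B p) b))"
      by (intro Ck_on_bounded_linear_compose[OF bounded_linear_minus[OF bounded_linear_ident] S]
          Ck_on_sum[OF S] Ck_on_scaleR[OF S] Ck_on_inner_const[OF S] CA Cinv)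
  qed
qed

lemma Cinf_on_\<nu>:
  fixes u :: "'p::euclidean_space \<Rightarrow> 'x \<Rightarrow> real"
  assumes S: "open S" and uV: "u ` S \<subseteq> V" and u: "\<And>z. z \<in> I \<Longrightarrow> Cinf_on S (\<lambda>p. u p z)"
  shows "Cinf_on S (\<lambda>p. one + sol (u p))" "Cinf_on S (\<lambda>p. \<nu> (u p) x)"
proof -
  show os: "Cinf_on S (\<lambda>p. one + sol (u p))"
    using Ck_on_sol[OF assms] by (intro Cinf_on_add[OF S]) (simp_all add: Cinf_on_def)
  have "Cinf_on S (\<lambda>p. \<Sum>z\<in>I. \<rho> x z (one + sol (u p)) * u p z)" if "x \<in> I"
    by (intro Cinf_on_sum[OF S] Cinf_on_mult[OF S] Cinf_on_compose[OF S subset_UNIV smooth os] u that)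
  then show "Cinf_on S (\<lambda>p. \<nu> (u p) x)"
    by (cases "x \<in> I") (simp_all add: \<nu>_def act_def)
qed

section \<open>The orbit meets the slice in a countable set\<close>

text \<open>Let \<open>K\<close> be the stabilizer algebra of \<open>w\<close>. Its conjugate by
  \<open>c\<close> stabilizes \<open>act c w\<close>, so there the injective map \<open>L\<close>
  agrees with \<open>P\<close>; hence \<open>P\<close> maps the conjugate injectively into
  \<open>K\<close>, and onto \<open>K\<close> because the dimensions agree. For \<open>\<xi>\<close>
  as assumed, \<open>L \<xi> = P \<xi>\<close> lies in \<open>K\<close>, so \<open>L\<close> takes
  the same value at an element of the conjugate, and \<open>\<xi>\<close> is that element.\<close>

lemma stabilizer_rank:
  assumes c: "mul c c' = one" "mul c' c = one" and V: "act c w \<in> V"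
    and \<xi>: "(\<Sum>x\<in>I. dact one (act c w) x \<xi> *\<^sub>R q x) = 0" and x: "x \<in> I"
  shows "dact one (act c w) x \<xi> = 0"
proof -
  interpret mul: bounded_bilinear mul by (rule bilin)
  let ?w = "act c w"
  define K where "K = {U. \<forall>x\<in>I. dact one w x U = 0}"
  have K: "subspace K"
    unfolding K_def subspace_def using linear_dact by (simp add: linear_0 linear_add linear_scale)
  have PK: "P Z \<in> K" for Z using dact_P by (simp add: K_def)
  define L where "L = B ?w 0"
  have L: "L Z = (\<Sum>x\<in>I. dact one ?w x Z *\<^sub>R q x) + P Z" for Z by (simp add: L_def B_def)
  have lL: "linear L" by (simp add: L_def linear_B)
  have L0: "Z = 0" if "L Z = 0" for Z
    using B_lower[OF _ V, of 0 Z] eps that by (simp add: L_def)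
  define conj where "conj U = mul (mul c U) c'" for U
  have l_conj: "linear conj"
    unfolding conj_def by (intro linearI) (simp_all add: mul.add_left mul.add_right mul.scaleR_left mul.scaleR_right)
  have conj_K: "dact one ?w x (conj U) = 0" if "U \<in> K" "x \<in> I" for U x
    using dact_conjugate[OF that(2) c(2)] that(1) by (simp add: K_def conj_def)
  have L_conj: "L (conj U) = P (conj U)" if "U \<in> K" for U
    using conj_K[OF that] by (simp add: L)
  have conj0: "U = 0" if "conj U = 0" for U
  proof -
    have "U = mul c' (mul (conj U) c)" by (simp add: conj_def assoc c) (simp add: assoc[symmetric] c)
    then show ?thesis using that by (simp add: mul.zero_left mul.zero_right)
  qed
  let ?f = "\<lambda>U. P (conj U)"
  have lf: "linear ?f" using linear_compose[OF l_conj linear_P] by (simp add: o_def)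
  have "inj_on ?f K"
    unfolding linear_inj_on_iff_eq_0[OF lf K] using L_conj L0 conj0 by metis
  moreover have "span K = K" using K by (rule span_eq_iff[THEN iffD2])
  ultimately have "dim (?f ` K) = dim K" using dim_image_eq[OF lf, of K] by metis
  then have "?f ` K = K"
    using PK by (intro subspace_dim_equal linear_subspace_image[OF lf] K) auto
  moreover have "P \<xi> \<in> K" by (rule PK)
  ultimately obtain U where U: "U \<in> K" "P (conj U) = P \<xi>" by (metis imageE)
  have "L (conj U - \<xi>) = 0" using L_conj[OF U(1)] U(2) \<xi> by (simp add: linear_diff[OF lL] L[of \<xi>])
  then have "conj U = \<xi>" using L0 by (metis eq_iff_diff_eq_0)
  then show ?thesis using conj_K[OF U(1) x] by simp
qed

text \<open>With \<open>g'\<close> the inverse of \<open>g\<close>, each \<open>a\<close> is the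
  product of \<open>one + mul (a - g) g'\<close> and \<open>g\<close>, and the first factor is a
  unit when \<open>a\<close> is near \<open>g\<close>.\<close>

lemma open_units: "open {g. \<exists>g'. mul g g' = one \<and> mul g' g = one}"
proof (rule Topological_Spaces.openI)
  interpret mul: bounded_bilinear mul by (rule bilin)
  fix g assume "g \<in> {g. \<exists>g'. mul g g' = one \<and> mul g' g = one}"
  then obtain g' where g: "mul g g' = one" "mul g' g = one" by blast
  let ?T = "{a. norm (mul (a - g) g') < \<epsilon>}"
  have "\<exists>b. mul a b = one \<and> mul b a = one" if a: "a \<in> ?T" for a
  proof -
    obtain b where b: "mul (one + mul (a - g) g') b = one" "mul b (one + mul (a - g) g') = one"
      using unit[of "mul (a - g) g'"] a by auto
    have e: "one + mul (a - g) g' = mul a g'" using g by (simp add: mul.diff_left)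
    then have "mul (mul a g') g = a" using g by (simp add: assoc)
    then have "mul a (mul g' b) = one" "mul (mul g' b) a = one"
      using b g unfolding e by (metis assoc one_left one_right)+
    then show ?thesis by blast
  qed
  moreover have "open ?T"
    by (intro open_Collect_less continuous_intros mul.continuous_on)
  moreover have "g \<in> ?T" using eps by (simp add: mul.zero_left)
  ultimately show "\<exists>T. open T \<and> g \<in> T \<and> T \<subseteq> {g. \<exists>g'. mul g g' = one \<and> mul g' g = one}"
    by blast
qed

lemma Cinf_on_act: "Cinf_on UNIV (\<lambda>g. act g y x)"
proof (cases "x \<in> I")
  case True
  then show ?thesis
    unfolding act_def by (auto intro!: Cinf_on_sum Cinf_on_mult smooth)
qed simp

text \<open>On the open set of units where everything is defined, \<open>\<nu> (act g w)\<close> has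
  zero derivative in \<open>g\<close>: its values stay in the orbit and satisfy the slice equation,
  and \<open>stabilizer_rank\<close> admits no nonzero velocity of this kind. The set requires the
  projected point to lie in \<open>V\<close> as well, since that is where
  \<open>stabilizer_rank\<close> is applied.\<close>

lemma countable_slice_orbit:
  "countable {\<nu> (act g w) | g g'. mul g g' = one \<and> mul g' g = one \<and> act g w \<in> V \<and> \<nu> (act g w) \<in> V}"
proof -
  interpret mul: bounded_bilinear mul by (rule bilin)
  let ?u = "\<lambda>g. act g w" and ?f = "\<lambda>g. \<nu> (act g w)"
  have "continuous_on UNIV ?u"
    by (intro continuous_on_coordinatewise_then_product Cinf_on_imp_continuous_on[OF Cinf_on_act])
  then have "open (?u -` V)" using open_V by (simp add: continuous_on_open_vimage)
  define \<Omega> where "\<Omega> = {g. \<exists>g'. mul g g' = one \<and> mul g' g = one} \<inter> ?u -` V"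
  have \<Omega>: "open \<Omega>" unfolding \<Omega>_def by (intro open_Int open_units \<open>open (?u -` V)\<close>)
  have u\<Omega>: "?u ` \<Omega> \<subseteq> V" by (auto simp: \<Omega>_def)
  have uC: "Cinf_on \<Omega> (\<lambda>g. ?u g z)" for z using Cinf_on_subset[OF Cinf_on_act] by blast
  have osC: "Cinf_on \<Omega> (\<lambda>g. one + sol (?u g))" and fC: "Cinf_on \<Omega> (\<lambda>g. ?f g x)" for x
    using Cinf_on_\<nu>[OF \<Omega> u\<Omega> uC] by blast+
  define \<Omega>' where "\<Omega>' = \<Omega> \<inter> ?f -` V"
  have "continuous_on \<Omega> ?f"
    by (intro continuous_on_coordinatewise_then_product Cinf_on_imp_continuous_on[OF fC])
  then have \<Omega>': "open \<Omega>'" unfolding \<Omega>'_def using \<Omega> open_V by (rule continuous_open_preimage)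
  have zero: "((\<lambda>g. ?f g x) has_derivative (\<lambda>_. 0)) (at g)" if g: "g \<in> \<Omega>'" for g x
  proof (cases "x \<in> I")
    case False
    then show ?thesis by (simp add: \<nu>_def)
  next
    case x: True
    have g\<Omega>: "g \<in> \<Omega>" and fV: "?f g \<in> V" and uV: "?u g \<in> V" using g by (auto simp: \<Omega>'_def \<Omega>_def)
    obtain g' where g': "mul g g' = one" "mul g' g = one" using g\<Omega> by (auto simp: \<Omega>_def)
    obtain b where b: "mul (one + sol (?u g)) b = one" "mul b (one + sol (?u g)) = one"
      using unit[OF less_imp_le[OF sol(1)[OF uV]]] by blast
    define N where "N g = mul (one + sol (?u g)) g" for g
    define n where "n = mul g' b"
    have n: "mul (N g) n = one" "mul n (N g) = one"
      unfolding N_def n_def using g' b by (metis assoc one_left)+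
    have f_eq: "?f g = act (N g) w" for g by (simp add: \<nu>_def N_def act_mul)
    obtain N' where N': "(N has_derivative N') (at g)"
      unfolding N_def using mul.FDERIV[OF Cinf_on_has_derivative[OF osC g\<Omega>] has_derivative_ident] by blast
    have d: "((\<lambda>g. ?f g z) has_derivative (\<lambda>\<eta>. dact (N g) w z (N' \<eta>))) (at g)" if "z \<in> I" for z
      unfolding f_eq by (rule has_derivative_compose[OF N' act_has_derivative[OF that]])
    \<comment> \<open>The slice equation holds identically on \<open>\<Omega>\<close>. Its
      derivative is computed in two ways, through the orbit map and as the derivative of the
      constant 0.\<close>
    have "((\<lambda>g. \<Sum>z\<in>I. (?f g z - w z) *\<^sub>R q z) has_derivative
        (\<lambda>\<eta>. \<Sum>z\<in>I. (dact (N g) w z (N' \<eta>) - 0) *\<^sub>R q z)) (at g)"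
      by (intro has_derivative_sum has_derivative_scaleR_left has_derivative_diff d has_derivative_const)
    moreover have "((\<lambda>g. \<Sum>z\<in>I. (?f g z - w z) *\<^sub>R q z) has_derivative (\<lambda>\<eta>. 0)) (at g)"
    proof (rule has_derivative_transform_within_open[OF has_derivative_const \<Omega> g\<Omega>])
      fix h assume "h \<in> \<Omega>"
      then have "act h w \<in> V" using u\<Omega> by blast
      from \<nu>_in_slice[OF this] show "0 = (\<Sum>z\<in>I. (?f h z - w z) *\<^sub>R q z)" by simp
    qed
    ultimately have "(\<lambda>\<eta>. \<Sum>z\<in>I. (dact (N g) w z (N' \<eta>) - 0) *\<^sub>R q z) = (\<lambda>\<eta>. 0)"
      by (rule has_derivative_unique)
    then have s0: "(\<Sum>z\<in>I. dact (N g) w z (N' \<eta>) *\<^sub>R q z) = 0" for \<eta>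
      by (metis (no_types, lifting) diff_zero sum.cong)
    \<comment> \<open>The velocity of the projected point is rewritten as an infinitesimal action at
      that point itself, the form that \<open>stabilizer_rank\<close> expects.\<close>
    have tr: "dact (N g) w z (N' \<eta>) = dact one (act (N g) w) z (mul (N' \<eta>) n)" if "z \<in> I" for z \<eta>
      using dact_translate_right[OF that, of one "N g" w "mul (N' \<eta>) n"] n by (simp add: assoc)
    have "dact (N g) w x (N' \<eta>) = 0" for \<eta>
    proof -
      have "(\<Sum>z\<in>I. dact one (act (N g) w) z (mul (N' \<eta>) n) *\<^sub>R q z) = 0"
        using s0[of \<eta>] tr by simp
      from stabilizer_rank[OF n _ this x] show ?thesis using tr[OF x] fV by (simp add: f_eq)
    qed
    then show ?thesis using d[OF x] by simp
  qed
  have "countable (?f ` \<Omega>')"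
  proof (rule countable_image_locally_constant)
    fix g assume g: "g \<in> \<Omega>'"
    obtain e where e: "e > 0" "ball g e \<subseteq> \<Omega>'" using \<Omega>' g openE by blast
    have "?f h = ?f g" if h: "h \<in> ball g e" for h
    proof
      fix x
      show "?f h x = ?f g x"
      proof (rule has_derivative_zero_unique[OF convex_ball[of g e] _ h])
        show "((\<lambda>g. ?f g x) has_derivative (\<lambda>_. 0)) (at k within ball g e)" if "k \<in> ball g e" for k
          by (rule has_derivative_at_withinI, rule zero) (use e that in blast)
      qed (use e in simp)
    qed
    moreover have "open (ball g e)" "g \<in> ball g e" using e by simp_all
    ultimately show "\<exists>U. open U \<and> g \<in> U \<and> U \<subseteq> \<Omega>' \<and> (\<forall>y\<in>U. ?f y = ?f g)"
      using e(2) by blast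
  qed
  moreover have "{\<nu> (act g w) | g g'. mul g g' = one \<and> mul g' g = one \<and> act g w \<in> V \<and> \<nu> (act g w) \<in> V} \<subseteq> ?f ` \<Omega>'"
    by (auto simp: \<Omega>'_def \<Omega>_def)
  ultimately show ?thesis by (rule countable_subset[rotated])
qed

text \<open>On a ball each coordinate of the projection has a connected image contained in a
  countable set of reals, hence a single value, namely the one at the center.\<close>

lemma \<nu>_constant:
  fixes t :: "'p::euclidean_space \<Rightarrow> 'x \<Rightarrow> real"
  assumes S: "open S" "p0 \<in> S" and t: "\<And>x. Cinf_on S (\<lambda>p. t p x)" and tp0: "t p0 = w"
    and orbit: "\<And>p. p \<in> S \<Longrightarrow> \<exists>g g'. mul g g' = one \<and> mul g' g = one \<and> t p = act g w"
  obtains S' where "open S'" "p0 \<in> S'" "S' \<subseteq> S" "t ` S' \<subseteq> V" "\<And>p. p \<in> S' \<Longrightarrow> \<nu> (t p) = w"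
proof -
  let ?C = "{\<nu> (act g w) | g g'. mul g g' = one \<and> mul g' g = one \<and> act g w \<in> V \<and> \<nu> (act g w) \<in> V}"
  define S1 where "S1 = S \<inter> t -` V"
  have "continuous_on S t"
    by (intro continuous_on_coordinatewise_then_product Cinf_on_imp_continuous_on[OF t])
  then have S1: "open S1" unfolding S1_def using S(1) open_V by (rule continuous_open_preimage)
  have fC: "Cinf_on S1 (\<lambda>p. \<nu> (t p) x)" for x
    by (rule Cinf_on_\<nu>(2)[OF S1]) (use Cinf_on_subset[OF t] in \<open>auto simp: S1_def\<close>)
  define S2 where "S2 = S1 \<inter> (\<lambda>p. \<nu> (t p)) -` V"
  have "continuous_on S1 (\<lambda>p. \<nu> (t p))"
    by (intro continuous_on_coordinatewise_then_product Cinf_on_imp_continuous_on[OF fC])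
  then have "open S2" unfolding S2_def using S1 open_V by (rule continuous_open_preimage)
  moreover have "p0 \<in> S2" using S(2) tp0 w_in_V \<nu>_w by (simp add: S2_def S1_def)
  ultimately obtain d where d: "d > 0" "ball p0 d \<subseteq> S2" by (meson openE)
  have inC: "\<nu> (t p) \<in> ?C" if "p \<in> ball p0 d" for p
  proof -
    have p: "p \<in> S" "t p \<in> V" "\<nu> (t p) \<in> V" using that d(2) by (auto simp: S2_def S1_def)
    obtain g g' where "mul g g' = one" "mul g' g = one" "t p = act g w" using orbit[OF p(1)] by blast
    then show ?thesis using p by auto
  qed
  show thesis
  proof (rule that[of "ball p0 d"])
    fix p assume p: "p \<in> ball p0 d"
    show "\<nu> (t p) = w"
    proof
      fix x
      let ?im = "(\<lambda>p. \<nu> (t p) x) ` ball p0 d"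
      have "connected ?im"
        by (rule connected_continuous_image[OF _ connected_ball])
          (rule continuous_on_subset[OF Cinf_on_imp_continuous_on[OF fC]], use d in \<open>auto simp: S2_def\<close>)
      moreover have "countable ?im"
      proof (rule countable_subset)
        show "?im \<subseteq> (\<lambda>y. y x) ` ?C" using inC by blast
      qed (rule countable_image[OF countable_slice_orbit])
      moreover have "\<nu> (t p) x \<in> ?im" "\<nu> (t p0) x \<in> ?im" using p d(1) by auto
      ultimately show "\<nu> (t p) x = w x"
        using connected_uncountable[of ?im "\<nu> (t p) x" "\<nu> (t p0) x"] tp0 \<nu>_w by auto
    qed
  qed (use d in \<open>auto simp: S2_def S1_def\<close>)
qed

end

text \<open>The family \<open>H\<close> is \<open>one + sol (t p)\<close>, which carries
  \<open>t p\<close> to its constant projection. The bound by \<open>e\<close> is kept in the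
  conclusion because closeness to \<open>one\<close> later makes the scalar part of
  \<open>H p\<close> positive.\<close>

theorem (in smooth_representation) local_slice:
  fixes t :: "'p::euclidean_space \<Rightarrow> 'x \<Rightarrow> real"
  assumes S: "open S" "p0 \<in> S" and t: "\<And>x. Cinf_on S (\<lambda>p. t p x)"
    and orbit: "\<And>p. p \<in> S \<Longrightarrow> \<exists>g g'. mul g g' = one \<and> mul g' g = one \<and> t p = act g (t p0)"
    and e: "e > 0"
  shows "\<exists>S' H. open S' \<and> p0 \<in> S' \<and> S' \<subseteq> S \<and> Cinf_on S' H \<and> (\<forall>p\<in>S'. norm (H p - one) < e \<and>
    (\<exists>b. mul (H p) b = one \<and> mul b (H p) = one) \<and> act (H p) (t p) = t p0)"
proof -
  define w where "w = t p0"
  have w_out: "w x = 0" if "x \<notin> I" for x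
    using orbit[OF S(2)] act_outside[OF that] unfolding w_def by metis
  have "\<exists>q P. linear P \<and> (\<forall>Z. (\<Sum>x\<in>I. dact one w x Z *\<^sub>R q x) + P Z = Z) \<and>
    (\<forall>x\<in>I. \<forall>Z. dact one w x (P Z) = 0 \<and> q x \<bullet> P Z = 0)"
    by (rule left_inverse_modulo_kernel[OF finite_I linear_dact])
  then obtain q P where lP: "linear P" and decomp: "\<forall>Z. (\<Sum>x\<in>I. dact one w x Z *\<^sub>R q x) + P Z = Z"
    and ann: "\<forall>x\<in>I. \<forall>Z. dact one w x (P Z) = 0 \<and> q x \<bullet> P Z = 0"
    by (elim exE conjE) (rule that)
  note qP = lP decomp[rule_format]
  obtain e1 where e1: "e1 > 0" "\<And>X. norm X \<le> e1 \<Longrightarrow> \<exists>b. mul (one + X) b = one \<and> mul b (one + X) = one"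
    using unit_near_one by blast
  \<comment> \<open>A continuous measure of how far the derivative of \<open>\<Gamma>\<close> is
    from the identity, summed over basis vectors. It is 0 at \<open>(0, w)\<close> by the
    decomposition \<open>decomp\<close>, so it stays below one half on a product
    neighbourhood.\<close>
  define c where "c = (\<lambda>(X, y). \<Sum>b\<in>Basis. norm (b - ((\<Sum>x\<in>I. dact (one + X) y x b *\<^sub>R q x) + P b)))"
  have coord: "continuous_on UNIV (\<lambda>y::'x \<Rightarrow> real. y z)" for z
    by (rule continuous_on_product_then_coordinatewise[OF continuous_on_id])
  have "continuous_on UNIV (\<lambda>p::'m \<times> ('x \<Rightarrow> real). frechet_derivative (\<rho> x z) (at (one + fst p)) b)"
    if "x \<in> I" "z \<in> I" for x z b
    by (rule continuous_on_compose2[OF Cinf_on_imp_continuous_on[OF Cinf_on_derivative[OF smooth[OF that]]],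
          of _ "\<lambda>p. one + fst p"]) (auto intro!: continuous_intros)
  moreover have "continuous_on UNIV (\<lambda>p::'m \<times> ('x \<Rightarrow> real). snd p z)" for z
    by (rule continuous_on_product_then_coordinatewise[OF continuous_on_snd[OF continuous_on_id]])
  ultimately have "continuous_on UNIV c"
    unfolding c_def dact_def case_prod_unfold
    by (intro continuous_on_sum continuous_on_norm continuous_on_diff continuous_on_add
        continuous_on_scaleR continuous_on_mult continuous_on_const)
  then have "open {p. c p < 1/2}" by (intro open_Collect_less continuous_on_const)
  moreover have "(0, w) \<in> {p. c p < 1/2}" by (simp add: c_def qP(2))
  ultimately obtain A V0 where AV: "open A" "open V0" "(0, w) \<in> A \<times> V0" "A \<times> V0 \<subseteq> {p. c p < 1/2}"
    by (rule open_prod_elim)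
  then obtain a where a: "a > 0" "ball 0 a \<subseteq> A" using openE by blast
  \<comment> \<open>The three entries keep the derivative near the identity, make
    \<open>one + X\<close> a unit, and keep \<open>H\<close> within \<open>e\<close> of
    \<open>one\<close>.\<close>
  define \<epsilon> where "\<epsilon> = min (a / 2) (min e1 (e / 2))"
  have eps_small: "\<epsilon> > 0" "\<epsilon> < a" "\<epsilon> \<le> e1" "\<epsilon> < e" using a e e1 by (auto simp: \<epsilon>_def)
  define V1 where "V1 = {y. norm (\<Sum>x\<in>I. (act one y x - w x) *\<^sub>R q x) < \<epsilon> / 2}"
  have "open V1"
    unfolding V1_def act_def
    by (intro open_Collect_less continuous_on_sum continuous_on_norm continuous_on_diff
        continuous_on_scaleR continuous_on_const) (auto intro!: continuous_on_sum continuous_on_mult coord)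
  have "representation_slice mul one I \<rho> w q P \<epsilon> (V0 \<inter> V1)"
  proof (rule representation_slice.intro[OF smooth_representation_axioms], rule representation_slice_axioms.intro)
    show "open (V0 \<inter> V1)" using AV \<open>open V1\<close> by blast
    show "w \<in> V0 \<inter> V1" using AV eps_small by (simp add: V1_def act_one w_out)
    show "norm (\<Sum>x\<in>I. (act one y x - w x) *\<^sub>R q x) < \<epsilon> / 2" if "y \<in> V0 \<inter> V1" for y
      using that by (simp add: V1_def)
    show "\<exists>b. mul (one + X) b = one \<and> mul b (one + X) = one" if "norm X \<le> \<epsilon>" for X
      using e1(2) that eps_small by auto
    show "norm (Z - ((\<Sum>x\<in>I. dact (one + X) y x Z *\<^sub>R q x) + P Z)) \<le> norm Z / 2"
      if X: "norm X \<le> \<epsilon>" and y: "y \<in> V0 \<inter> V1" for X y Z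
    proof -
      let ?L = "\<lambda>Z. Z - ((\<Sum>x\<in>I. dact (one + X) y x Z *\<^sub>R q x) + P Z)"
      have "X \<in> A" using X a eps_small(2) by auto
      then have cl: "c (X, y) \<le> 1/2" using AV(4) y by auto
      have "linear ?L"
        by (intro linear_compose_sub linear_ident linear_compose_add linear_compose_sum ballI
            linear_scaleR_const linear_dact qP(1))
      then have "?L Z = (\<Sum>b\<in>Basis. (Z \<bullet> b) *\<^sub>R ?L b)" by (rule linear_euclidean_expansion)
      then have "norm (?L Z) = norm (\<Sum>b\<in>Basis. (Z \<bullet> b) *\<^sub>R ?L b)" by (rule arg_cong)
      also have "\<dots> \<le> (\<Sum>b\<in>Basis. norm ((Z \<bullet> b) *\<^sub>R ?L b))" by (rule norm_sum)
      also have "\<dots> \<le> (\<Sum>b\<in>Basis. norm Z * norm (?L b))"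
        by (intro sum_mono) (simp add: Basis_le_norm mult_right_mono)
      also have "\<dots> = norm Z * c (X, y)" by (simp add: c_def sum_distrib_left)
      also have "\<dots> \<le> norm Z / 2" using mult_left_mono[OF cl norm_ge_zero[of Z]] by simp
      finally show ?thesis .
    qed
  qed (use ann in \<open>simp_all add: qP w_out eps_small\<close>)
  then interpret representation_slice mul one I \<rho> w q P \<epsilon> "V0 \<inter> V1" .
  obtain S' where S': "open S'" "p0 \<in> S'" "S' \<subseteq> S" "t ` S' \<subseteq> V0 \<inter> V1" "\<And>p. p \<in> S' \<Longrightarrow> \<nu> (t p) = w"
    using \<nu>_constant[OF S t w_def[symmetric] orbit[folded w_def]] by blast
  show ?thesis
  proof (intro exI[of _ S'] exI[of _ "\<lambda>p. one + sol (t p)"] conjI ballI)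
    show "open S'" "p0 \<in> S'" "S' \<subseteq> S" by (fact S')+
    show "Cinf_on S' (\<lambda>p. one + sol (t p))"
      by (rule Cinf_on_\<nu>(1)[OF S'(1,4)]) (rule Cinf_on_subset[OF t S'(3)])
    fix p assume p: "p \<in> S'"
    then have "t p \<in> V0 \<inter> V1" using S'(4) by blast
    then have s: "norm (sol (t p)) < \<epsilon>" by (rule sol(1))
    show "norm (one + sol (t p) - one) < e" using s eps_small by simp
    show "\<exists>b. mul (one + sol (t p)) b = one \<and> mul b (one + sol (t p)) = one"
      using s unit by simp
    show "act (one + sol (t p)) (t p) = t p0" using S'(5)[OF p, unfolded \<nu>_def] w_def by simp
  qed
qed

section \<open>The positive part of an invertible operator\<close>

text \<open>The exponential growth rate of the iterates at \<open>x\<close> is at most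
  \<open>r\<close>. The slack \<open>\<sigma>\<close> absorbs the polynomial factors that Jordan
  blocks contribute.\<close>

definition grows :: "('v::real_normed_vector \<Rightarrow> 'v) \<Rightarrow> real \<Rightarrow> 'v \<Rightarrow> bool" where
  "grows H r x \<longleftrightarrow> (\<forall>\<sigma>>1. \<exists>C. \<forall>n. norm ((H ^^ n) x) \<le> C * (r * \<sigma>) ^ n)"

lemma linear_funpow: "linear H \<Longrightarrow> linear (H ^^ n)" for H :: "'v::real_vector \<Rightarrow> 'v"
proof (induction n)
  case 0 show ?case by (auto intro!: linearI)
next
  case (Suc n) then show ?case unfolding funpow.simps(2) by (intro linear_compose)
qed

lemma funpow_commute: "(\<And>x. L (H x) = H (L x)) \<Longrightarrow> L ((H ^^ n) x) = (H ^^ n) (L x)" for H :: "'v \<Rightarrow> 'v"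
  by (induction n) auto

lemma grows_zero: "linear H \<Longrightarrow> grows H r 0"
  unfolding grows_def by (intro allI impI exI[of _ 0]) (simp add: linear_0[OF linear_funpow])

lemma grows_add:
  assumes "linear H" "grows H r x" "grows H r y"
  shows "grows H r (x + y)"
  unfolding grows_def
proof (intro allI impI)
  fix \<sigma> :: real assume "\<sigma> > 1"
  then obtain C C' where C: "\<And>n. norm ((H ^^ n) x) \<le> C * (r * \<sigma>) ^ n" "\<And>n. norm ((H ^^ n) y) \<le> C' * (r * \<sigma>) ^ n"
    using assms(2,3) unfolding grows_def by blast
  have "norm ((H ^^ n) (x + y)) \<le> (C + C') * (r * \<sigma>) ^ n" for n
    using norm_triangle_ineq[of "(H ^^ n) x" "(H ^^ n) y"] C[of n]
    by (simp add: linear_add[OF linear_funpow[OF assms(1)]] distrib_right)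
  then show "\<exists>C. \<forall>n. norm ((H ^^ n) (x + y)) \<le> C * (r * \<sigma>) ^ n" by blast
qed

lemma grows_commuting:
  assumes L: "bounded_linear L" "\<And>x. L (H x) = H (L x)" and x: "grows H r x"
  shows "grows H r (L x)"
  unfolding grows_def
proof (intro allI impI)
  fix \<sigma> :: real assume "\<sigma> > 1"
  then obtain C where C: "\<And>n. norm ((H ^^ n) x) \<le> C * (r * \<sigma>) ^ n"
    using x unfolding grows_def by blast
  obtain K where K: "K \<ge> 0" "\<And>x. norm (L x) \<le> norm x * K"
    using bounded_linear.nonneg_bounded[OF L(1)] by blast
  have "norm ((H ^^ n) (L x)) \<le> (C * K) * (r * \<sigma>) ^ n" for n
  proof -
    have "norm ((H ^^ n) (L x)) = norm (L ((H ^^ n) x))" using funpow_commute[of L H, OF L(2)] by simp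
    also have "\<dots> \<le> norm ((H ^^ n) x) * K" by (rule K(2))
    also have "\<dots> \<le> (C * (r * \<sigma>) ^ n) * K" by (rule mult_right_mono[OF C K(1)])
    finally show ?thesis by (simp add: mult_ac)
  qed
  then show "\<exists>C. \<forall>n. norm ((H ^^ n) (L x)) \<le> C * (r * \<sigma>) ^ n" by blast
qed

text \<open>This climbs one step of a Jordan chain: \<open>S\<close> plays the role of the
  eigenvalue, and it multiplies norms by \<open>r\<close> and commutes with \<open>H\<close>. The
  perturbation \<open>u\<close> already grows at rate \<open>r\<close>, and the slack pays for its
  accumulation.\<close>

lemma grows_perturbed_eigenvector:
  assumes H: "linear H" and S: "\<And>x. S (H x) = H (S x)" "\<And>x. norm (S x) = r * norm x" and r: "r > 0"
    and v: "H v = S v + u" and u: "grows H r u"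
  shows "grows H r v"
  unfolding grows_def
proof (intro allI impI)
  fix \<sigma> :: real assume \<sigma>: "\<sigma> > 1"
  then obtain C where C: "\<And>n. norm ((H ^^ n) u) \<le> C * (r * \<sigma>) ^ n"
    using u unfolding grows_def by blast
  have "norm u \<le> C" using C[of 0] by simp
  then have C0: "C \<ge> 0" using norm_ge_zero order_trans by blast
  have d: "r * \<sigma> - r > 0" using r \<sigma> by (simp add: algebra_simps)
  \<comment> \<open>Chosen so that \<open>C \<le> A * (r * \<sigma> - r)\<close>, which is exactly
    what the induction step consumes.\<close>
  define A where "A = norm v + C / (r * \<sigma> - r)"
  have "norm ((H ^^ n) v) \<le> A * (r * \<sigma>) ^ n" for n
  proof (induction n)
    case 0
    then show ?case using C0 d by (simp add: A_def)
  next
    case (Suc n)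
    have "(H ^^ Suc n) v = (H ^^ n) (S v + u)" by (simp add: funpow_swap1 v)
    also have "\<dots> = S ((H ^^ n) v) + (H ^^ n) u"
      using funpow_commute[of S H, OF S(1)] by (simp add: linear_add[OF linear_funpow[OF H]])
    finally have "norm ((H ^^ Suc n) v) \<le> r * norm ((H ^^ n) v) + norm ((H ^^ n) u)"
      using norm_triangle_ineq[of "S ((H ^^ n) v)" "(H ^^ n) u"] S(2) by simp
    also have "\<dots> \<le> r * (A * (r * \<sigma>) ^ n) + C * (r * \<sigma>) ^ n"
      using Suc.IH C[of n] r by (intro add_mono mult_left_mono) auto
    also have "\<dots> = (r * A + C) * (r * \<sigma>) ^ n" by (simp add: algebra_simps)
    also have "\<dots> \<le> (A * (r * \<sigma>)) * (r * \<sigma>) ^ n"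
    proof (rule mult_right_mono)
      have "(norm v + C / D) * D = norm v * D + C" if "D > 0" for D using that by (simp add: distrib_right)
      from this[OF d] have "C \<le> A * (r * \<sigma> - r)" unfolding A_def using d by simp
      then show "r * A + C \<le> A * (r * \<sigma>)" by (simp add: algebra_simps)
    qed (use r \<sigma> in simp)
    finally show ?case by (simp add: mult_ac)
  qed
  then show "\<exists>C. \<forall>n. norm ((H ^^ n) v) \<le> C * (r * \<sigma>) ^ n" by blast
qed

lemma power_bounded_imp_le:
  fixes a b c C :: real
  assumes "b > 0" "c > 0" "\<And>n. c * a ^ n \<le> C * b ^ n"
  shows "a \<le> b"
proof (rule ccontr)
  assume "\<not> a \<le> b"
  then have "1 < a / b" using assms(1) by simp
  then obtain n where "C / c < (a / b) ^ n" using real_arch_pow by blast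
  then have "C * b ^ n < c * a ^ n"
    using assms(1,2) by (simp add: power_divide field_simps)
  then show False using assms(3)[of n] by simp
qed

lemma le_if_le_all_factors:
  fixes a b :: real
  assumes "\<And>\<sigma>. \<sigma> > 1 \<Longrightarrow> a \<le> b * \<sigma> ^ n"
  shows "a \<le> b"
proof (rule tendsto_lowerbound)
  show "((\<lambda>\<sigma>. b * \<sigma> ^ n) \<longlongrightarrow> b) (at_right 1)"
    by (rule tendsto_eq_intros | simp)+
  show "\<forall>\<^sub>F \<sigma> in at_right 1. a \<le> b * \<sigma> ^ n"
    using assms by (simp add: eventually_at_right_less eventually_mono[OF eventually_at_right_less])
qed simp

lemma grows_eigenvector:
  assumes S: "\<And>x. S (H x) = H (S x)" "\<And>x. norm (S x) = s * norm x" and r: "r > 0"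
    and v: "H v = S v" and g: "grows H r v" and "v \<noteq> 0"
  shows "s \<le> r"
proof (rule le_if_le_all_factors[where n = 1])
  fix \<sigma> :: real assume \<sigma>: "\<sigma> > 1"
  then obtain C where C: "\<And>n. norm ((H ^^ n) v) \<le> C * (r * \<sigma>) ^ n"
    using g unfolding grows_def by blast
  have "norm ((H ^^ n) v) = norm v * s ^ n" for n
  proof (induction n)
    case (Suc n)
    have "(H ^^ Suc n) v = S ((H ^^ n) v)"
      using funpow_commute[of S H, OF S(1)] by (simp add: funpow_swap1 v)
    then show ?case using Suc S(2) by simp
  qed simp
  then show "s \<le> r * \<sigma> ^ 1"
    using power_bounded_imp_le[of "r * \<sigma>" "norm v" s C] C r \<sigma> \<open>v \<noteq> 0\<close> by simp
qed

section \<open>The complexified space is spanned by vectors of pure growth\<close>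

locale invertible_operator =
  fixes h k :: "'e::euclidean_space \<Rightarrow> 'e"
  assumes linear_h: "linear h" and linear_k: "linear k"
    and hk: "h (k x) = x" and kh: "k (h x) = x"
begin

text \<open>The complexification of \<open>'e\<close> is \<open>'e \<times> 'e\<close>, on which \<open>cs z\<close> is multiplication by \<open>z\<close>.\<close>

definition cs :: "complex \<Rightarrow> 'e \<times> 'e \<Rightarrow> 'e \<times> 'e" where
  "cs z v = (Re z *\<^sub>R fst v - Im z *\<^sub>R snd v, Re z *\<^sub>R snd v + Im z *\<^sub>R fst v)"

definition H :: "'e \<times> 'e \<Rightarrow> 'e \<times> 'e" where "H v = (h (fst v), h (snd v))"
definition K :: "'e \<times> 'e \<Rightarrow> 'e \<times> 'e" where "K v = (k (fst v), k (snd v))"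

text \<open>The two-sided condition makes the growth rate exact. \<open>G r\<close> plays the role
  of the sum of the generalized eigenspaces for eigenvalues of absolute value \<open>r\<close>;
  defining it by growth avoids the Jordan normal form.\<close>

definition G :: "real \<Rightarrow> ('e \<times> 'e) set" where
  "G r = {v. grows H r v \<and> grows K (1 / r) v}"

definition S :: "('e \<times> 'e) set" where "S = span (\<Union>r\<in>{0<..}. G r)"

lemma linear_H: "linear H" and linear_K: "linear K" and linear_cs: "linear (cs z)"
  unfolding H_def K_def cs_def
  by (auto intro!: linearI simp: linear_add[OF linear_h] linear_add[OF linear_k]
      linear_scale[OF linear_h] linear_scale[OF linear_k] algebra_simps)

lemma HK: "H (K v) = v" and KH: "K (H v) = v"
  by (simp_all add: H_def K_def hk kh)

lemma cs_H: "cs z (H v) = H (cs z v)" and cs_K: "cs z (K v) = K (cs z v)"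
  by (simp_all add: cs_def H_def K_def linear_add[OF linear_h] linear_add[OF linear_k] linear_diff[OF linear_h]
      linear_diff[OF linear_k] linear_scale[OF linear_h] linear_scale[OF linear_k])

lemma cs_cs: "cs z (cs w v) = cs (z * w) v" and cs_1: "cs 1 v = v" and cs_0: "cs 0 v = 0"
  and cs_add: "cs (z + w) v = cs z v + cs w v"
  by (simp_all add: cs_def algebra_simps prod_eq_iff)

lemma norm_cs: "norm (cs z v) = norm z * norm v"
proof -
  have "(norm (a *\<^sub>R x - b *\<^sub>R y))\<^sup>2 + (norm (a *\<^sub>R y + b *\<^sub>R x))\<^sup>2
      = (a\<^sup>2 + b\<^sup>2) * ((norm x)\<^sup>2 + (norm y)\<^sup>2)" for a b and x y :: 'e
    unfolding power2_norm_eq_inner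
    by (simp add: inner_diff_left inner_diff_right inner_add_left inner_add_right
        inner_commute[of y x] power2_eq_square algebra_simps)
  then show ?thesis
    by (simp add: cs_def norm_prod_def cmod_def real_sqrt_mult)
qed

lemma bounded_linear_of_linear: "linear L \<Longrightarrow> bounded_linear L" for L :: "'e \<times> 'e \<Rightarrow> 'e \<times> 'e"
  by (rule linear_conv_bounded_linear[THEN iffD1])

lemma G_commuting:
  assumes "linear L" "\<And>v. L (H v) = H (L v)" "\<And>v. L (K v) = K (L v)" "v \<in> G r"
  shows "L v \<in> G r"
  using assms grows_commuting[OF bounded_linear_of_linear[OF assms(1)]] by (simp add: G_def)

lemma subspace_G: "subspace (G r)"
  unfolding subspace_def
proof (intro conjI ballI allI)
  show "0 \<in> G r" by (simp add: G_def grows_zero linear_H linear_K)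
  show "x + y \<in> G r" if "x \<in> G r" "y \<in> G r" for x y
    using that by (simp add: G_def grows_add linear_H linear_K)
  show "c *\<^sub>R x \<in> G r" if "x \<in> G r" for c x
    by (rule G_commuting[OF _ _ _ that])
      (simp_all add: linear_scale[OF linear_H] linear_scale[OF linear_K])
qed

lemma subspace_S: "subspace S"
  by (simp add: S_def)

lemma G_subset_S: "r > 0 \<Longrightarrow> G r \<subseteq> S"
  unfolding S_def by (auto intro: span_base)

lemma S_commuting:
  assumes "linear L" "\<And>v. L (H v) = H (L v)" "\<And>v. L (K v) = K (L v)" "v \<in> S"
  shows "L v \<in> S"
proof -
  have "L ` (\<Union>r\<in>{0<..}. G r) \<subseteq> (\<Union>r\<in>{0<..}. G r)" using G_commuting[OF assms(1-3)] by blast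
  then have "L ` S \<subseteq> S"
    unfolding S_def linear_span_image[OF assms(1), symmetric] by (rule span_mono)
  then show ?thesis using assms(4) by blast
qed

text \<open>An eigenvector for \<open>z\<close> inside \<open>G r\<close> would satisfy
  \<open>norm z \<le> r\<close> by its growth under \<open>H\<close> and the reverse inequality by
  its growth under \<open>K\<close>. So \<open>H\<close> minus \<open>z\<close> is injective on the
  invariant finite dimensional space \<open>G r\<close>, hence surjective.\<close>

lemma shift_surj_on_G:
  assumes r: "r > 0" and ne: "norm z \<noteq> r" and z: "z \<noteq> 0"
  shows "(\<lambda>v. H v - cs z v) ` G r = G r"
proof -
  let ?L = "\<lambda>v. H v - cs z v"
  have lin: "linear ?L" by (intro linear_compose_sub linear_H linear_cs)
  have "v = 0" if v: "v \<in> G r" "?L v = 0" for v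
  proof (rule ccontr)
    assume "v \<noteq> 0"
    have e: "H v = cs z v" using v(2) by simp
    have e': "K v = cs (1 / z) v"
    proof -
      have "v = K (cs z v)" using e KH by metis
      then have "cs (1 / z) v = cs (1 / z) (cs z (K v))" by (simp add: cs_K)
      then show ?thesis using z by (simp add: cs_cs cs_1)
    qed
    have "norm z \<le> r"
      by (rule grows_eigenvector[OF cs_H norm_cs r e _ \<open>v \<noteq> 0\<close>]) (use v in \<open>simp add: G_def\<close>)
    moreover have "norm (1 / z) \<le> 1 / r"
      by (rule grows_eigenvector[OF cs_K norm_cs _ e' _ \<open>v \<noteq> 0\<close>]) (use v r in \<open>simp_all add: G_def\<close>)
    then have "r \<le> norm z" using r z by (simp add: norm_divide field_simps)
    ultimately show False using ne by simp
  qed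
  then have "inj_on ?L (G r)" unfolding linear_inj_on_iff_eq_0[OF lin subspace_G] by blast
  moreover have "span (G r) = G r" using subspace_G by (rule span_eq_iff[THEN iffD2])
  ultimately have "dim (?L ` G r) = dim (G r)" using dim_image_eq[OF lin, of "G r"] by metis
  moreover have "?L ` G r \<subseteq> G r"
  proof
    fix w assume "w \<in> ?L ` G r"
    then obtain v where v: "v \<in> G r" "w = ?L v" by blast
    have "?L v \<in> G r"
      by (rule G_commuting[OF lin _ _ v(1)])
        (simp_all add: cs_H cs_K HK KH linear_diff[OF linear_H] linear_diff[OF linear_K])
    then show "w \<in> G r" using v by simp
  qed
  ultimately show ?thesis
    by (intro subspace_dim_equal linear_subspace_image[OF lin] subspace_G) auto
qed

text \<open>Modulo the image of \<open>S\<close> under \<open>H\<close> minus \<open>z\<close>,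
  every \<open>G r\<close> with \<open>r\<close> different from \<open>norm z\<close> disappears, by
  surjectivity. Hence after subtraction of a suitable \<open>s\<close> in \<open>S\<close> the
  vector satisfies the eigenvalue equation up to an error in \<open>G (norm z)\<close>, and the
  perturbation lemma for \<open>H\<close> and for \<open>K\<close> puts it into
  \<open>G (norm z)\<close>.\<close>

lemma eigenvector_modulo_S:
  assumes "H v - cs z v \<in> S" "z \<noteq> 0"
  shows "v \<in> S"
proof -
  let ?L = "\<lambda>v. H v - cs z v" and ?r = "norm z"
  have lin: "linear ?L" by (intro linear_compose_sub linear_H linear_cs)
  have r: "?r > 0" using assms(2) by simp
  define T where "T = {?L s + g | s g. s \<in> S \<and> g \<in> G ?r}"
  have "subspace {x + y | x y. x \<in> ?L ` S \<and> y \<in> G ?r}"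
    by (intro subspace_sums linear_subspace_image[OF lin] subspace_S subspace_G)
  moreover have "{x + y | x y. x \<in> ?L ` S \<and> y \<in> G ?r} = T" unfolding T_def by blast
  ultimately have sT: "subspace T" by simp
  have "G r \<subseteq> T" if "r > 0" for r
  proof
    fix g assume g: "g \<in> G r"
    show "g \<in> T"
    proof (cases "r = ?r")
      case True
      have "g = ?L 0 + g" using linear_0[OF lin] by simp
      moreover have "(0::'e \<times> 'e) \<in> S" using subspace_S by (rule subspace_0)
      ultimately show ?thesis unfolding T_def using g True by blast
    next
      case False
      then have "?L ` G r = G r" using shift_surj_on_G[OF that _ assms(2)] by simp
      then obtain s where s: "s \<in> G r" "g = ?L s" using g by blast
      moreover have "(0::'e \<times> 'e) \<in> G ?r" using subspace_G by (rule subspace_0)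
      moreover have "g = ?L s + 0" using s(2) by simp
      ultimately show ?thesis unfolding T_def using G_subset_S[OF that] by blast
    qed
  qed
  then have "S \<subseteq> T" unfolding S_def using sT by (intro span_minimal) auto
  then obtain s g where sg: "s \<in> S" "g \<in> G ?r" "?L v = ?L s + g" using assms(1) unfolding T_def by blast
  have e: "H (v - s) = cs z (v - s) + g"
    using sg(3) by (simp add: linear_diff[OF linear_H] linear_diff[OF linear_cs] algebra_simps)
  have e': "K (v - s) = cs (1 / z) (v - s) + cs (- 1 / z) (K g)"
  proof -
    have "v - s = cs z (K (v - s)) + K g"
      using arg_cong[OF e, of K] by (simp add: KH linear_add[OF linear_K] cs_K)
    then have "cs (1 / z) (v - s) = cs (1 / z) (cs z (K (v - s))) + cs (1 / z) (K g)"
      using linear_add[OF linear_cs] by metis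
    moreover have "cs (- 1 / z) (K g) = - cs (1 / z) (K g)" by (simp add: cs_def prod_eq_iff)
    ultimately show ?thesis using assms(2) by (simp add: cs_cs cs_1)
  qed
  have "cs (- 1 / z) (K g) \<in> G ?r"
    by (rule G_commuting[OF linear_compose[OF linear_K linear_cs, unfolded o_def] _ _ sg(2)])
      (simp_all add: cs_H[symmetric] cs_K[symmetric] HK KH)
  then have "grows K (1 / ?r) (v - s)"
    using grows_perturbed_eigenvector[of K "cs (1 / z)" "1 / ?r" "v - s" "cs (- 1 / z) (K g)"]
      r e' linear_K cs_K norm_cs by (simp add: G_def norm_divide)
  moreover have "grows H ?r (v - s)"
    using grows_perturbed_eigenvector[OF linear_H cs_H norm_cs r e] sg(2) by (simp add: G_def)
  ultimately have "v - s \<in> S" using G_subset_S[OF r] by (auto simp: G_def)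
  then show ?thesis using subspace_add[OF subspace_S _ sg(1)] by fastforce
qed

text \<open>The polynomial \<open>p\<close> evaluated at the operator \<open>H\<close> and applied
  to \<open>v\<close>, by the scheme of Horner.\<close>

definition pev :: "complex poly \<Rightarrow> 'e \<times> 'e \<Rightarrow> 'e \<times> 'e" where
  "pev p v = fold_coeffs (\<lambda>a w. cs a v + H w) p 0"

lemma pev_0 [simp]: "pev 0 v = 0"
  by (simp add: pev_def)

lemma pev_pCons: "pev (pCons a p) v = cs a v + H (pev p v)"
  by (cases "p = 0 \<and> a = 0") (auto simp: pev_def cs_0 linear_0[OF linear_H])

lemma pev_add: "pev (p + q) v = pev p v + pev q v"
proof (induction p arbitrary: q)
  case (pCons a p)
  then show ?case by (cases q) (simp add: pev_pCons cs_add linear_add[OF linear_H])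
qed simp

lemma pev_smult: "pev (smult c p) v = cs c (pev p v)"
  by (induction p) (simp_all add: pev_pCons cs_cs cs_H linear_add[OF linear_cs] linear_0[OF linear_cs])

lemma pev_linear_factor: "pev ([:- z, 1:] * q) v = H (pev q v) - cs z (pev q v)"
proof -
  have n: "cs (- z) w = - cs z w" for w by (simp add: cs_def prod_eq_iff)
  have e: "[:- z, 1:] * q = smult (- z) q + pCons 0 q" by simp
  show ?thesis unfolding e pev_add pev_smult pev_pCons n cs_0 by simp
qed

lemma pev_sum: "finite A \<Longrightarrow> pev (\<Sum>i\<in>A. f i) v = (\<Sum>i\<in>A. pev (f i) v)"
  by (induction A rule: finite_induct) (simp_all add: pev_add)

lemma pev_monom: "pev (monom c n) v = cs c ((H ^^ n) v)"
  by (induction n)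
    (simp_all add: pev_pCons monom_0 monom_Suc cs_0 linear_0[OF linear_H] cs_H)

text \<open>One more iterate of \<open>v\<close> than the real dimension forces a linear relation,
  whose coefficients form the polynomial.\<close>

lemma ex_annihilating_poly: "\<exists>p. p \<noteq> 0 \<and> pev p v = 0"
proof -
  let ?f = "\<lambda>n. (H ^^ n) v"
  show ?thesis
  proof (cases "inj_on ?f {..DIM('e \<times> 'e)}")
    case True
    then have "card (?f ` {..DIM('e \<times> 'e)}) > DIM('e \<times> 'e)" by (simp add: card_image)
    then have "dependent (?f ` {..DIM('e \<times> 'e)})" using dependent_biggerset by blast
    then obtain u w where u: "w \<in> ?f ` {..DIM('e \<times> 'e)}" "u w \<noteq> 0"
      "(\<Sum>w\<in>?f ` {..DIM('e \<times> 'e)}. u w *\<^sub>R w) = 0"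
      unfolding dependent_finite[OF finite_imageI[OF finite_atMost]] by blast
    define p where "p = (\<Sum>i\<le>DIM('e \<times> 'e). monom (complex_of_real (u (?f i))) i)"
    have "pev p v = (\<Sum>i\<le>DIM('e \<times> 'e). u (?f i) *\<^sub>R ?f i)"
      unfolding p_def by (simp add: pev_sum pev_monom) (simp add: cs_def prod_eq_iff fst_sum snd_sum)
    also have "\<dots> = (\<Sum>w\<in>?f ` {..DIM('e \<times> 'e)}. u w *\<^sub>R w)"
      by (simp only: sum.reindex[OF True] o_def)
    finally have "pev p v = 0" using u(3) by simp
    moreover have "p \<noteq> 0"
    proof -
      obtain i where "i \<le> DIM('e \<times> 'e)" "w = ?f i" using u(1) by blast
      then have "coeff p i = complex_of_real (u w)"
        unfolding p_def by (simp add: coeff_sum coeff_monom)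
      then show ?thesis using u(2) by auto
    qed
    ultimately show ?thesis by blast
  next
    \<comment> \<open>Two iterates coincide, so the set of iterates is too small for the dimension
      count; the difference of two monomials annihilates \<open>v\<close> instead.\<close>
    case False
    then obtain i j where ij: "i \<noteq> j" "?f i = ?f j" by (auto simp: inj_on_def)
    have "cs (- 1) w = - w" for w by (simp add: cs_def prod_eq_iff)
    then have "pev (monom 1 i + monom (- 1) j) v = 0" using ij(2) by (simp add: pev_add pev_monom cs_1)
    moreover have "coeff (monom 1 i + monom (- 1) j :: complex poly) i = 1" using ij(1) by (simp add: coeff_monom)
    then have "monom 1 i + monom (- 1) j \<noteq> (0 :: complex poly)" by (metis coeff_0 zero_neq_one)
    ultimately show ?thesis by blast
  qed
qed

text \<open>Among the nonzero polynomials that carry some vector outside \<open>S\<close> into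
  \<open>S\<close>, one of least degree is taken. It is not constant, so a root \<open>z\<close> can
  be split off. By minimality the quotient leaves a vector outside \<open>S\<close>, but this vector
  is an eigenvector for \<open>z\<close> modulo \<open>S\<close>, hence in \<open>S\<close>. For
  \<open>z = 0\<close> invertibility of \<open>H\<close> gives the contradiction directly.\<close>

lemma S_UNIV: "S = UNIV"
proof (rule ccontr)
  assume "S \<noteq> UNIV"
  then obtain w0 where "w0 \<notin> S" by blast
  moreover obtain p0 where "p0 \<noteq> 0" "pev p0 w0 = 0" using ex_annihilating_poly by blast
  ultimately have "\<exists>p. p \<noteq> 0 \<and> (\<exists>w. w \<notin> S \<and> pev p w \<in> S)"
    using subspace_0[OF subspace_S] by metis
  then obtain p where p: "p \<noteq> 0" "\<exists>w. w \<notin> S \<and> pev p w \<in> S"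
    and minimal: "\<And>q. q \<noteq> 0 \<Longrightarrow> (\<exists>w. w \<notin> S \<and> pev q w \<in> S) \<Longrightarrow> degree p \<le> degree q"
    using exists_least_iff[of "\<lambda>n. \<exists>p. degree p = n \<and> p \<noteq> 0 \<and> (\<exists>w. w \<notin> S \<and> pev p w \<in> S)"]
    by (metis not_le)
  then obtain w where w: "w \<notin> S" "pev p w \<in> S" by blast
  have "degree p \<noteq> 0"
  proof
    assume "degree p = 0"
    then obtain c where c: "p = [:c:]" by (rule degree_eq_zeroE)
    then have "cs c w \<in> S" using w(2) by (simp add: pev_pCons linear_0[OF linear_H])
    then have "cs (1 / c) (cs c w) \<in> S"
      by (rule S_commuting[OF linear_cs cs_H cs_K])
    then show False using w(1) p(1) c by (simp add: cs_cs cs_1)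
  qed
  then have "\<not> constant (poly p)" by (simp add: constant_degree)
  then obtain z where "poly p z = 0" using fundamental_theorem_of_algebra by blast
  then obtain q where q: "p = [:- z, 1:] * q" by (metis poly_eq_0_iff_dvd dvdE)
  have q0: "q \<noteq> 0" using q p(1) by auto
  have "degree p = degree [:- z, 1:] + degree q"
    unfolding q by (rule degree_mult_eq) (use q0 in auto)
  then have "degree p = Suc (degree q)" by simp
  then have "pev q w \<notin> S" using minimal[OF q0] w(1) by (metis not_less_eq_eq order_refl)
  moreover have L: "H (pev q w) - cs z (pev q w) \<in> S" using w(2) q pev_linear_factor by metis
  have "pev q w \<in> S"
  proof (cases "z = 0")
    case True
    then have "H (pev q w) \<in> S" using L by (simp add: cs_0)
    then have "K (H (pev q w)) \<in> S"
      by (rule S_commuting[OF linear_K, rotated 2]) (simp_all add: HK KH)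
    then show ?thesis by (simp add: KH)
  next
    case False
    then show ?thesis using eigenvector_modulo_S[OF L] by blast
  qed
  ultimately show False by blast
qed

text \<open>The first component is the real part, and it commutes with the iterates, so real parts
  inherit both growth bounds. They span the real space, and a basis is selected among them.\<close>

lemma growth_basis:
  obtains B m where "finite B" "independent B" "span B = UNIV"
    "\<And>b. b \<in> B \<Longrightarrow> m b > 0 \<and> grows h (m b) b \<and> grows k (1 / m b) b"
proof -
  have Hn: "fst ((H ^^ n) v) = (h ^^ n) (fst v)" "fst ((K ^^ n) v) = (k ^^ n) (fst v)" for n v
    by (induction n) (simp_all add: H_def K_def)
  have le: "norm (fst v) \<le> norm v" for v :: "'e \<times> 'e" by (metis norm_fst_le prod.collapse)
  have proj: "grows L' r (fst v)"
    if gv: "grows L r v" and it: "\<And>n. fst ((L ^^ n) v) = (L' ^^ n) (fst v)" for L L' r and v :: "'e \<times> 'e"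
    unfolding grows_def
  proof (intro allI impI)
    fix \<sigma> :: real assume "\<sigma> > 1"
    then obtain C where "\<And>n. norm ((L ^^ n) v) \<le> C * (r * \<sigma>) ^ n" using gv unfolding grows_def by blast
    then have "norm ((L' ^^ n) (fst v)) \<le> C * (r * \<sigma>) ^ n" for n
      using le[of "(L ^^ n) v"] order_trans unfolding it by blast
    then show "\<exists>C. \<forall>n. norm ((L' ^^ n) (fst v)) \<le> C * (r * \<sigma>) ^ n" by blast
  qed
  let ?X = "{x. \<exists>r>0. grows h r x \<and> grows k (1 / r) x}"
  have "fst v \<in> ?X" if "v \<in> G r" "r > 0" for v r
  proof -
    have "grows H r v" "grows K (1 / r) v" using that(1) by (simp_all add: G_def)
    from proj[OF this(1) Hn(1)] proj[OF this(2) Hn(2)] show ?thesis using that(2) by blast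
  qed
  then have "fst ` (\<Union>r\<in>{0<..}. G r) \<subseteq> ?X" by blast
  then have "fst ` S \<subseteq> span ?X"
    unfolding S_def linear_span_image[OF linear_fst, symmetric] by (rule span_mono)
  then have X: "span ?X = UNIV" by (simp add: S_UNIV top.extremum_unique)
  obtain B where B: "B \<subseteq> ?X" "independent B" "?X \<subseteq> span B"
    using maximal_independent_subset by blast
  have "span B = UNIV" using span_mono[OF B(3)] X by (simp add: span_span top.extremum_unique)
  moreover have "\<forall>b\<in>B. \<exists>r>0. grows h r b \<and> grows k (1 / r) b" using B(1) by blast
  then obtain m where "\<And>b. b \<in> B \<Longrightarrow> m b > 0 \<and> grows h (m b) b \<and> grows k (1 / m b) b" by metis
  ultimately show thesis using that independent_imp_finite[OF B(2)] B(2) by blast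
qed

end

section \<open>Forms scaled by an operator\<close>

lemma grows_prod_list:
  assumes "\<And>x. x \<in> set xs \<Longrightarrow> m x > 0 \<and> grows h (m x) x" and \<sigma>: "\<sigma> > 1"
  shows "\<exists>C\<ge>0. \<forall>n. prod_list (map (\<lambda>x. norm ((h ^^ n) x)) xs) \<le> C * (prod_list (map m xs) * \<sigma> ^ length xs) ^ n"
  using assms(1)
proof (induction xs)
  case Nil
  then show ?case by (intro exI[of _ 1]) simp
next
  case (Cons x xs)
  then obtain C where C: "C \<ge> 0" "\<And>n. prod_list (map (\<lambda>x. norm ((h ^^ n) x)) xs) \<le> C * (prod_list (map m xs) * \<sigma> ^ length xs) ^ n"
    by auto
  obtain C' where C': "\<And>n. norm ((h ^^ n) x) \<le> C' * (m x * \<sigma>) ^ n"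
    using Cons.prems \<sigma> unfolding grows_def by (meson list.set_intros(1))
  have "norm x \<le> C'" using C'[of 0] by simp
  then have "C' \<ge> 0" using norm_ge_zero order_trans by blast
  have "prod_list (map (\<lambda>x. norm ((h ^^ n) x)) (x # xs)) \<le> (C' * C) * (prod_list (map m (x # xs)) * \<sigma> ^ length (x # xs)) ^ n" for n
  proof -
    have "m x > 0" using Cons.prems by simp
    then have "norm ((h ^^ n) x) * prod_list (map (\<lambda>x. norm ((h ^^ n) x)) xs)
        \<le> (C' * (m x * \<sigma>) ^ n) * (C * (prod_list (map m xs) * \<sigma> ^ length xs) ^ n)"
      using C'[of n] C(2)[of n] \<open>C' \<ge> 0\<close> \<sigma> by (intro mult_mono) (auto intro!: prod_list_nonneg)
    then show ?thesis by (simp add: power_mult_distrib mult_ac)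
  qed
  then show ?case using C(1) \<open>C' \<ge> 0\<close> by (intro exI[of _ "C' * C"]) simp
qed

text \<open>Iteration of the scaling relation makes \<open>T\<close> grow like the powers of
  \<open>\<tau>\<close>, while boundedness of \<open>T\<close> limits the growth to that of the
  product of the norms of the arguments.\<close>

lemma eigenform_le:
  fixes T :: "'e::euclidean_space list \<Rightarrow> real"
  assumes T: "multilinear (length xs) T" and \<tau>: "\<tau> > 0"
    and eq: "\<And>ys. length ys = length xs \<Longrightarrow> T (map h ys) = \<tau> * T ys"
    and m: "\<And>x. x \<in> set xs \<Longrightarrow> m x > 0 \<and> grows h (m x) x" and nz: "T xs \<noteq> 0"
  shows "\<tau> \<le> prod_list (map m xs)"
proof (rule le_if_le_all_factors[where n = "length xs"])
  fix \<sigma> :: real assume \<sigma>: "\<sigma> > 1"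
  obtain M where M: "M \<ge> 0" "\<And>ys. length ys = length xs \<Longrightarrow> \<bar>T ys\<bar> \<le> M * prod_list (map norm ys)"
    using multilinear_bounded[OF T] by blast
  obtain C where C: "\<And>n. prod_list (map (\<lambda>x. norm ((h ^^ n) x)) xs) \<le> C * (prod_list (map m xs) * \<sigma> ^ length xs) ^ n"
    using grows_prod_list[OF m \<sigma>] by blast
  have it: "T (map (h ^^ n) xs) = \<tau> ^ n * T xs" for n
  proof (induction n)
    case (Suc n)
    have "T (map (h ^^ Suc n) xs) = T (map h (map (h ^^ n) xs))" by simp
    also have "\<dots> = \<tau> * T (map (h ^^ n) xs)" by (rule eq) simp
    finally show ?case by (simp only: Suc power_Suc mult.assoc)
  qed simp
  have bd: "\<bar>T xs\<bar> * \<tau> ^ n \<le> (M * C) * (prod_list (map m xs) * \<sigma> ^ length xs) ^ n" for n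
  proof -
    have "\<bar>T xs\<bar> * \<tau> ^ n = \<bar>T (map (h ^^ n) xs)\<bar>" using \<tau> by (simp add: it abs_mult)
    also have "\<dots> \<le> M * prod_list (map norm (map (h ^^ n) xs))" by (rule M(2)) simp
    also have "\<dots> \<le> M * (C * (prod_list (map m xs) * \<sigma> ^ length xs) ^ n)"
      using C[of n] M(1) by (intro mult_left_mono) (simp_all add: o_def)
    finally show ?thesis by simp
  qed
  have "prod_list (map m xs) > 0"
    using m by (induction xs) auto
  then show "\<tau> \<le> prod_list (map m xs) * \<sigma> ^ length xs"
    using nz \<sigma> by (intro power_bounded_imp_le[OF _ _ bd]) auto
qed

text \<open>The flow is \<open>t \<mapsto> s\<^sup>t\<close> for the positive part \<open>s\<close> of \<open>h\<close>, which acts on the generalized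
  eigenspaces of \<open>h\<close> as the absolute value of the eigenvalue. A form scaled by \<open>h\<close> can only pair
  eigenspaces for which the product of these absolute values is the scaling factor.\<close>

theorem ex_positive_part_flow:
  fixes h :: "'e::euclidean_space \<Rightarrow> 'e"
  assumes h: "linear h" "bij h"
  shows "\<exists>f. (\<forall>t. linear (f t) \<and> bij (f t)) \<and> (\<forall>n T \<tau> t xs. multilinear n T \<longrightarrow> \<tau> > 0 \<longrightarrow>
    (\<forall>ys. length ys = n \<longrightarrow> T (map h ys) = \<tau> * T ys) \<longrightarrow> length xs = n \<longrightarrow>
    T (map (f t) xs) = \<tau> powr t * T xs)"
proof -
  have "linear (inv h)" by (rule linear_inv[OF h])
  then interpret invertible_operator h "inv h"
    using h by unfold_locales (auto simp: bij_is_surj surj_f_inv_f bij_is_inj linear_add linear_scale)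
  obtain B m where B: "finite B" "independent B" "span B = UNIV"
    and m: "\<And>b. b \<in> B \<Longrightarrow> m b > 0 \<and> grows h (m b) b \<and> grows (inv h) (1 / m b) b"
    using growth_basis by blast
  have "\<forall>t. \<exists>f. linear f \<and> (\<forall>b\<in>B. f b = (m b powr t) *\<^sub>R b)"
    using linear_independent_extend[OF B(2), of "\<lambda>b. (m b powr t) *\<^sub>R b" for t] by (intro allI)
  from choice[OF this] obtain f where "\<forall>t. linear (f t) \<and> (\<forall>b\<in>B. f t b = (m b powr t) *\<^sub>R b)" ..
  then have lf: "\<And>t. linear (f t)" and f: "\<And>t b. b \<in> B \<Longrightarrow> f t b = (m b powr t) *\<^sub>R b"
    by simp_all
  have inverse: "f (- t) (f t x) = x" for t x
  proof -
    have "f (- t) (f t b) = b" if "b \<in> B" for b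
      using m[OF that] by (simp add: f[OF that] linear_scale[OF lf] powr_minus)
    then show ?thesis
      using linear_eq_on_span[of "\<lambda>x. f (- t) (f t x)" "\<lambda>x. x" B x] B(3)
        linear_compose[OF lf lf] by (auto simp: o_def linear_ident)
  qed
  have "bij (f t)" for t
    by (rule o_bij[of "f (- t)"]) (use inverse[of t] inverse[of "- t"] in auto)
  moreover have "T (map (f t) xs) = \<tau> powr t * T xs"
    if T: "multilinear n T" and \<tau>: "\<tau> > 0" and eq: "\<forall>ys. length ys = n \<longrightarrow> T (map h ys) = \<tau> * T ys"
      and "length xs = n" for n T \<tau> t xs
  proof (rule multilinear_eq_on_span[OF multilinear_map[OF T lf] multilinear_scale[OF T] B(3) _ \<open>length xs = n\<close>])
    fix bs assume bs: "length bs = n" "set bs \<subseteq> B"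
    have me: "map (f t) bs = map (\<lambda>b. (m b powr t) *\<^sub>R b) bs" using bs f by auto
    then have fT: "T (map (f t) bs) = prod_list (map (\<lambda>b. m b powr t) bs) * T bs"
      unfolding me using multilinear_map_scaleR[of bs T "\<lambda>b. m b powr t"] T bs by simp
    show "T (map (f t) bs) = \<tau> powr t * T bs"
    proof (cases "T bs = 0")
      case False
      have "\<tau> \<le> prod_list (map m bs)"
        by (rule eigenform_le[of bs T \<tau> h]) (use T \<tau> eq bs m False in auto)
      \<comment> \<open>The inverse operator scales \<open>T\<close> by \<open>1 / \<tau>\<close>
        and has the reciprocal growth rates, so the same estimate yields the opposite inequality and
        \<open>\<tau>\<close> equals the product of the rates.\<close>
      moreover have "1 / \<tau> \<le> prod_list (map (\<lambda>b. 1 / m b) bs)"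
      proof (rule eigenform_le[of bs T "1 / \<tau>" "inv h"])
        fix ys :: "'e list" assume "length ys = length bs"
        then have "T (map h (map (inv h) ys)) = \<tau> * T (map (inv h) ys)"
          using eq[rule_format, of "map (inv h) ys"] bs by simp
        moreover have "map h (map (inv h) ys) = ys" by (simp add: hk map_idI)
        ultimately show "T (map (inv h) ys) = 1 / \<tau> * T ys" using \<tau> by simp
      qed (use T \<tau> bs m False in auto)
      moreover have pos: "\<forall>b\<in>set bs. m b > 0" using m bs by blast
      then have "prod_list (map (\<lambda>b. 1 / m b) bs) = 1 / prod_list (map m bs)"
        "prod_list (map m bs) > 0" "prod_list (map (\<lambda>b. m b powr t) bs) = prod_list (map m bs) powr t"
        by (induction bs) (auto simp: powr_mult prod_list_nonneg)
      ultimately show ?thesis using fT \<tau> by (simp add: field_simps)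
    qed (use fT in simp)
  qed
  ultimately show ?thesis using lf by blast
qed

section \<open>Charts, frames and derivations\<close>

definition transition :: "('a, 'e::euclidean_space) chart \<Rightarrow> ('a, 'e) chart \<Rightarrow> 'e \<Rightarrow> 'e" where
  "transition c d = snd d \<circ> chart_inv c"

definition jac :: "('a, 'e::euclidean_space) chart \<Rightarrow> ('a, 'e) chart \<Rightarrow> 'a \<Rightarrow> 'e \<Rightarrow> 'e" where
  "jac c d P v = frechet_derivative (transition c d) (at (snd c P)) v"

text \<open>The first term differentiates the direction \<open>\<eta>\<close>, the second the point
  at which \<open>F\<close> is differentiated. In a Lie bracket the terms of the second kind
  cancel.\<close>

lemma frechet_derivative_of_directional:
  fixes F :: "'e::euclidean_space \<Rightarrow> real" and \<eta> :: "'e \<Rightarrow> 'e"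
  assumes T: "open T" "p \<in> T" and F: "Cinf_on T F" and \<eta>: "Cinf_on T \<eta>"
  shows "frechet_derivative (\<lambda>y. frechet_derivative F (at y) (\<eta> y)) (at p) v =
    frechet_derivative F (at p) (frechet_derivative \<eta> (at p) v)
    + frechet_derivative (\<lambda>y. frechet_derivative F (at y) (\<eta> p)) (at p) v"
proof -
  let ?F' = "\<lambda>y. frechet_derivative F (at y)"
  have lin: "linear (?F' y)" if "y \<in> T" for y
    using has_derivative_linear[OF Cinf_on_has_derivative[OF F that]] .
  have dF: "((\<lambda>y. ?F' y b) has_derivative frechet_derivative (\<lambda>y. ?F' y b) (at p)) (at p)" for b
    by (rule Cinf_on_has_derivative[OF Cinf_on_derivative[OF F] T(2)])
  have d\<eta>: "((\<lambda>y. \<eta> y \<bullet> b) has_derivative (\<lambda>v. frechet_derivative \<eta> (at p) v \<bullet> b)) (at p)" for b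
    by (rule has_derivative_inner_left[OF Cinf_on_has_derivative[OF \<eta> T(2)]])
  have sum1: "((\<lambda>y. \<Sum>b\<in>Basis. (\<eta> y \<bullet> b) *\<^sub>R ?F' y b) has_derivative (\<lambda>v. \<Sum>b\<in>Basis.
      (\<eta> p \<bullet> b) *\<^sub>R frechet_derivative (\<lambda>y. ?F' y b) (at p) v + (frechet_derivative \<eta> (at p) v \<bullet> b) *\<^sub>R ?F' p b)) (at p)"
    by (intro has_derivative_sum has_derivative_scaleR d\<eta> dF)
  have D1: "((\<lambda>y. ?F' y (\<eta> y)) has_derivative (\<lambda>v. \<Sum>b\<in>Basis.
      (\<eta> p \<bullet> b) *\<^sub>R frechet_derivative (\<lambda>y. ?F' y b) (at p) v + (frechet_derivative \<eta> (at p) v \<bullet> b) *\<^sub>R ?F' p b)) (at p)"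
    by (rule has_derivative_transform_within_open[OF sum1 T])
      (rule linear_euclidean_expansion[OF lin, symmetric])
  have sum2: "((\<lambda>y. \<Sum>b\<in>Basis. (\<eta> p \<bullet> b) *\<^sub>R ?F' y b) has_derivative (\<lambda>v. \<Sum>b\<in>Basis.
      (\<eta> p \<bullet> b) *\<^sub>R frechet_derivative (\<lambda>y. ?F' y b) (at p) v)) (at p)"
    by (intro has_derivative_sum has_derivative_scaleR_right dF)
  have D2: "((\<lambda>y. ?F' y (\<eta> p)) has_derivative (\<lambda>v. \<Sum>b\<in>Basis.
      (\<eta> p \<bullet> b) *\<^sub>R frechet_derivative (\<lambda>y. ?F' y b) (at p) v)) (at p)"
    by (rule has_derivative_transform_within_open[OF sum2 T])
      (rule linear_euclidean_expansion[OF lin, symmetric])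
  have "?F' p (frechet_derivative \<eta> (at p) v) = (\<Sum>b\<in>Basis. (frechet_derivative \<eta> (at p) v \<bullet> b) *\<^sub>R ?F' p b)"
    by (rule linear_euclidean_expansion[OF lin[OF T(2)]])
  then show ?thesis
    unfolding frechet_derivative_at[OF D1, symmetric] frechet_derivative_at[OF D2, symmetric]
    by (simp add: sum.distrib)
qed

locale manifold =
  fixes \<A> :: "('a::{t2_space,second_countable_topology}, 'e::euclidean_space) chart set"
  assumes atlas: "smooth_atlas \<A>"
begin

lemma open_domain: "c \<in> \<A> \<Longrightarrow> open (fst c)"
  using atlas by (auto simp: smooth_atlas_def)

lemma homeo: "c \<in> \<A> \<Longrightarrow> homeomorphism (fst c) (snd c ` fst c) (snd c) (chart_inv c)"
  using atlas by (auto simp: smooth_atlas_def)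

lemma chart_inv_coord [simp]: "c \<in> \<A> \<Longrightarrow> P \<in> fst c \<Longrightarrow> chart_inv c (snd c P) = P"
  using homeo homeomorphism_apply1 by blast

lemma open_coord_image:
  assumes "c \<in> \<A>" "open U"
  shows "open (snd c ` (U \<inter> fst c))"
proof -
  have "openin (top_of_set (fst c)) (U \<inter> fst c)" using assms(2) by (subst Int_commute) (rule openin_open_Int)
  then have "openin (top_of_set (snd c ` fst c)) (snd c ` (U \<inter> fst c))"
    by (rule homeomorphism_imp_open_map[OF homeo[OF assms(1)]])
  moreover have "open (snd c ` fst c)" using atlas assms(1) by (auto simp: smooth_atlas_def)
  ultimately show ?thesis by (rule openin_open_trans)
qed

lemma Cinf_transition: "c \<in> \<A> \<Longrightarrow> d \<in> \<A> \<Longrightarrow> Cinf_on (snd c ` (fst c \<inter> fst d)) (transition c d)"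
  using atlas by (auto simp: smooth_atlas_def transition_def)

lemma transition_coord: "c \<in> \<A> \<Longrightarrow> P \<in> fst c \<Longrightarrow> transition c d (snd c P) = snd d P"
  by (simp add: transition_def)

lemma chart_at: "chart_at \<A> P \<in> \<A>" "P \<in> fst (chart_at \<A> P)"
proof -
  have "P \<in> (\<Union>c\<in>\<A>. fst c)" using atlas by (simp add: smooth_atlas_def)
  then have "\<exists>c. c \<in> \<A> \<and> P \<in> fst c" by blast
  from someI_ex[OF this] show "chart_at \<A> P \<in> \<A>" "P \<in> fst (chart_at \<A> P)"
    by (simp_all add: chart_at_def)
qed

lemma transition_has_derivative:
  assumes "c \<in> \<A>" "d \<in> \<A>" "P \<in> fst c" "P \<in> fst d"
  shows "(transition c d has_derivative jac c d P) (at (snd c P))"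
  unfolding jac_def using Cinf_on_has_derivative[OF Cinf_transition[OF assms(1,2)]] assms by simp

lemma linear_jac: "c \<in> \<A> \<Longrightarrow> d \<in> \<A> \<Longrightarrow> P \<in> fst c \<Longrightarrow> P \<in> fst d \<Longrightarrow> linear (jac c d P)"
  using transition_has_derivative has_derivative_linear by blast

lemma derivative_change_chart:
  assumes c: "c \<in> \<A>" "P \<in> fst c" and d: "d \<in> \<A>" "P \<in> fst d"
    and f: "(f \<circ> chart_inv d has_derivative f') (at (snd d P))"
  shows "(f \<circ> chart_inv c has_derivative (\<lambda>v. f' (jac c d P v))) (at (snd c P))"
proof (rule has_derivative_transform_within_open)
  show "((\<lambda>y. (f \<circ> chart_inv d) (transition c d y)) has_derivative (\<lambda>v. f' (jac c d P v))) (at (snd c P))"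
    by (rule has_derivative_compose[OF transition_has_derivative[OF c(1) d(1) c(2) d(2)],
          unfolded transition_coord[OF c, of d], OF f])
  show "open (snd c ` (fst d \<inter> fst c))" by (rule open_coord_image[OF c(1) open_domain[OF d(1)]])
  show "snd c P \<in> snd c ` (fst d \<inter> fst c)" using c d by blast
  show "(f \<circ> chart_inv d) (transition c d y) = (f \<circ> chart_inv c) y" if "y \<in> snd c ` (fst d \<inter> fst c)" for y
    using that c d by (auto simp: transition_coord)
qed

lemma jac_cocycle:
  assumes "c \<in> \<A>" "d \<in> \<A>" "e \<in> \<A>" "P \<in> fst c" "P \<in> fst d" "P \<in> fst e"
  shows "jac d e P (jac c d P v) = jac c e P v"
proof -
  have "(snd e \<circ> chart_inv c has_derivative (\<lambda>v. jac d e P (jac c d P v))) (at (snd c P))"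
    by (rule derivative_change_chart)
      (use assms transition_has_derivative[of d e P] in \<open>simp_all add: transition_def\<close>)
  then have "jac c e P = (\<lambda>v. jac d e P (jac c d P v))"
    using has_derivative_unique[OF transition_has_derivative] assms by (simp add: transition_def)
  then show ?thesis by simp
qed

lemma jac_self:
  assumes "c \<in> \<A>" "P \<in> fst c"
  shows "jac c c P v = v"
proof -
  have "(transition c c has_derivative (\<lambda>v. v)) (at (snd c P))"
    by (rule has_derivative_transform_within_open[OF has_derivative_ident, of "snd c ` (UNIV \<inter> fst c)"])
      (use assms open_coord_image[OF assms(1) open_UNIV] in \<open>auto simp: transition_coord\<close>)
  from has_derivative_unique[OF transition_has_derivative this] assms show ?thesis by simp
qed

lemma chart_coord_jac: "chart_coord \<A> c P v = jac (chart_at \<A> P) c P v"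
  by (simp add: chart_coord_def jac_def transition_def)

lemma linear_chart_coord: "c \<in> \<A> \<Longrightarrow> P \<in> fst c \<Longrightarrow> linear (chart_coord \<A> c P)"
  unfolding chart_coord_jac[abs_def] using linear_jac chart_at by simp

lemma chart_coord_self: "chart_coord \<A> (chart_at \<A> P) P v = v"
  by (simp add: chart_coord_jac jac_self chart_at)

text \<open>\<open>frame c P b\<close> is the tangent vector at \<open>P\<close> with coordinates \<open>b\<close> in the chart \<open>c\<close>.\<close>

definition frame :: "('a, 'e) chart \<Rightarrow> 'a \<Rightarrow> 'e \<Rightarrow> 'e" where
  "frame c P b = jac c (chart_at \<A> P) P b"

lemma chart_coord_frame:
  "c \<in> \<A> \<Longrightarrow> d \<in> \<A> \<Longrightarrow> P \<in> fst c \<Longrightarrow> P \<in> fst d \<Longrightarrow> chart_coord \<A> d P (frame c P b) = jac c d P b"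
  by (simp add: chart_coord_jac frame_def jac_cocycle chart_at)

lemma frame_chart_coord: "c \<in> \<A> \<Longrightarrow> P \<in> fst c \<Longrightarrow> frame c P (chart_coord \<A> c P v) = v"
  by (simp add: chart_coord_jac frame_def jac_cocycle chart_at jac_self)

lemma chart_coord_frame_self: "c \<in> \<A> \<Longrightarrow> P \<in> fst c \<Longrightarrow> chart_coord \<A> c P (frame c P b) = b"
  by (simp add: chart_coord_frame jac_self)

lemma linear_frame: "c \<in> \<A> \<Longrightarrow> P \<in> fst c \<Longrightarrow> linear (frame c P)"
  unfolding frame_def[abs_def] using linear_jac chart_at by simp

lemma bij_frame: "c \<in> \<A> \<Longrightarrow> P \<in> fst c \<Longrightarrow> bij (frame c P)"
  by (rule o_bij[of "chart_coord \<A> c P"]) (auto simp: frame_chart_coord chart_coord_frame_self)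

section \<open>Smooth functions and vector fields on the manifold\<close>

lemma smooth_funI:
  "(\<And>c. c \<in> \<A> \<Longrightarrow> Cinf_on (snd c ` (U \<inter> fst c)) (\<lambda>y. f (chart_inv c y))) \<Longrightarrow> smooth_fun \<A> U f"
  by (simp add: smooth_fun_def o_def)

lemma smooth_funD:
  "smooth_fun \<A> U f \<Longrightarrow> c \<in> \<A> \<Longrightarrow> Cinf_on (snd c ` (U \<inter> fst c)) (\<lambda>y. f (chart_inv c y))"
  by (simp add: smooth_fun_def o_def)

lemma smooth_fun_const: "smooth_fun \<A> U (\<lambda>p. k)"
  by (rule smooth_funI) simp

lemma smooth_fun_add: "open U \<Longrightarrow> smooth_fun \<A> U f \<Longrightarrow> smooth_fun \<A> U h \<Longrightarrow> smooth_fun \<A> U (\<lambda>p. f p + h p)"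
  by (rule smooth_funI) (intro Cinf_on_add open_coord_image smooth_funD)

lemma smooth_fun_mult: "open U \<Longrightarrow> smooth_fun \<A> U f \<Longrightarrow> smooth_fun \<A> U h \<Longrightarrow> smooth_fun \<A> U (\<lambda>p. f p * h p)"
  by (rule smooth_funI) (intro Cinf_on_mult open_coord_image smooth_funD)

lemma smooth_fun_diff:
  assumes "open U" "smooth_fun \<A> U f" "smooth_fun \<A> U h"
  shows "smooth_fun \<A> U (\<lambda>p. f p - h p)"
  using smooth_fun_add[OF assms(1,2) smooth_fun_mult[OF assms(1) smooth_fun_const[of U "-1"] assms(3)]] by simp

lemma smooth_fun_sum: "open U \<Longrightarrow> (\<And>i. i \<in> I \<Longrightarrow> smooth_fun \<A> U (f i)) \<Longrightarrow> smooth_fun \<A> U (\<lambda>p. \<Sum>i\<in>I. f i p)"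
  by (rule smooth_funI) (intro Cinf_on_sum open_coord_image smooth_funD)

lemma smooth_fun_cong:
  assumes "open U" "\<And>p. p \<in> U \<Longrightarrow> f p = h p" "smooth_fun \<A> U f"
  shows "smooth_fun \<A> U h"
proof (rule smooth_funI)
  fix c assume c: "c \<in> \<A>"
  show "Cinf_on (snd c ` (U \<inter> fst c)) (\<lambda>y. h (chart_inv c y))"
    by (rule Cinf_on_cong[OF open_coord_image[OF c assms(1)] _ smooth_funD[OF assms(3) c]])
      (use assms(2) c in auto)
qed

lemma smooth_vfieldI:
  "(\<And>c. c \<in> \<A> \<Longrightarrow> Cinf_on (snd c ` (U \<inter> fst c)) (vfield_coord \<A> c X)) \<Longrightarrow> smooth_vfield \<A> U X"
  by (simp add: smooth_vfield_def)

lemma smooth_vfieldD: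
  "smooth_vfield \<A> U X \<Longrightarrow> c \<in> \<A> \<Longrightarrow> Cinf_on (snd c ` (U \<inter> fst c)) (vfield_coord \<A> c X)"
  by (simp add: smooth_vfield_def)

lemma vfield_coord_coord: "c \<in> \<A> \<Longrightarrow> P \<in> fst c \<Longrightarrow> vfield_coord \<A> c X (snd c P) = chart_coord \<A> c P (X P)"
  by (simp add: vfield_coord_def)

lemma smooth_vfield_combine:
  assumes "open U" "smooth_fun \<A> U f" "smooth_vfield \<A> U X" "smooth_vfield \<A> U Y"
  shows "smooth_vfield \<A> U (\<lambda>p. f p *\<^sub>R X p + Y p)"
proof (rule smooth_vfieldI)
  fix c assume c: "c \<in> \<A>"
  show "Cinf_on (snd c ` (U \<inter> fst c)) (vfield_coord \<A> c (\<lambda>p. f p *\<^sub>R X p + Y p))"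
  proof (rule Cinf_on_cong[OF open_coord_image[OF c assms(1)]])
    show "Cinf_on (snd c ` (U \<inter> fst c)) (\<lambda>y. f (chart_inv c y) *\<^sub>R vfield_coord \<A> c X y + vfield_coord \<A> c Y y)"
      by (intro Cinf_on_add Cinf_on_scaleR open_coord_image c assms(1) smooth_funD[OF assms(2)]
          smooth_vfieldD[OF assms(3)] smooth_vfieldD[OF assms(4)])
    show "f (chart_inv c y) *\<^sub>R vfield_coord \<A> c X y + vfield_coord \<A> c Y y
        = vfield_coord \<A> c (\<lambda>p. f p *\<^sub>R X p + Y p) y" if "y \<in> snd c ` (U \<inter> fst c)" for y
      using that c by (auto simp: vfield_coord_coord linear_add[OF linear_chart_coord] linear_scale[OF linear_chart_coord])
  qed
qed

lemma smooth_vfield_zero: "smooth_vfield \<A> U (\<lambda>p. 0)"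
  if "open U"
proof (rule smooth_vfieldI)
  fix c assume c: "c \<in> \<A>"
  show "Cinf_on (snd c ` (U \<inter> fst c)) (vfield_coord \<A> c (\<lambda>p. 0))"
    by (rule Cinf_on_cong[OF open_coord_image[OF c that] _ Cinf_on_const[of _ 0]])
      (use c in \<open>auto simp: vfield_coord_coord linear_0[OF linear_chart_coord]\<close>)
qed

lemma smooth_vfield_scale:
  assumes "open U" "smooth_fun \<A> U f" "smooth_vfield \<A> U X"
  shows "smooth_vfield \<A> U (\<lambda>p. f p *\<^sub>R X p)"
  using smooth_vfield_combine[OF assms smooth_vfield_zero[OF assms(1)]] by simp

lemma smooth_vfield_add:
  assumes "open U" "smooth_vfield \<A> U X" "smooth_vfield \<A> U Y"
  shows "smooth_vfield \<A> U (\<lambda>p. X p + Y p)"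
  using smooth_vfield_combine[OF assms(1) smooth_fun_const[of U 1] assms(2,3)] by simp

lemma smooth_vfield_diff:
  assumes "open U" "smooth_vfield \<A> U X" "smooth_vfield \<A> U Y"
  shows "smooth_vfield \<A> U (\<lambda>p. X p - Y p)"
  using smooth_vfield_combine[OF assms(1) smooth_fun_const[of U "- 1"] assms(3,2)] by simp

lemma smooth_vfield_subset: "smooth_vfield \<A> U X \<Longrightarrow> V \<subseteq> U \<Longrightarrow> smooth_vfield \<A> V X"
  by (rule smooth_vfieldI, rule Cinf_on_subset[OF smooth_vfieldD]) auto

lemma smooth_vfield_cong:
  assumes "open U" "\<And>p. p \<in> U \<Longrightarrow> X p = Y p" "smooth_vfield \<A> U X"
  shows "smooth_vfield \<A> U Y"
proof (rule smooth_vfieldI)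
  fix c assume c: "c \<in> \<A>"
  show "Cinf_on (snd c ` (U \<inter> fst c)) (vfield_coord \<A> c Y)"
    by (rule Cinf_on_cong[OF open_coord_image[OF c assms(1)] _ smooth_vfieldD[OF assms(3) c]])
      (use assms(2) c in \<open>auto simp: vfield_coord_coord\<close>)
qed

text \<open>Smoothness must be checked in every chart of the atlas. For objects supported in one
  chart \<open>c\<close>, composition with the transition map reduces this to the expression in
  \<open>c\<close>.\<close>

lemma Cinf_transition_compose:
  assumes c: "c \<in> \<A>" and d: "d \<in> \<A>" and U: "open U" "U \<subseteq> fst c"
    and F: "Cinf_on (snd c ` U) F"
  shows "Cinf_on (snd d ` (U \<inter> fst d)) (\<lambda>y. F (transition d c y))"
proof (rule Cinf_on_compose[OF open_coord_image[OF d U(1)] _ F])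
  show "transition d c ` snd d ` (U \<inter> fst d) \<subseteq> snd c ` U" using d by (auto simp: transition_coord)
  show "Cinf_on (snd d ` (U \<inter> fst d)) (transition d c)"
    by (rule Cinf_on_subset[OF Cinf_transition[OF d c]]) (use U in auto)
qed

lemma smooth_frame:
  assumes c: "c \<in> \<A>"
  shows "smooth_vfield \<A> (fst c) (\<lambda>P. frame c P b)"
proof (rule smooth_vfieldI)
  fix d assume d: "d \<in> \<A>"
  have *: "Cinf_on (snd c ` (fst c \<inter> fst d)) (\<lambda>y. frechet_derivative (transition c d) (at y) b)"
    by (rule Cinf_on_derivative[OF Cinf_transition[OF c d]])
  have "Cinf_on (snd d ` (fst c \<inter> fst d \<inter> fst d)) (\<lambda>y. frechet_derivative (transition c d) (at (transition d c y)) b)"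
    by (rule Cinf_transition_compose[OF c d open_Int[OF open_domain[OF c] open_domain[OF d]] _ *]) auto
  then have **: "Cinf_on (snd d ` (fst c \<inter> fst d)) (\<lambda>y. frechet_derivative (transition c d) (at (transition d c y)) b)"
    by (simp add: Int_assoc)
  show "Cinf_on (snd d ` (fst c \<inter> fst d)) (vfield_coord \<A> d (\<lambda>P. frame c P b))"
    by (rule Cinf_on_cong[OF open_coord_image[OF d open_domain[OF c]] _ **])
      (use c d in \<open>auto simp: vfield_coord_coord chart_coord_frame jac_def transition_coord\<close>)
qed

lemma smooth_fun_coefficient:
  assumes c: "c \<in> \<A>" and U: "open U" "U \<subseteq> fst c" and X: "smooth_vfield \<A> U X"
  shows "smooth_fun \<A> U (\<lambda>P. chart_coord \<A> c P (X P) \<bullet> b)"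
proof (rule smooth_funI)
  fix d assume d: "d \<in> \<A>"
  have "U \<inter> fst c = U" using U by auto
  then have "Cinf_on (snd c ` U) (\<lambda>y. vfield_coord \<A> c X y \<bullet> b)"
    using Cinf_on_inner_const[OF open_coord_image[OF c U(1)] smooth_vfieldD[OF X c]] by simp
  note * = Cinf_transition_compose[OF c d U this]
  show "Cinf_on (snd d ` (U \<inter> fst d)) (\<lambda>y. chart_coord \<A> c (chart_inv d y) (X (chart_inv d y)) \<bullet> b)"
    by (rule Cinf_on_cong[OF open_coord_image[OF d U(1)] _ *])
      (use c d U in \<open>auto simp: transition_coord vfield_coord_coord\<close>)
qed

lemma frame_expansion:
  assumes "c \<in> \<A>" "P \<in> fst c"
  shows "v = (\<Sum>b\<in>Basis. (chart_coord \<A> c P v \<bullet> b) *\<^sub>R frame c P b)"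
  using linear_euclidean_expansion[OF linear_frame[OF assms], of "chart_coord \<A> c P v"]
    frame_chart_coord[OF assms] by simp

section \<open>Derivations along vector fields\<close>

lemma fun_has_derivative:
  assumes "smooth_fun \<A> U f" "c \<in> \<A>" "P \<in> fst c" "P \<in> U"
  shows "(f \<circ> chart_inv c has_derivative frechet_derivative (f \<circ> chart_inv c) (at (snd c P))) (at (snd c P))"
  using Cinf_on_has_derivative[OF smooth_funD[OF assms(1,2)]] assms by (simp add: o_def)

lemma dir_deriv_chart:
  assumes U: "open U" "P \<in> U" and f: "smooth_fun \<A> U f" and c: "c \<in> \<A>" "P \<in> fst c"
  shows "dir_deriv \<A> X f P = frechet_derivative (f \<circ> chart_inv c) (at (snd c P)) (chart_coord \<A> c P (X P))"
proof -
  let ?d = "chart_at \<A> P"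
  have "(f \<circ> chart_inv ?d has_derivative
      (\<lambda>v. frechet_derivative (f \<circ> chart_inv c) (at (snd c P)) (jac ?d c P v))) (at (snd ?d P))"
    by (rule derivative_change_chart[OF chart_at c fun_has_derivative[OF f c U(2)]])
  from frechet_derivative_at[OF this] show ?thesis
    unfolding dir_deriv_def chart_coord_jac by metis
qed

lemma dir_deriv_coord:
  assumes "open U" "smooth_fun \<A> U f" "c \<in> \<A>" "y \<in> snd c ` (U \<inter> fst c)"
  shows "dir_deriv \<A> X f (chart_inv c y) = frechet_derivative (\<lambda>y. f (chart_inv c y)) (at y) (vfield_coord \<A> c X y)"
  using assms dir_deriv_chart[of U _ f c X] by (auto simp: vfield_coord_coord o_def)

lemma smooth_dir_deriv:
  assumes U: "open U" and f: "smooth_fun \<A> U f" and X: "smooth_vfield \<A> U X"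
  shows "smooth_fun \<A> U (dir_deriv \<A> X f)"
proof (rule smooth_funI)
  fix c assume c: "c \<in> \<A>"
  note S = open_coord_image[OF c U]
  have *: "Cinf_on (snd c ` (U \<inter> fst c)) (\<lambda>y. frechet_derivative (\<lambda>y. f (chart_inv c y)) (at y) (vfield_coord \<A> c X y))"
    by (rule Cinf_on_derivative_apply[OF S smooth_funD[OF f c] Cinf_on_id[OF S] _ smooth_vfieldD[OF X c]]) auto
  show "Cinf_on (snd c ` (U \<inter> fst c)) (\<lambda>y. dir_deriv \<A> X f (chart_inv c y))"
    by (rule Cinf_on_cong[OF S _ *]) (rule dir_deriv_coord[OF U f c, symmetric])
qed

lemma dir_deriv_cong:
  assumes U: "open U" "P \<in> U" and f: "smooth_fun \<A> U f" and eq: "\<And>p. p \<in> U \<Longrightarrow> f p = h p" and X: "X P = Y P"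
  shows "dir_deriv \<A> X f P = dir_deriv \<A> Y h P"
proof -
  let ?c = "chart_at \<A> P"
  have "(h \<circ> chart_inv ?c has_derivative frechet_derivative (f \<circ> chart_inv ?c) (at (snd ?c P))) (at (snd ?c P))"
    by (rule has_derivative_transform_within_open[OF fun_has_derivative[OF f chart_at U(2)]
          open_coord_image[OF chart_at(1) U(1), of P]])
      (use U chart_at eq in auto)
  from frechet_derivative_at[OF this] show ?thesis by (simp add: dir_deriv_def X)
qed

lemma dir_deriv_add:
  assumes "P \<in> U" "smooth_fun \<A> U f" "smooth_fun \<A> U h"
  shows "dir_deriv \<A> X (\<lambda>p. f p + h p) P = dir_deriv \<A> X f P + dir_deriv \<A> X h P"
proof -
  let ?c = "chart_at \<A> P"
  from frechet_derivative_at[OF has_derivative_add[OF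
      fun_has_derivative[OF assms(2) chart_at assms(1)] fun_has_derivative[OF assms(3) chart_at assms(1)]]]
  show ?thesis unfolding dir_deriv_def by (simp add: o_def fun_eq_iff)
qed

lemma dir_deriv_mult:
  assumes "P \<in> U" "smooth_fun \<A> U f" "smooth_fun \<A> U h"
  shows "dir_deriv \<A> X (\<lambda>p. f p * h p) P = f P * dir_deriv \<A> X h P + dir_deriv \<A> X f P * h P"
proof -
  from frechet_derivative_at[OF has_derivative_mult[OF
      fun_has_derivative[OF assms(2) chart_at assms(1)] fun_has_derivative[OF assms(3) chart_at assms(1)]]]
  show ?thesis unfolding dir_deriv_def by (simp add: o_def fun_eq_iff chart_at)
qed

lemma dir_deriv_combine_field:
  assumes "P \<in> U" "smooth_fun \<A> U h"
  shows "dir_deriv \<A> (\<lambda>p. f p *\<^sub>R X p + Y p) h P = f P * dir_deriv \<A> X h P + dir_deriv \<A> Y h P"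
  unfolding dir_deriv_def
  using has_derivative_linear[OF fun_has_derivative[OF assms(2) chart_at assms(1)]]
  by (simp add: linear_add linear_scale)

text \<open>In the preferred chart the iterated derivatives split into a term with the derivative of
  a field and a second derivative of \<open>f\<close>. Symmetry removes the latter from the
  commutator, and the former are the formula for the bracket.\<close>

lemma dir_deriv_lie_bracket:
  assumes U: "open U" "P \<in> U" and f: "smooth_fun \<A> U f"
    and X: "smooth_vfield \<A> U X" and Y: "smooth_vfield \<A> U Y"
  shows "dir_deriv \<A> (lie_bracket \<A> X Y) f P
    = dir_deriv \<A> X (dir_deriv \<A> Y f) P - dir_deriv \<A> Y (dir_deriv \<A> X f) P"
proof -
  define c where "c = chart_at \<A> P"
  define p where "p = snd c P"
  define T where "T = snd c ` (U \<inter> fst c)"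
  define F where "F = (\<lambda>y. f (chart_inv c y))"
  note c = chart_at[of P, folded c_def]
  have T: "open T" "p \<in> T" unfolding T_def p_def using open_coord_image[OF c(1) U(1)] U c by auto
  have F: "Cinf_on T F" unfolding T_def F_def by (rule smooth_funD[OF f c(1)])
  have iterated: "dir_deriv \<A> X (dir_deriv \<A> Y f) P
      = frechet_derivative F (at p) (frechet_derivative (vfield_coord \<A> c Y) (at p) (X P))
      + frechet_derivative (\<lambda>y. frechet_derivative F (at y) (Y P)) (at p) (X P)"
    if Y: "smooth_vfield \<A> U Y" for X Y
  proof -
    have "((\<lambda>y. frechet_derivative F (at y) (vfield_coord \<A> c Y y)) has_derivative
        frechet_derivative (dir_deriv \<A> Y f \<circ> chart_inv c) (at p)) (at p)"
      by (rule has_derivative_transform_within_open[OF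
            fun_has_derivative[OF smooth_dir_deriv[OF U(1) f Y] c U(2), folded p_def] T])
        (use dir_deriv_coord[OF U(1) f c(1)] in \<open>simp add: T_def F_def\<close>)
    from frechet_derivative_at[OF this]
    have "dir_deriv \<A> X (dir_deriv \<A> Y f) P
        = frechet_derivative (\<lambda>y. frechet_derivative F (at y) (vfield_coord \<A> c Y y)) (at p) (X P)"
      by (simp add: dir_deriv_def c_def p_def)
    also have "vfield_coord \<A> c Y p = Y P"
      unfolding p_def vfield_coord_coord[OF c] unfolding c_def by (rule chart_coord_self)
    then have "frechet_derivative (\<lambda>y. frechet_derivative F (at y) (vfield_coord \<A> c Y y)) (at p) (X P)
      = frechet_derivative F (at p) (frechet_derivative (vfield_coord \<A> c Y) (at p) (X P))
      + frechet_derivative (\<lambda>y. frechet_derivative F (at y) (Y P)) (at p) (X P)"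
      using frechet_derivative_of_directional[OF T F, of "vfield_coord \<A> c Y"] smooth_vfieldD[OF Y c(1)]
      by (simp add: T_def)
    finally show ?thesis .
  qed
  have "linear (frechet_derivative F (at p))"
    using has_derivative_linear[OF Cinf_on_has_derivative[OF F T(2)]] .
  moreover have "dir_deriv \<A> (lie_bracket \<A> X Y) f P = frechet_derivative F (at p)
      (frechet_derivative (vfield_coord \<A> c Y) (at p) (X P) - frechet_derivative (vfield_coord \<A> c X) (at p) (Y P))"
    by (simp add: dir_deriv_def lie_bracket_def Let_def c_def p_def F_def o_def)
  ultimately show ?thesis
    using iterated[OF Y] iterated[OF X] second_derivative_symmetric[OF T(1) F T(2), of "Y P" "X P"]
    by (simp add: linear_diff)
qed

end

section \<open>The curvature tensor and its covariant derivatives\<close>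

locale levi_civita_manifold = manifold \<A>
  for \<A> :: "('a::{t2_space,second_countable_topology}, 'e::euclidean_space) chart set" +
  fixes g :: "'a \<Rightarrow> 'e \<Rightarrow> 'e \<Rightarrow> real" and D :: "('a, 'e) connection"
  assumes metric: "pseudo_riemannian_metric \<A> g"
    and LC: "levi_civita_connection \<A> g D"
begin

abbreviation SV :: "'a set \<Rightarrow> ('a, 'e) vfield \<Rightarrow> bool" where "SV U X \<equiv> smooth_vfield \<A> U X"

abbreviation Rm where "Rm \<equiv> curvature_operator \<A> D"

lemma inner_g: "nondegenerate_inner_product (g P)"
  using metric by (simp add: pseudo_riemannian_metric_def)

lemma g_sym: "g P x y = g P y x"
  using inner_g[of P] by (simp add: nondegenerate_inner_product_def)

lemma linear_g: "linear (g P x)" "linear (\<lambda>x. g P x y)"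
proof -
  show 1: "linear (g P x)" for x using inner_g[of P] by (simp add: nondegenerate_inner_product_def)
  have "(\<lambda>x. g P x y) = g P y" by (rule ext) (rule g_sym)
  then show "linear (\<lambda>x. g P x y)" using 1 by simp
qed

lemma g_eqI: "(\<And>w. g P x w = g P y w) \<Longrightarrow> x = y"
proof -
  assume "\<And>w. g P x w = g P y w"
  then have "g P (x - y) w = 0" for w by (simp add: linear_diff[OF linear_g(2)])
  then show ?thesis using inner_g[of P] unfolding nondegenerate_inner_product_def by (metis eq_iff_diff_eq_0)
qed

lemma smooth_g: "open U \<Longrightarrow> SV U X \<Longrightarrow> SV U Y \<Longrightarrow> smooth_fun \<A> U (\<lambda>p. g p (X p) (Y p))"
  using metric by (simp add: pseudo_riemannian_metric_def)

lemma affine: "affine_connection \<A> D"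
  using LC by (simp add: levi_civita_connection_def)

lemma D_smooth: "open U \<Longrightarrow> SV U X \<Longrightarrow> SV U Y \<Longrightarrow> SV U (D X Y)"
  using affine unfolding affine_connection_def by blast

lemma D_cong:
  assumes "open U" "SV U X" "SV U X'" "SV U Y" "SV U Y'" "\<And>p. p \<in> U \<Longrightarrow> X p = X' p"
    "\<And>p. p \<in> U \<Longrightarrow> Y p = Y' p" "P \<in> U"
  shows "D X Y P = D X' Y' P"
  using affine[unfolded affine_connection_def, rule_format, OF assms(1), of X X' Y Y'] assms by blast

lemma D_add_left: "open U \<Longrightarrow> SV U X \<Longrightarrow> SV U X' \<Longrightarrow> SV U Y \<Longrightarrow> P \<in> U \<Longrightarrow>
    D (\<lambda>p. X p + X' p) Y P = D X Y P + D X' Y P"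
  using affine[unfolded affine_connection_def, rule_format, of U X X' Y Y] by blast

lemma D_add_right: "open U \<Longrightarrow> SV U X \<Longrightarrow> SV U Y \<Longrightarrow> SV U Y' \<Longrightarrow> P \<in> U \<Longrightarrow>
    D X (\<lambda>p. Y p + Y' p) P = D X Y P + D X Y' P"
  using affine[unfolded affine_connection_def, rule_format, of U X X Y Y'] by blast

lemma D_scale: "open U \<Longrightarrow> SV U X \<Longrightarrow> SV U Y \<Longrightarrow> smooth_fun \<A> U f \<Longrightarrow> P \<in> U \<Longrightarrow>
    D (\<lambda>p. f p *\<^sub>R X p) Y P = f P *\<^sub>R D X Y P \<and>
    D X (\<lambda>p. f p *\<^sub>R Y p) P = dir_deriv \<A> X f P *\<^sub>R Y P + f P *\<^sub>R D X Y P"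
  using affine[unfolded affine_connection_def, rule_format, of U X X Y Y] by blast

lemma D_combine_left:
  assumes "open U" "smooth_fun \<A> U f" "SV U X" "SV U X'" "SV U Y" "P \<in> U"
  shows "D (\<lambda>p. f p *\<^sub>R X p + X' p) Y P = f P *\<^sub>R D X Y P + D X' Y P"
  using D_add_left[OF assms(1) smooth_vfield_scale[OF assms(1-3)] assms(4-6)] D_scale[OF assms(1,3,5,2,6)]
  by simp

lemma D_combine_right:
  assumes "open U" "smooth_fun \<A> U f" "SV U X" "SV U Y" "SV U Y'" "P \<in> U"
  shows "D X (\<lambda>p. f p *\<^sub>R Y p + Y' p) P = dir_deriv \<A> X f P *\<^sub>R Y P + f P *\<^sub>R D X Y P + D X Y' P"
  using D_add_right[OF assms(1,3) smooth_vfield_scale[OF assms(1,2,4)] assms(5,6)] D_scale[OF assms(1,3,4,2,6)]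
  by simp

lemma torsion_free: "open U \<Longrightarrow> SV U X \<Longrightarrow> SV U Y \<Longrightarrow> P \<in> U \<Longrightarrow> D X Y P - D Y X P = lie_bracket \<A> X Y P"
  using LC unfolding levi_civita_connection_def by blast

lemma compatible: "open U \<Longrightarrow> SV U X \<Longrightarrow> SV U Y \<Longrightarrow> SV U Z \<Longrightarrow> P \<in> U \<Longrightarrow>
    dir_deriv \<A> X (\<lambda>p. g p (Y p) (Z p)) P = g P (D X Y P) (Z P) + g P (Y P) (D X Z P)"
  using LC unfolding levi_civita_connection_def by blast

section \<open>Linearity of the curvature operator over the smooth functions\<close>

text \<open>Torsion freeness expresses the bracket through \<open>D\<close>, whose values on smooth
  fields are smooth. The same detour proves its locality and its product rule later, without
  coordinates.\<close>

lemma smooth_bracket: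
  assumes "open U" "SV U X" "SV U Y"
  shows "SV U (lie_bracket \<A> X Y)"
  by (rule smooth_vfield_cong[OF assms(1) torsion_free[OF assms]
        smooth_vfield_diff[OF assms(1) D_smooth[OF assms] D_smooth[OF assms(1,3,2)]]])

lemma smooth_curvature:
  assumes "open U" "SV U X" "SV U Y" "SV U Z"
  shows "SV U (Rm X Y Z)"
  unfolding curvature_operator_def
  by (intro smooth_vfield_diff D_smooth smooth_bracket assms)

lemma bracket_cong:
  assumes "open U" "SV U X" "SV U X'" "SV U Y" "SV U Y'" "\<And>p. p \<in> U \<Longrightarrow> X p = X' p"
    "\<And>p. p \<in> U \<Longrightarrow> Y p = Y' p" "P \<in> U"
  shows "lie_bracket \<A> X Y P = lie_bracket \<A> X' Y' P"
  using torsion_free[OF assms(1,2,4,8)] torsion_free[OF assms(1,3,5,8)]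
    D_cong[OF assms] D_cong[OF assms(1,4,5,2,3,7,6,8)] by simp

lemma curvature_cong:
  assumes U: "open U" and X: "SV U X" "SV U X'" and Y: "SV U Y" "SV U Y'" and Z: "SV U Z" "SV U Z'"
    and eq: "\<And>p. p \<in> U \<Longrightarrow> X p = X' p" "\<And>p. p \<in> U \<Longrightarrow> Y p = Y' p" "\<And>p. p \<in> U \<Longrightarrow> Z p = Z' p"
    and P: "P \<in> U"
  shows "Rm X Y Z P = Rm X' Y' Z' P"
proof -
  note s = D_smooth[OF U] smooth_bracket[OF U]
  have "D X (D Y Z) P = D X' (D Y' Z') P"
    by (rule D_cong[OF U]) (use X Y Z eq P s D_cong[OF U Y Z] in auto)
  moreover have "D Y (D X Z) P = D Y' (D X' Z') P"
    by (rule D_cong[OF U]) (use X Y Z eq P s D_cong[OF U X Z] in auto)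
  moreover have "D (lie_bracket \<A> X Y) Z P = D (lie_bracket \<A> X' Y') Z' P"
    by (rule D_cong[OF U]) (use X Y Z eq P s bracket_cong[OF U X Y] in auto)
  ultimately show ?thesis by (simp add: curvature_operator_def)
qed

text \<open>The combination of \<open>f\<close>, \<open>X\<close> and \<open>X'\<close> treats
  additivity and homogeneity together. The derivative of \<open>f\<close> along \<open>Y\<close>
  occurs once in the iterated connection and once through the bracket, with opposite effect.\<close>

lemma curvature_combine_1:
  assumes U: "open U" and f: "smooth_fun \<A> U f" and X: "SV U X" and X': "SV U X'" and Y: "SV U Y"
    and Z: "SV U Z" and P: "P \<in> U"
  shows "Rm (\<lambda>p. f p *\<^sub>R X p + X' p) Y Z P
    = f P *\<^sub>R Rm X Y Z P + Rm X' Y Z P"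
proof -
  let ?W = "\<lambda>p. f p *\<^sub>R X p + X' p"
  note s = D_smooth[OF U] smooth_bracket[OF U] smooth_vfield_combine[OF U] smooth_dir_deriv[OF U]
    smooth_fun_mult[OF U smooth_fun_const[of U "- 1"]]
  have W: "SV U ?W" by (intro s f X X')
  have 1: "D ?W (D Y Z) P = f P *\<^sub>R D X (D Y Z) P + D X' (D Y Z) P"
    by (rule D_combine_left[OF U f X X' _ P]) (intro s Y Z)
  have "D Y (D ?W Z) P = D Y (\<lambda>p. f p *\<^sub>R D X Z p + D X' Z p) P"
    by (rule D_cong[OF U Y Y _ _ refl _ P]) (intro s W f X X' Z | rule D_combine_left[OF U f X X' Z])+
  also have "\<dots> = dir_deriv \<A> Y f P *\<^sub>R D X Z P + f P *\<^sub>R D Y (D X Z) P + D Y (D X' Z) P"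
    by (rule D_combine_right[OF U f Y _ _ P]) (intro s X X' Z)+
  finally have 2: "D Y (D ?W Z) P = dir_deriv \<A> Y f P *\<^sub>R D X Z P + f P *\<^sub>R D Y (D X Z) P + D Y (D X' Z) P" .
  \<comment> \<open>The bracket of the combined field with \<open>Y\<close>, arranged as nested
    combinations so that \<open>D_combine_left\<close> applies twice.\<close>
  let ?B = "\<lambda>p. (- 1 * dir_deriv \<A> Y f p) *\<^sub>R X p + (f p *\<^sub>R lie_bracket \<A> X Y p + lie_bracket \<A> X' Y p)"
  have B: "lie_bracket \<A> ?W Y p = ?B p" if "p \<in> U" for p
    using torsion_free[OF U W Y that] torsion_free[OF U X Y that] torsion_free[OF U X' Y that]
      D_combine_left[OF U f X X' Y that] D_combine_right[OF U f Y X X' that]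
    by (simp add: algebra_simps)
  have sB: "SV U (\<lambda>p. f p *\<^sub>R lie_bracket \<A> X Y p + lie_bracket \<A> X' Y p)" by (intro s f X X' Y)
  have "D (lie_bracket \<A> ?W Y) Z P = D ?B Z P"
    by (rule D_cong[OF U _ _ Z Z B refl P]) (intro s W f X X' Y sB)+
  also have "\<dots> = (- 1 * dir_deriv \<A> Y f P) *\<^sub>R D X Z P
      + D (\<lambda>p. f p *\<^sub>R lie_bracket \<A> X Y p + lie_bracket \<A> X' Y p) Z P"
    by (rule D_combine_left[OF U _ X sB Z P]) (intro s f Y)
  also have "D (\<lambda>p. f p *\<^sub>R lie_bracket \<A> X Y p + lie_bracket \<A> X' Y p) Z P
      = f P *\<^sub>R D (lie_bracket \<A> X Y) Z P + D (lie_bracket \<A> X' Y) Z P"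
    by (rule D_combine_left[OF U f _ _ Z P]) (intro s X X' Y)+
  finally show ?thesis unfolding curvature_operator_def 1 2 by (simp add: algebra_simps)
qed

lemma curvature_antisym:
  assumes U: "open U" and X: "SV U X" and Y: "SV U Y" and Z: "SV U Z" and P: "P \<in> U"
  shows "Rm X Y Z P = - Rm Y X Z P"
proof -
  note b = smooth_bracket[OF U X Y]
  have "lie_bracket \<A> Y X = (\<lambda>p. - 1 *\<^sub>R lie_bracket \<A> X Y p)"
    by (simp add: lie_bracket_def Let_def fun_eq_iff)
  then have "D (lie_bracket \<A> Y X) Z P = - D (lie_bracket \<A> X Y) Z P"
    using D_scale[OF U b Z smooth_fun_const[of U "- 1"] P] by simp
  then show ?thesis by (simp add: curvature_operator_def)
qed

lemma curvature_combine_2: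
  assumes U: "open U" and f: "smooth_fun \<A> U f" and X: "SV U X" and Y: "SV U Y" and Y': "SV U Y'"
    and Z: "SV U Z" and P: "P \<in> U"
  shows "Rm X (\<lambda>p. f p *\<^sub>R Y p + Y' p) Z P
    = f P *\<^sub>R Rm X Y Z P + Rm X Y' Z P"
  using curvature_combine_1[OF U f Y Y' X Z P] curvature_antisym[OF U X Y Z P] curvature_antisym[OF U X Y' Z P]
    curvature_antisym[OF U X smooth_vfield_combine[OF U f Y Y'] Z P] by simp

text \<open>The mixed first order terms are symmetric in \<open>X\<close> and \<open>Y\<close> and
  drop out. The second derivatives of \<open>f\<close> leave the commutator of the two derivations,
  which the derivative along the bracket cancels.\<close>

lemma curvature_combine_3:
  assumes U: "open U" and f: "smooth_fun \<A> U f" and X: "SV U X" and Y: "SV U Y"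
    and Z: "SV U Z" and Z': "SV U Z'" and P: "P \<in> U"
  shows "Rm X Y (\<lambda>p. f p *\<^sub>R Z p + Z' p) P
    = f P *\<^sub>R Rm X Y Z P + Rm X Y Z' P"
proof -
  let ?W = "\<lambda>p. f p *\<^sub>R Z p + Z' p"
  note s = D_smooth[OF U] smooth_bracket[OF U] smooth_vfield_combine[OF U] smooth_dir_deriv[OF U]
  have W: "SV U ?W" by (intro s f Z Z')
  have DD: "D X (D Y ?W) P = dir_deriv \<A> X (dir_deriv \<A> Y f) P *\<^sub>R Z P + dir_deriv \<A> Y f P *\<^sub>R D X Z P
      + dir_deriv \<A> X f P *\<^sub>R D Y Z P + f P *\<^sub>R D X (D Y Z) P + D X (D Y Z') P"
    if X: "SV U X" and Y: "SV U Y" for X Y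
  proof -
    let ?V = "\<lambda>p. f p *\<^sub>R D Y Z p + D Y Z' p"
    have V: "SV U ?V" by (intro s f Y Z Z')
    have "D X (D Y ?W) P = D X (\<lambda>p. dir_deriv \<A> Y f p *\<^sub>R Z p + ?V p) P"
      by (rule D_cong[OF U X X _ _ refl _ P])
        (intro s W f X Y Z V | simp add: D_combine_right[OF U f Y Z Z'])+
    also have "\<dots> = dir_deriv \<A> X (dir_deriv \<A> Y f) P *\<^sub>R Z P + dir_deriv \<A> Y f P *\<^sub>R D X Z P + D X ?V P"
      by (rule D_combine_right[OF U _ X Z V P]) (intro s f Y)
    also have "D X ?V P = dir_deriv \<A> X f P *\<^sub>R D Y Z P + f P *\<^sub>R D X (D Y Z) P + D X (D Y Z') P"
      by (rule D_combine_right[OF U f X _ _ P]) (intro s Y Z Z')+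
    finally show ?thesis by simp
  qed
  have "D (lie_bracket \<A> X Y) ?W P = dir_deriv \<A> (lie_bracket \<A> X Y) f P *\<^sub>R Z P
      + f P *\<^sub>R D (lie_bracket \<A> X Y) Z P + D (lie_bracket \<A> X Y) Z' P"
    by (rule D_combine_right[OF U f smooth_bracket[OF U X Y] Z Z' P])
  then show ?thesis
    unfolding curvature_operator_def DD[OF X Y] DD[OF Y X] dir_deriv_lie_bracket[OF U P f X Y]
    by (simp add: algebra_simps)
qed

section \<open>Tensor fields as multilinear maps over the smooth functions\<close>

text \<open>The conditions are demanded over every open set, so that a tensor may be evaluated on
  local frames; they also make the property stable under \<open>cov_deriv0\<close>. The second one
  is locality, the third linearity over the smooth functions.\<close>

definition tensorial :: "nat \<Rightarrow> ('a, 'e) tensor_field0 \<Rightarrow> bool" where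
  "tensorial n T \<longleftrightarrow> (\<forall>U. open U \<longrightarrow>
    (\<forall>Xs. length Xs = n \<longrightarrow> (\<forall>X\<in>set Xs. SV U X) \<longrightarrow> smooth_fun \<A> U (T Xs)) \<and>
    (\<forall>Xs Ys. length Xs = n \<longrightarrow> length Ys = n \<longrightarrow> (\<forall>X\<in>set Xs. SV U X) \<longrightarrow> (\<forall>Y\<in>set Ys. SV U Y) \<longrightarrow>
      (\<forall>i<n. \<forall>p\<in>U. (Xs ! i) p = (Ys ! i) p) \<longrightarrow> (\<forall>p\<in>U. T Xs p = T Ys p)) \<and>
    (\<forall>Xs i f X Y. length Xs = n \<longrightarrow> (\<forall>X\<in>set Xs. SV U X) \<longrightarrow> i < n \<longrightarrow> smooth_fun \<A> U f \<longrightarrow> SV U X \<longrightarrow> SV U Y \<longrightarrow>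
      (\<forall>p\<in>U. T (Xs[i := \<lambda>p. f p *\<^sub>R X p + Y p]) p = f p * T (Xs[i := X]) p + T (Xs[i := Y]) p)))"

lemma tensorial_smooth:
  "tensorial n T \<Longrightarrow> open U \<Longrightarrow> length Xs = n \<Longrightarrow> \<forall>X\<in>set Xs. SV U X \<Longrightarrow> smooth_fun \<A> U (T Xs)"
  by (simp add: tensorial_def)

lemma tensorial_cong:
  assumes "tensorial n T" "open U" "length Xs = n" "length Ys = n" "\<forall>X\<in>set Xs. SV U X" "\<forall>Y\<in>set Ys. SV U Y"
    "\<And>i p. i < n \<Longrightarrow> p \<in> U \<Longrightarrow> (Xs ! i) p = (Ys ! i) p" "p \<in> U"
  shows "T Xs p = T Ys p"
  by (rule assms(1)[unfolded tensorial_def, THEN spec, THEN mp, OF assms(2), THEN conjunct2, THEN conjunct1, rule_format])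
    (use assms in auto)

lemma tensorial_combine:
  assumes "tensorial n T" "open U" "length Xs = n" "\<forall>X\<in>set Xs. SV U X" "i < n" "smooth_fun \<A> U f"
    "SV U X" "SV U Y" "p \<in> U"
  shows "T (Xs[i := \<lambda>p. f p *\<^sub>R X p + Y p]) p = f p * T (Xs[i := X]) p + T (Xs[i := Y]) p"
  by (rule assms(1)[unfolded tensorial_def, THEN spec, THEN mp, OF assms(2), THEN conjunct2, THEN conjunct2, rule_format])
    (use assms in auto)

lemma smooth_list_update: "\<forall>X\<in>set Xs. SV U X \<Longrightarrow> SV U Y \<Longrightarrow> \<forall>X\<in>set (Xs[i := Y]). SV U X"
  using set_update_subset_insert[of Xs i Y] by blast

lemma tensorial_curv04: "tensorial 4 (curv04 \<A> g D)"
  unfolding tensorial_def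
proof (intro allI impI conjI ballI)
  fix U :: "'a set" and Xs assume U: "open U" and Xs: "length Xs = 4" "\<forall>X\<in>set Xs. SV U X"
  have "SV U (Xs ! i)" if "i < 4" for i using Xs that by simp
  then show "smooth_fun \<A> U (curv04 \<A> g D Xs)"
    unfolding curv04_def by (intro smooth_g smooth_curvature U) simp_all
next
  fix U :: "'a set" and Xs Ys p
  assume U: "open U" and Xs: "length Xs = 4" and Ys: "length Ys = 4" and "\<forall>X\<in>set Xs. SV U X" "\<forall>Y\<in>set Ys. SV U Y"
    and eq: "\<forall>i<4. \<forall>p\<in>U. (Xs ! i) p = (Ys ! i) p" and p: "p \<in> U"
  then have "SV U (Xs ! i)" "SV U (Ys ! i)" if "i < 4" for i using that by simp_all
  then have "Rm (Xs ! 0) (Xs ! 1) (Xs ! 2) p = Rm (Ys ! 0) (Ys ! 1) (Ys ! 2) p"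
    using eq by (intro curvature_cong[OF U _ _ _ _ _ _ _ _ _ p]) simp_all
  then show "curv04 \<A> g D Xs p = curv04 \<A> g D Ys p"
    using eq p by (simp add: curv04_def)
next
  fix U :: "'a set" and Xs i f X Y p
  assume U: "open U" and Xs: "length Xs = 4" "\<forall>X\<in>set Xs. SV U X" and i: "i < (4::nat)"
    and f: "smooth_fun \<A> U f" and XY: "SV U X" "SV U Y" and p: "p \<in> U"
  have s: "SV U (Xs ! i)" if "i < 4" for i using Xs that by simp
  have s': "SV U (Xs ! 0)" "SV U (Xs ! Suc 0)" "SV U (Xs ! 2)" using s by simp_all
  have "i = 0 \<or> i = 1 \<or> i = 2 \<or> i = 3" using i by linarith
  then show "curv04 \<A> g D (Xs[i := \<lambda>p. f p *\<^sub>R X p + Y p]) p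
      = f p * curv04 \<A> g D (Xs[i := X]) p + curv04 \<A> g D (Xs[i := Y]) p"
    using curvature_combine_1[OF U f XY s'(2,3) p] curvature_combine_2[OF U f s'(1) XY s'(3) p]
      curvature_combine_3[OF U f s'(1,2) XY p]
    by (elim disjE) (simp_all add: curv04_def Xs(1) linear_add[OF linear_g(1)] linear_scale[OF linear_g(1)]
        linear_add[OF linear_g(2)] linear_scale[OF linear_g(2)])
qed

lemma cov_deriv0_snoc:
  "cov_deriv0 \<A> D T (Ys @ [V]) P = dir_deriv \<A> V (T Ys) P - (\<Sum>i<length Ys. T (Ys[i := D V (Ys ! i)]) P)"
  by (simp add: cov_deriv0_def)

lemma cov_deriv1_snoc:
  "cov_deriv1 D S (Ys @ [V]) P = D V (S Ys) P - (\<Sum>i<length Ys. S (Ys[i := D V (Ys ! i)]) P)"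
  by (simp add: cov_deriv1_def)

lemma smooth_cov_deriv0:
  assumes T: "tensorial n T" and U: "open U" and Ys: "length Ys = n" "\<forall>X\<in>set Ys. SV U X" and V: "SV U V"
  shows "smooth_fun \<A> U (cov_deriv0 \<A> D T (Ys @ [V]))"
  unfolding cov_deriv0_snoc[abs_def]
proof (intro smooth_fun_diff[OF U] smooth_fun_sum[OF U] smooth_dir_deriv[OF U] V tensorial_smooth[OF T U])
  fix i assume "i \<in> {..<length Ys}"
  then show "\<forall>X\<in>set (Ys[i := D V (Ys ! i)]). SV U X"
    using Ys V by (intro smooth_list_update D_smooth[OF U]) simp_all
qed (use Ys in simp_all)

lemma tensorial_cov_deriv0:
  assumes T: "tensorial n T"
  shows "tensorial (Suc n) (cov_deriv0 \<A> D T)"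
  unfolding tensorial_def
proof (intro allI impI conjI ballI)
  fix U :: "'a set" and Xs assume U: "open U" and Xs: "length Xs = Suc n" "\<forall>X\<in>set Xs. SV U X"
  then obtain Ys V where "Xs = Ys @ [V]" "length Ys = n" by (metis length_Suc_conv_rev)
  then show "smooth_fun \<A> U (cov_deriv0 \<A> D T Xs)"
    using smooth_cov_deriv0[OF T U] Xs(2) by simp
next
  fix U :: "'a set" and Xs Xs' p
  assume U: "open U" and Xs: "length Xs = Suc n" "\<forall>X\<in>set Xs. SV U X"
    and Xs': "length Xs' = Suc n" "\<forall>Y\<in>set Xs'. SV U Y"
    and eq: "\<forall>i<Suc n. \<forall>p\<in>U. (Xs ! i) p = (Xs' ! i) p" and p: "p \<in> U"
  obtain Ys V where Y: "Xs = Ys @ [V]" "length Ys = n" using Xs(1) by (metis length_Suc_conv_rev)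
  obtain Ys' V' where Y': "Xs' = Ys' @ [V']" "length Ys' = n" using Xs'(1) by (metis length_Suc_conv_rev)
  have s: "\<forall>X\<in>set Ys. SV U X" "SV U V" "\<forall>X\<in>set Ys'. SV U X" "SV U V'" using Xs(2) Xs'(2) Y Y' by auto
  have V: "V p = V' p" if "p \<in> U" for p
    using eq[rule_format, of n p] that Y Y' by (simp add: nth_append)
  have Ye: "(Ys ! i) p = (Ys' ! i) p" if "i < n" "p \<in> U" for i p
    using eq[rule_format, of i p] that Y Y' by (simp add: nth_append)
  have T_eq: "T Ys q = T Ys' q" if "q \<in> U" for q
    by (rule tensorial_cong[OF T U Y(2) Y'(2) s(1,3) _ that]) (rule Ye)
  have "dir_deriv \<A> V (T Ys) p = dir_deriv \<A> V' (T Ys') p"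
    by (rule dir_deriv_cong[where X = V and Y = V', OF U p tensorial_smooth[OF T U Y(2) s(1)] _ V[OF p]])
      (rule T_eq)
  moreover have "T (Ys[i := D V (Ys ! i)]) p = T (Ys'[i := D V' (Ys' ! i)]) p" if i: "i < n" for i
  proof (rule tensorial_cong[OF T U _ _ _ _ _ p])
    have si: "SV U (Ys ! i)" "SV U (Ys' ! i)" using s Y(2) Y'(2) i by simp_all
    show "\<forall>X\<in>set (Ys[i := D V (Ys ! i)]). SV U X" "\<forall>X\<in>set (Ys'[i := D V' (Ys' ! i)]). SV U X"
      using s si by (intro smooth_list_update D_smooth[OF U]; simp)+
    show "(Ys[i := D V (Ys ! i)] ! j) q = (Ys'[i := D V' (Ys' ! i)] ! j) q" if "j < n" "q \<in> U" for j q
      using that i Y(2) Y'(2) Ye D_cong[OF U s(2,4) si V Ye[OF i]] by (cases "j = i") auto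
  qed (use Y Y' in simp_all)
  ultimately show "cov_deriv0 \<A> D T Xs p = cov_deriv0 \<A> D T Xs' p"
    using Y Y' by (simp add: cov_deriv0_snoc)
next
  fix U :: "'a set" and Xs i f X Y p
  assume U: "open U" and Xs: "length Xs = Suc n" "\<forall>X\<in>set Xs. SV U X" and i: "i < Suc n"
    and f: "smooth_fun \<A> U f" and X: "SV U X" and Y: "SV U Y" and p: "p \<in> U"
  let ?W = "\<lambda>p. f p *\<^sub>R X p + Y p"
  have W: "SV U ?W" by (rule smooth_vfield_combine[OF U f X Y])
  obtain Ys V where YV: "Xs = Ys @ [V]" "length Ys = n" using Xs(1) by (metis length_Suc_conv_rev)
  have s: "\<forall>X\<in>set Ys. SV U X" "SV U V" using Xs(2) YV by auto
  have sj: "SV U (Ys ! j)" if "j < n" for j using s YV(2) that by simp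
  show "cov_deriv0 \<A> D T (Xs[i := ?W]) p = f p * cov_deriv0 \<A> D T (Xs[i := X]) p + cov_deriv0 \<A> D T (Xs[i := Y]) p"
  proof (cases "i = n")
    case True
    have "T (Ys[j := D ?W (Ys ! j)]) p = f p * T (Ys[j := D X (Ys ! j)]) p + T (Ys[j := D Y (Ys ! j)]) p"
      if j: "j < n" for j
    proof -
      have DX: "SV U (D X (Ys ! j))" "SV U (D Y (Ys ! j))" "SV U (D ?W (Ys ! j))"
        using sj[OF j] X Y W by (simp_all add: D_smooth[OF U])
      have "T (Ys[j := D ?W (Ys ! j)]) p = T (Ys[j := \<lambda>p. f p *\<^sub>R D X (Ys ! j) p + D Y (Ys ! j) p]) p"
      proof (rule tensorial_cong[OF T U _ _ _ _ _ p])
        show "(Ys[j := D ?W (Ys ! j)] ! k) q = (Ys[j := \<lambda>p. f p *\<^sub>R D X (Ys ! j) p + D Y (Ys ! j) p] ! k) q"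
          if "k < n" "q \<in> U" for k q
          using that j YV(2) D_combine_left[OF U f X Y sj[OF j] that(2)] by (cases "k = j") auto
      qed (use YV smooth_list_update[OF s(1) DX(3)]
            smooth_list_update[OF s(1) smooth_vfield_combine[OF U f DX(1,2)]] in simp_all)
      also have "\<dots> = f p * T (Ys[j := D X (Ys ! j)]) p + T (Ys[j := D Y (Ys ! j)]) p"
        by (rule tensorial_combine[OF T U YV(2) s(1) j f DX(1,2) p])
      finally show ?thesis .
    qed
    then have "(\<Sum>j<n. T (Ys[j := D ?W (Ys ! j)]) p)
        = f p * (\<Sum>j<n. T (Ys[j := D X (Ys ! j)]) p) + (\<Sum>j<n. T (Ys[j := D Y (Ys ! j)]) p)"
      by (simp add: sum.distrib sum_distrib_left)
    moreover have "dir_deriv \<A> ?W (T Ys) p = f p * dir_deriv \<A> X (T Ys) p + dir_deriv \<A> Y (T Ys) p"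
      by (rule dir_deriv_combine_field[OF p tensorial_smooth[OF T U YV(2) s(1)]])
    moreover have "Xs[i := Z] = Ys @ [Z]" for Z using YV True by (auto simp: list_update_append)
    ultimately show ?thesis using YV(2) by (simp add: cov_deriv0_snoc algebra_simps)
  next
    case False
    then have i: "i < n" using i by simp
    have up: "Xs[i := Z] = Ys[i := Z] @ [V]" for Z using YV i by (simp add: list_update_append)
    have sT: "smooth_fun \<A> U (T (Ys[i := Z]))" if "SV U Z" for Z
      using tensorial_smooth[OF T U] smooth_list_update[OF s(1) that] YV(2) by simp
    have "dir_deriv \<A> V (T (Ys[i := ?W])) p = dir_deriv \<A> V (\<lambda>q. f q * T (Ys[i := X]) q + T (Ys[i := Y]) q) p"
      by (rule dir_deriv_cong[OF U p sT[OF W] _ refl]) (rule tensorial_combine[OF T U YV(2) s(1) i f X Y])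
    also have "\<dots> = (f p * dir_deriv \<A> V (T (Ys[i := X])) p + dir_deriv \<A> V f p * T (Ys[i := X]) p)
        + dir_deriv \<A> V (T (Ys[i := Y])) p"
      by (simp only: dir_deriv_add[OF p smooth_fun_mult[OF U f sT[OF X]] sT[OF Y]] dir_deriv_mult[OF p f sT[OF X]])
    finally have d: "dir_deriv \<A> V (T (Ys[i := ?W])) p = f p * dir_deriv \<A> V (T (Ys[i := X])) p
        + dir_deriv \<A> V f p * T (Ys[i := X]) p + dir_deriv \<A> V (T (Ys[i := Y])) p" .
    define R where "R Z j = T (Ys[i := Z, j := D V (Ys[i := Z] ! j)]) p" for Z j
    \<comment> \<open>\<open>R Z j\<close> is the correction term for slot \<open>j\<close> when
      \<open>Z\<close> stands in slot \<open>i\<close>. Only \<open>j = i\<close> yields a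
      derivative of \<open>f\<close>, and it cancels the one from the product rule in
      \<open>d\<close>.\<close>
    have "R ?W j = f p * R X j + R Y j + (if j = i then dir_deriv \<A> V f p * T (Ys[i := X]) p else 0)"
      if j: "j < n" for j
    proof (cases "j = i")
      case False
      let ?Zs = "Ys[j := D V (Ys ! j)]"
      have sZ: "\<forall>X\<in>set ?Zs. SV U X" using s sj[OF j] by (intro smooth_list_update D_smooth[OF U]) simp_all
      have "R Z j = T (?Zs[i := Z]) p" for Z
        using False by (simp add: R_def list_update_swap)
      then show ?thesis
        using tensorial_combine[OF T U _ sZ i f X Y p] YV(2) False by simp
    next
      case True
      let ?E = "\<lambda>p. f p *\<^sub>R D V X p + D V Y p"
      have DV: "SV U (D V X)" "SV U (D V Y)" "SV U (D V ?W)" using D_smooth[OF U s(2)] X Y W by blast+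
      have E: "SV U ?E" by (rule smooth_vfield_combine[OF U f DV(1,2)])
      have fV: "smooth_fun \<A> U (dir_deriv \<A> V f)" by (rule smooth_dir_deriv[OF U f s(2)])
      have "T (Ys[i := D V ?W]) p = T (Ys[i := \<lambda>p. dir_deriv \<A> V f p *\<^sub>R X p + ?E p]) p"
      proof (rule tensorial_cong[OF T U _ _ _ _ _ p])
        show "(Ys[i := D V ?W] ! k) q = (Ys[i := \<lambda>p. dir_deriv \<A> V f p *\<^sub>R X p + ?E p] ! k) q"
          if "k < n" "q \<in> U" for k q
          using that i YV(2) D_combine_right[OF U f s(2) X Y that(2)] by (cases "k = i") auto
      qed (use YV smooth_list_update[OF s(1) DV(3)]
            smooth_list_update[OF s(1) smooth_vfield_combine[OF U fV X E]] in simp_all)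
      also have "\<dots> = dir_deriv \<A> V f p * T (Ys[i := X]) p + T (Ys[i := ?E]) p"
        by (rule tensorial_combine[OF T U YV(2) s(1) i fV X E p])
      also have "T (Ys[i := ?E]) p = f p * T (Ys[i := D V X]) p + T (Ys[i := D V Y]) p"
        by (rule tensorial_combine[OF T U YV(2) s(1) i f DV(1,2) p])
      finally show ?thesis using True i YV(2) by (simp add: R_def)
    qed
    then have "(\<Sum>j<n. R ?W j) = f p * (\<Sum>j<n. R X j) + (\<Sum>j<n. R Y j) + dir_deriv \<A> V f p * T (Ys[i := X]) p"
      using i by (simp add: sum.distrib sum_distrib_left)
    then show ?thesis
      unfolding up cov_deriv0_snoc using d YV(2) by (simp add: R_def algebra_simps)
  qed
qed

lemma tensorial_nabla: "tensorial (4 + k) ((cov_deriv0 \<A> D ^^ k) (curv04 \<A> g D))"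
proof (induction k)
  case (Suc k)
  from tensorial_cov_deriv0[OF Suc] show ?case by simp
qed (simp add: tensorial_curv04)

lemma tensorial_zero:
  assumes "tensorial n T" "open U" "length Xs = n" "\<forall>X\<in>set Xs. SV U X" "i < n" "p \<in> U"
  shows "T (Xs[i := \<lambda>p. 0]) p = 0"
  using tensorial_combine[OF assms(1-5) smooth_fun_const[of U 1] smooth_vfield_zero smooth_vfield_zero assms(6)] assms(2)
  by simp

lemma tensorial_sum:
  assumes T: "tensorial n T" and U: "open U" and Xs: "length Xs = n" "\<forall>X\<in>set Xs. SV U X" and i: "i < n" and p: "p \<in> U"
    and F: "finite F" and f: "\<And>b. b \<in> F \<Longrightarrow> smooth_fun \<A> U (f b)" and E: "\<And>b. b \<in> F \<Longrightarrow> SV U (E b)"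
  shows "SV U (\<lambda>p. \<Sum>b\<in>F. f b p *\<^sub>R E b p) \<and>
    T (Xs[i := \<lambda>p. \<Sum>b\<in>F. f b p *\<^sub>R E b p]) p = (\<Sum>b\<in>F. f b p * T (Xs[i := E b]) p)"
  using F f E
proof (induction F rule: finite_induct)
  case empty
  then show ?case using tensorial_zero[OF T U Xs i p] smooth_vfield_zero[OF U] by simp
next
  case (insert b F)
  let ?S = "\<lambda>p. \<Sum>b\<in>F. f b p *\<^sub>R E b p"
  have IH: "SV U ?S" "T (Xs[i := ?S]) p = (\<Sum>b\<in>F. f b p * T (Xs[i := E b]) p)" using insert by simp_all
  have fb: "smooth_fun \<A> U (f b)" "SV U (E b)" using insert.prems by simp_all
  show ?case
    using tensorial_combine[OF T U Xs i fb IH(1) p] smooth_vfield_combine[OF U fb IH(1)] IH(2) insert.hyps by simp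
qed

section \<open>Values of a tensor field at a point\<close>

text \<open>Near \<open>p\<close> a field is the combination of the frame of a chart with smooth
  coefficients. Linearity over functions pulls these out, and at \<open>p\<close> they are the
  coordinates of the vector there.\<close>

lemma tensorial_pointwise_slot:
  assumes T: "tensorial n T" and U: "open U" and Xs: "length Xs = n" "\<forall>X\<in>set Xs. SV U X" and i: "i < n" and p: "p \<in> U"
    and XY: "SV U X" "SV U Y" "X p = Y p"
  shows "T (Xs[i := X]) p = T (Xs[i := Y]) p"
proof -
  let ?c = "chart_at \<A> p"
  define W where "W = U \<inter> fst ?c"
  have W: "open W" "p \<in> W" "W \<subseteq> fst ?c" "W \<subseteq> U" using p chart_at(2) open_Int[OF U open_domain[OF chart_at(1)]] by (auto simp: W_def)
  have XsW: "\<forall>X\<in>set Xs. SV W X" using Xs(2) smooth_vfield_subset W(4) by blast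
  have "T (Xs[i := X]) p = (\<Sum>b\<in>Basis. (chart_coord \<A> ?c p (X p) \<bullet> b) * T (Xs[i := \<lambda>q. frame ?c q b]) p)"
    if "SV U X" for X
  proof -
    let ?f = "\<lambda>b q. chart_coord \<A> ?c q (X q) \<bullet> b" and ?E = "\<lambda>b q. frame ?c q b"
    have XW: "SV W X" using smooth_vfield_subset[OF that W(4)] .
    have *: "SV W (\<lambda>q. \<Sum>b\<in>Basis. ?f b q *\<^sub>R ?E b q) \<and>
      T (Xs[i := \<lambda>q. \<Sum>b\<in>Basis. ?f b q *\<^sub>R ?E b q]) p = (\<Sum>b\<in>Basis. ?f b p * T (Xs[i := ?E b]) p)"
      by (rule tensorial_sum[OF T W(1) Xs(1) XsW i W(2) finite_Basis])
        (use smooth_fun_coefficient[OF chart_at(1) W(1,3) XW] smooth_vfield_subset[OF smooth_frame[OF chart_at(1)] W(3)] in auto)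
    have "T (Xs[i := X]) p = T (Xs[i := \<lambda>q. \<Sum>b\<in>Basis. ?f b q *\<^sub>R ?E b q]) p"
    proof (rule tensorial_cong[OF T W(1) _ _ _ _ _ W(2)])
      show "(Xs[i := X] ! k) q = (Xs[i := \<lambda>q. \<Sum>b\<in>Basis. ?f b q *\<^sub>R ?E b q] ! k) q" if "k < n" "q \<in> W" for k q
        using that i Xs(1) frame_expansion[OF chart_at(1), of q p "X q"] W(3) by (cases "k = i") auto
    qed (use Xs(1) smooth_list_update[OF XsW XW] smooth_list_update[OF XsW conjunct1[OF *]] in simp_all)
    with * show ?thesis by simp
  qed
  then show ?thesis using XY by simp
qed

text \<open>The arguments are exchanged one at a time, from the left, by the statement for a single
  slot.\<close>

lemma tensorial_pointwise:
  assumes T: "tensorial n T" and U: "open U" "p \<in> U"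
    and Xs: "length Xs = n" "\<forall>X\<in>set Xs. SV U X" and Ys: "length Ys = n" "\<forall>X\<in>set Ys. SV U X"
    and eq: "\<And>i. i < n \<Longrightarrow> (Xs ! i) p = (Ys ! i) p"
  shows "T Xs p = T Ys p"
proof -
  have "T (take k Ys @ drop k Xs) p = T Xs p" if "k \<le> n" for k
    using that
  proof (induction k)
    case (Suc k)
    let ?Z = "take k Ys @ drop k Xs"
    have k: "k < n" using Suc.prems by simp
    have Z: "length ?Z = n" "\<forall>X\<in>set ?Z. SV U X"
      using Xs Ys k by (auto dest: in_set_takeD in_set_dropD)
    have dk: "drop k Xs = Xs ! k # drop (Suc k) Xs" using Cons_nth_drop_Suc[of k Xs] k Xs(1) by simp
    have tk: "take (Suc k) Ys = take k Ys @ [Ys ! k]" using take_Suc_conv_app_nth[of k Ys] k Ys(1) by simp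
    have l: "length (take k Ys) = k" using k Ys(1) by simp
    have "take (Suc k) Ys @ drop (Suc k) Xs = ?Z[k := Ys ! k]"
      unfolding dk tk using l by (simp add: list_update_append)
    moreover have "?Z = ?Z[k := Xs ! k]"
      unfolding dk using l by (simp add: list_update_append)
    moreover have "T (?Z[k := Ys ! k]) p = T (?Z[k := Xs ! k]) p"
      by (rule tensorial_pointwise_slot[OF T U(1) Z k U(2)]) (use Xs Ys k eq[OF k] in simp_all)
    ultimately show ?case using Suc by simp
  qed simp
  from this[of n] show ?thesis using Xs(1) Ys(1) by simp
qed

lemma extend_vector:
  "extend_vector \<A> P x P = x" "\<exists>U. open U \<and> P \<in> U \<and> SV U (extend_vector \<A> P x)"
proof -
  let ?c = "chart_at \<A> P"
  have "frame ?c P x = x" by (simp add: frame_def jac_self chart_at)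
  then have "\<exists>X. X P = x \<and> (\<exists>U. open U \<and> P \<in> U \<and> SV U X)"
    using smooth_frame[OF chart_at(1)] open_domain[OF chart_at(1)] chart_at(2)
    by (intro exI[of _ "\<lambda>Q. frame ?c Q x"] exI[of _ "fst ?c"] conjI) simp_all
  from someI_ex[OF this] show "extend_vector \<A> P x P = x" "\<exists>U. open U \<and> P \<in> U \<and> SV U (extend_vector \<A> P x)"
    by (simp_all add: extend_vector_def)
qed

lemma common_domain:
  assumes "\<forall>X\<in>set Xs. \<exists>U. open U \<and> P \<in> U \<and> SV U X"
  shows "\<exists>U. open U \<and> P \<in> U \<and> (\<forall>X\<in>set Xs. SV U X)"
  using assms
proof (induction Xs)
  case Nil
  show ?case by (intro exI[of _ UNIV]) simp
next
  case (Cons X Xs)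
  then obtain U V where UV: "open U" "P \<in> U" "\<forall>X\<in>set Xs. SV U X" "open V" "P \<in> V" "SV V X" by auto
  then have "open (U \<inter> V)" "P \<in> U \<inter> V" by auto
  moreover have "\<forall>Y\<in>set (X # Xs). SV (U \<inter> V) Y"
    using UV smooth_vfield_subset[of U _ "U \<inter> V"] smooth_vfield_subset[of V X "U \<inter> V"] by auto
  ultimately show ?case by blast
qed

lemma common_domain_extend:
  obtains U where "open U" "P \<in> U" "\<forall>X\<in>set (map (extend_vector \<A> P) xs). SV U X"
  using common_domain[of "map (extend_vector \<A> P) xs" P] extend_vector(2) by auto

text \<open>The definition evaluates on arbitrarily chosen extensions; pointwise dependence allows
  any smooth fields with the same values at \<open>P\<close>, in particular frames, in which
  smoothness in \<open>P\<close> becomes visible.\<close>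

lemma nabla_curv04_field:
  assumes U: "open U" "P \<in> U" and Xs: "length Xs = 4 + k" "\<forall>X\<in>set Xs. SV U X"
  shows "(cov_deriv0 \<A> D ^^ k) (curv04 \<A> g D) Xs P = nabla_curv04 \<A> g D k P (map (\<lambda>X. X P) Xs)"
proof -
  let ?Ys = "map (extend_vector \<A> P) (map (\<lambda>X. X P) Xs)"
  obtain V where V: "open V" "P \<in> V" "\<forall>X\<in>set ?Ys. SV V X" by (rule common_domain_extend)
  have "(cov_deriv0 \<A> D ^^ k) (curv04 \<A> g D) Xs P = (cov_deriv0 \<A> D ^^ k) (curv04 \<A> g D) ?Ys P"
  proof (rule tensorial_pointwise[OF tensorial_nabla, of "U \<inter> V"])
    show "\<forall>X\<in>set Xs. SV (U \<inter> V) X" "\<forall>X\<in>set ?Ys. SV (U \<inter> V) X"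
      using Xs(2) V(3) smooth_vfield_subset by (blast intro: smooth_vfield_subset)+
  qed (use U V Xs extend_vector in auto)
  then show ?thesis by (simp add: nabla_curv04_def)
qed

lemma multilinear_nabla_curv04: "multilinear (4 + k) (nabla_curv04 \<A> g D k P)"
  unfolding multilinear_def
proof (intro allI impI)
  fix xs :: "'e list" and i assume xs: "length xs = 4 + k \<and> i < 4 + k"
  let ?T = "(cov_deriv0 \<A> D ^^ k) (curv04 \<A> g D)" and ?ext = "extend_vector \<A> P"
  have combine: "nabla_curv04 \<A> g D k P (xs[i := c *\<^sub>R x + y])
      = c * nabla_curv04 \<A> g D k P (xs[i := x]) + nabla_curv04 \<A> g D k P (xs[i := y])" for c x y
  proof -
    obtain U where U: "open U" "P \<in> U" "\<forall>X\<in>set (map ?ext (x # y # xs)). SV U X"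
      by (rule common_domain_extend)
    then have s: "\<forall>X\<in>set (map ?ext xs). SV U X" "SV U (?ext x)" "SV U (?ext y)" by auto
    have v: "?T ((map ?ext xs)[i := Z]) P = nabla_curv04 \<A> g D k P (xs[i := Z P])" if "SV U Z" for Z
    proof -
      have "map (\<lambda>X. X P) ((map ?ext xs)[i := Z]) = xs[i := Z P]"
        by (simp add: map_update o_def extend_vector(1))
      then show ?thesis
        using nabla_curv04_field[OF U(1,2), of "(map ?ext xs)[i := Z]" k] smooth_list_update[OF s(1) that] xs by simp
    qed
    have "?T ((map ?ext xs)[i := \<lambda>p. c *\<^sub>R ?ext x p + ?ext y p]) P
        = c * ?T ((map ?ext xs)[i := ?ext x]) P + ?T ((map ?ext xs)[i := ?ext y]) P"
      by (rule tensorial_combine[OF tensorial_nabla U(1) _ s(1) _ smooth_fun_const s(2,3) U(2)]) (use xs in simp_all)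
    then show ?thesis
      using v[OF smooth_vfield_combine[OF U(1) smooth_fun_const s(2,3)], of c] v[OF s(2)] v[OF s(3)]
      by (simp add: extend_vector(1))
  qed
  have z: "nabla_curv04 \<A> g D k P (xs[i := 0]) = 0" using combine[of 1 0 0] by simp
  show "linear (\<lambda>x. nabla_curv04 \<A> g D k P (xs[i := x]))"
    using combine[of 1] combine[of _ _ 0] z by (intro linearI) simp_all
qed

lemma smooth_nabla_frame:
  assumes c: "c \<in> \<A>" and bs: "length bs = 4 + k"
  shows "smooth_fun \<A> (fst c) (\<lambda>P. nabla_curv04 \<A> g D k P (map (frame c P) bs))"
proof -
  let ?Xs = "map (\<lambda>b P. frame c P b) bs"
  have s: "\<forall>X\<in>set ?Xs. SV (fst c) X" using smooth_frame[OF c] by auto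
  show ?thesis
    by (rule smooth_fun_cong[OF open_domain[OF c] _ tensorial_smooth[OF tensorial_nabla open_domain[OF c] _ s]])
      (use nabla_curv04_field[OF open_domain[OF c] _ _ s] bs in \<open>simp_all add: o_def\<close>)
qed

section \<open>Lowering an index commutes with covariant differentiation\<close>

text \<open>Inserting \<open>W\<close> in the fourth slot turns arguments of \<open>\<nabla>\<^sup>k\<R>\<close> into arguments of \<open>\<nabla>\<^sup>kR\<close>.\<close>

definition insert4 :: "'v \<Rightarrow> 'v list \<Rightarrow> 'v list" where
  "insert4 w xs = take 3 xs @ w # drop 3 xs"

lemma length_insert4: "length xs \<ge> 3 \<Longrightarrow> length (insert4 w xs) = Suc (length xs)"
  by (simp add: insert4_def)

lemma map_insert4: "map f (insert4 w xs) = insert4 (f w) (map f xs)"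
  by (simp add: insert4_def take_map drop_map)

lemma insert4_snoc: "length Ys \<ge> 3 \<Longrightarrow> insert4 W (Ys @ [V]) = insert4 W Ys @ [V]"
  by (simp add: insert4_def)

lemma sum_insert4:
  assumes "length Ys \<ge> 3"
  shows "(\<Sum>i<length (insert4 W Ys). F ((insert4 W Ys)[i := h (insert4 W Ys ! i)]))
    = (\<Sum>i<length Ys. F (insert4 W (Ys[i := h (Ys ! i)]))) + F (insert4 (h W) Ys)"
proof -
  let ?Zs = "insert4 W Ys" and ?n = "length Ys"
  \<comment> \<open>The renumbering of slots caused by the insertion: index 3 is omitted, since it
    belongs to \<open>W\<close> and yields the separate summand.\<close>
  let ?\<sigma> = "\<lambda>i. if i < 3 then i else Suc i"
  have len: "length ?Zs = Suc ?n" using assms by (simp add: insert4_def)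
  have l3: "length (take 3 Ys) = 3" using assms by simp
  have split: "{..<Suc ?n} = insert 3 (?\<sigma> ` {..<?n})"
  proof -
    have "x \<in> insert 3 (?\<sigma> ` {..<?n})" if "x < Suc ?n" for x
    proof (cases "x < 3 \<or> x = 3")
      case True
      then show ?thesis using that assms by (auto intro!: image_eqI[of x ?\<sigma> x])
    next
      case False
      then show ?thesis using that by (intro insertI2 image_eqI[of x ?\<sigma> "x - 1"]) auto
    qed
    then show ?thesis using assms by auto
  qed
  have slot: "?Zs[?\<sigma> i := h (?Zs ! ?\<sigma> i)] = insert4 W (Ys[i := h (Ys ! i)])" if "i < ?n" for i
  proof (cases "i < 3")
    case True
    then show ?thesis using l3
      by (simp add: insert4_def nth_append list_update_append take_update_swap[symmetric] drop_update_swap)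
  next
    case False
    then obtain j where j: "i = 3 + j" using le_Suc_ex not_less by blast
    have "Suc i - 3 = Suc j" using j by simp
    then show ?thesis using l3 that j
      by (simp add: insert4_def nth_append list_update_append drop_update_swap)
  qed
  have "(\<Sum>i<Suc ?n. F (?Zs[i := h (?Zs ! i)])) = F (?Zs[3 := h (?Zs ! 3)]) + (\<Sum>i\<in>?\<sigma> ` {..<?n}. F (?Zs[i := h (?Zs ! i)]))"
    unfolding split by (subst sum.insert) auto
  also have "?Zs[3 := h (?Zs ! 3)] = insert4 (h W) Ys"
    using l3 by (simp add: insert4_def nth_append list_update_append)
  also have "(\<Sum>i\<in>?\<sigma> ` {..<?n}. F (?Zs[i := h (?Zs ! i)])) = (\<Sum>i<?n. F (insert4 W (Ys[i := h (Ys ! i)])))"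
    by (subst sum.reindex) (auto simp: inj_on_def slot o_def split: if_splits intro!: sum.cong)
  finally show ?thesis unfolding len by (simp only: add.commute)
qed

text \<open>The metric is parallel, so pairing with \<open>W\<close> commutes with covariant
  differentiation. New directions are appended at the end, so \<open>W\<close> keeps its place in
  the fourth slot. Smoothness is carried along in the induction because \<open>D\<close> is
  controlled on smooth fields only.\<close>

lemma nabla_metric:
  assumes U: "open U" and Xs: "length Xs = 3 + k" "\<forall>X\<in>set Xs. SV U X"
  shows "SV U ((cov_deriv1 D ^^ k) (curv13 \<A> D) Xs) \<and>
    (\<forall>W. SV U W \<longrightarrow> (\<forall>P\<in>U. g P ((cov_deriv1 D ^^ k) (curv13 \<A> D) Xs P) (W P)
      = (cov_deriv0 \<A> D ^^ k) (curv04 \<A> g D) (insert4 W Xs) P))"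
  using Xs
proof (induction k arbitrary: Xs)
  case 0
  have "SV U (Xs ! i)" if "i < 3" for i using 0 that by simp
  then have "SV U (curv13 \<A> D Xs)" unfolding curv13_def by (intro smooth_curvature U) simp_all
  moreover have "take 3 Xs = Xs" "length Xs = 3" using 0 by simp_all
  then have "insert4 W Xs ! 3 = W" "insert4 W Xs ! 0 = Xs ! 0" "insert4 W Xs ! Suc 0 = Xs ! Suc 0"
    "insert4 W Xs ! 2 = Xs ! 2" for W
    by (simp_all add: insert4_def nth_append)
  ultimately show ?case by (simp add: curv13_def curv04_def)
next
  case (Suc k)
  let ?S = "(cov_deriv1 D ^^ k) (curv13 \<A> D)" and ?T = "(cov_deriv0 \<A> D ^^ k) (curv04 \<A> g D)"
  obtain Ys V where YV: "Xs = Ys @ [V]" "length Ys = 3 + k" using Suc.prems(1) by (metis add_Suc_right length_Suc_conv_rev)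
  have s: "\<forall>X\<in>set Ys. SV U X" "SV U V" using Suc.prems(2) YV by auto
  note IH = Suc.IH[OF YV(2) s(1)]
  have si: "length (Ys[i := D V (Ys ! i)]) = 3 + k \<and> (\<forall>X\<in>set (Ys[i := D V (Ys ! i)]). SV U X)" if "i < length Ys" for i
  proof -
    have "SV U (D V (Ys ! i))" by (rule D_smooth[OF U s(2)]) (use s(1) that in simp)
    from smooth_list_update[OF s(1) this] show ?thesis using YV(2) by simp
  qed
  note IHi = Suc.IH[OF conjunct1[OF si] conjunct2[OF si]]
  have eq: "(cov_deriv1 D ^^ Suc k) (curv13 \<A> D) Xs = (\<lambda>P. D V (?S Ys) P - (\<Sum>i<length Ys. ?S (Ys[i := D V (Ys ! i)]) P))"
    using YV by (simp add: cov_deriv1_snoc fun_eq_iff)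
  have sumS: "SV U (\<lambda>P. \<Sum>i\<in>F. ?S (Ys[i := D V (Ys ! i)]) P)" if "finite F" "F \<subseteq> {..<length Ys}" for F
    using that
  proof (induction F rule: finite_induct)
    case empty
    then show ?case using smooth_vfield_zero[OF U] by simp
  next
    case (insert i F)
    then show ?case using smooth_vfield_add[OF U, of "?S (Ys[i := D V (Ys ! i)])"] IHi[of i] by simp
  qed
  have "SV U ((cov_deriv1 D ^^ Suc k) (curv13 \<A> D) Xs)"
    unfolding eq using IH by (intro smooth_vfield_diff[OF U] D_smooth[OF U] s sumS) auto
  moreover have "g P ((cov_deriv1 D ^^ Suc k) (curv13 \<A> D) Xs P) (W P)
      = (cov_deriv0 \<A> D ^^ Suc k) (curv04 \<A> g D) (insert4 W Xs) P" if W: "SV U W" and P: "P \<in> U" for W P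
  proof -
    have DW: "SV U (D V W)" by (rule D_smooth[OF U s(2) W])
    have SY: "SV U (?S Ys)" using IH by blast
    have "g P ((cov_deriv1 D ^^ Suc k) (curv13 \<A> D) Xs P) (W P)
        = g P (D V (?S Ys) P) (W P) - (\<Sum>i<length Ys. g P (?S (Ys[i := D V (Ys ! i)]) P) (W P))"
      unfolding eq by (simp add: linear_diff[OF linear_g(2)] linear_sum[OF linear_g(2)])
    also have "(\<Sum>i<length Ys. g P (?S (Ys[i := D V (Ys ! i)]) P) (W P))
        = (\<Sum>i<length Ys. ?T (insert4 W (Ys[i := D V (Ys ! i)])) P)"
      by (rule sum.cong[OF refl]) (use IHi W P in simp)
    \<comment> \<open>Compatibility with the metric produces the derivative of \<open>W\<close>,
      which is exactly the correction term of the fourth slot in the covariant derivative of the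
      lowered tensor.\<close>
    also have "g P (D V (?S Ys) P) (W P) = dir_deriv \<A> V (\<lambda>p. g p (?S Ys p) (W p)) P - ?T (insert4 (D V W) Ys) P"
      using compatible[OF U s(2) SY W P] IH DW P by simp
    also have "dir_deriv \<A> V (\<lambda>p. g p (?S Ys p) (W p)) P = dir_deriv \<A> V (?T (insert4 W Ys)) P"
      by (rule dir_deriv_cong[OF U P smooth_g[OF U SY W]]) (use IH W in simp_all)
    also have "dir_deriv \<A> V (?T (insert4 W Ys)) P - ?T (insert4 (D V W) Ys) P
          - (\<Sum>i<length Ys. ?T (insert4 W (Ys[i := D V (Ys ! i)])) P)
        = (cov_deriv0 \<A> D ^^ Suc k) (curv04 \<A> g D) (insert4 W Xs) P"
      using sum_insert4[of Ys "\<lambda>Zs. ?T Zs P" W "D V"] YV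
      by (simp add: insert4_snoc cov_deriv0_snoc)
    finally show ?thesis .
  qed
  ultimately show ?case by blast
qed

lemma nabla_curv13_curv04:
  assumes "length xs = 3 + k"
  shows "g P (nabla_curv13 \<A> D k P xs) w = nabla_curv04 \<A> g D k P (insert4 w xs)"
proof -
  let ?ext = "extend_vector \<A> P"
  obtain U where U: "open U" "P \<in> U" "\<forall>X\<in>set (map ?ext (w # xs)). SV U X"
    by (rule common_domain_extend)
  then have w: "SV U (?ext w)" and "\<forall>X\<in>set (map ?ext xs). SV U X" by auto
  from nabla_metric[OF U(1) _ this(2), of k] assms
  have "\<forall>W. SV U W \<longrightarrow> (\<forall>P\<in>U. g P ((cov_deriv1 D ^^ k) (curv13 \<A> D) (map ?ext xs) P) (W P)
      = (cov_deriv0 \<A> D ^^ k) (curv04 \<A> g D) (insert4 W (map ?ext xs)) P)"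
    by simp
  from this[rule_format, OF w U(2)] show ?thesis
    by (simp add: nabla_curv13_def nabla_curv04_def map_insert4 extend_vector(1))
qed

end

section \<open>Scaled isomorphisms of families of multilinear forms\<close>

lemma multilinear_prod:
  assumes "\<And>i. i < n \<Longrightarrow> linear (f i)"
  shows "multilinear n (\<lambda>xs. \<Prod>i<n. f i (xs ! i))"
  unfolding multilinear_def
proof (intro allI impI)
  fix xs :: "'a list" and k assume k: "length xs = n \<and> k < n"
  have "(\<Prod>i<n. f i (xs[k := x] ! i)) = f k x * (\<Prod>i\<in>{..<n} - {k}. f i (xs ! i))" for x
    using k by (subst prod.remove[of _ k]) (auto intro!: prod.cong)
  then show "linear (\<lambda>x. \<Prod>i<n. f i (xs[k := x] ! i))"
    using assms[of k] k by (intro linearI) (simp_all add: linear_add linear_scale distrib_right)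
qed

lemma multilinear_scaleR_all:
  assumes "multilinear n T" "length xs = n"
  shows "T (map (\<lambda>x. s *\<^sub>R x) xs) = s ^ n * T xs"
  using multilinear_map_scaleR[of xs T "\<lambda>_. s"] assms by (simp add: map_replicate_const prod_list_replicate)

text \<open>One factor serves the whole family, whatever the ranks of its members. With the metric
  as a member this is what index lowering makes of a homothety.\<close>

definition scaled_iso :: "nat \<Rightarrow> (nat \<Rightarrow> nat) \<Rightarrow> (nat \<Rightarrow> 'v::real_vector list \<Rightarrow> real) \<Rightarrow>
    (nat \<Rightarrow> 'w::real_vector list \<Rightarrow> real) \<Rightarrow> real \<Rightarrow> bool" where
  "scaled_iso J m T U a \<longleftrightarrow> a > 0 \<and> (\<exists>F. linear F \<and> bij F \<and>
    (\<forall>j<J. \<forall>xs. length xs = m j \<longrightarrow> U j (map F xs) = a * T j xs))"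

lemma scaled_iso_trans:
  assumes "scaled_iso J m T U a" "scaled_iso J m U W b"
  shows "scaled_iso J m T W (b * a)"
proof -
  obtain F where F: "a > 0" "linear F" "bij F" "\<forall>j<J. \<forall>xs. length xs = m j \<longrightarrow> U j (map F xs) = a * T j xs"
    using assms(1) unfolding scaled_iso_def by blast
  obtain G where G: "b > 0" "linear G" "bij G" "\<forall>j<J. \<forall>xs. length xs = m j \<longrightarrow> W j (map G xs) = b * U j xs"
    using assms(2) unfolding scaled_iso_def by blast
  have "W j (map (G \<circ> F) xs) = b * a * T j xs" if "j < J" "length xs = m j" for j xs
    using F(4)[rule_format, OF that] G(4)[rule_format, of j "map F xs"] that by simp
  then show ?thesis
    unfolding scaled_iso_def using F G linear_compose[OF F(2) G(2)] bij_comp[OF F(3) G(3)]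
    by (intro conjI exI[of _ "G \<circ> F"]) auto
qed

lemma scaled_iso_sym:
  assumes "scaled_iso J m T U a"
  shows "scaled_iso J m U T (1 / a)"
proof -
  obtain F where F: "a > 0" "linear F" "bij F" "\<forall>j<J. \<forall>xs. length xs = m j \<longrightarrow> U j (map F xs) = a * T j xs"
    using assms(1) unfolding scaled_iso_def by blast
  have "F \<circ> inv F = id" using F(3) by (simp add: bij_is_surj surj_iff[symmetric])
  then have "T j (map (inv F) xs) = 1 / a * U j xs" if "j < J" "length xs = m j" for j xs
    using F(4)[rule_format, of j "map (inv F) xs"] F(1) that by (simp add: field_simps)
  then show ?thesis
    unfolding scaled_iso_def using F linear_inv[OF F(2,3)] bij_imp_bij_inv[OF F(3)]
    by (intro conjI exI[of _ "inv F"]) auto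
qed

text \<open>A bijection with factor \<open>a\<close> scales all forms of the family alike, so its
  flow at time \<open>t\<close> scales all of them by \<open>a powr t\<close>, and every positive
  number is of this form when \<open>a\<close> differs from 1.\<close>

lemma scaled_iso_flow:
  fixes T :: "nat \<Rightarrow> 'e::euclidean_space list \<Rightarrow> real"
  assumes T: "\<And>j. j < J \<Longrightarrow> multilinear (m j) (T j)" and a: "scaled_iso J m T T a" "a \<noteq> 1" and b: "b > 0"
  shows "scaled_iso J m T T b"
proof -
  obtain F where F: "a > 0" "linear F" "bij F" "\<forall>j<J. \<forall>xs. length xs = m j \<longrightarrow> T j (map F xs) = a * T j xs"
    using a(1) unfolding scaled_iso_def by blast
  obtain f where f: "\<forall>t. linear (f t) \<and> bij (f t)" and fT: "\<forall>n T \<tau> t xs. multilinear n T \<longrightarrow> \<tau> > 0 \<longrightarrow>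
    (\<forall>ys. length ys = n \<longrightarrow> T (map F ys) = \<tau> * T ys) \<longrightarrow> length xs = n \<longrightarrow> T (map (f t) xs) = \<tau> powr t * T xs"
    using ex_positive_part_flow[OF F(2,3)] by (elim exE conjE)
  define t where "t = ln b / ln a"
  have "a powr t = b" using F(1) a(2) b by (simp add: t_def powr_def)
  then have "T j (map (f t) xs) = b * T j xs" if "j < J" "length xs = m j" for j xs
    using fT[rule_format, of "m j" "T j" a xs t] T F(1,4) that by simp
  then show ?thesis unfolding scaled_iso_def using f b by blast
qed

section \<open>The algebra of scaled maps and its representation on forms\<close>

text \<open>A finite type with one element for each basis vector. It makes endomorphisms of an
  arbitrary Euclidean space a vector type which is again Euclidean, as the locale
  \<open>smooth_representation\<close> demands.\<close>

typedef (overloaded) 'e basis_index = "Basis :: 'e::euclidean_space set"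
  by (metis nonempty_Basis ex_in_conv)

lemma bij_Rep_basis_index: "bij_betw Rep_basis_index UNIV Basis"
  using type_definition.Rep_range[OF type_definition_basis_index] Rep_basis_index_inject
  by (auto simp: bij_betw_def inj_on_def)

instance basis_index :: (euclidean_space) finite
proof
  show "finite (UNIV :: 'a basis_index set)"
    using bij_betw_finite[OF bij_Rep_basis_index] by simp
qed

text \<open>A pair \<open>(M, a)\<close> stands for the linear map \<open>lmap M\<close> and the factor \<open>a\<close>, acting on a form by
  precomposition with the map and multiplication by the factor; hence the reversed product.\<close>

type_synonym 'e scaled_map = "('e ^ 'e basis_index) \<times> real"

definition lmap :: "'e::euclidean_space ^ 'e basis_index \<Rightarrow> 'e \<Rightarrow> 'e" where
  "lmap M x = (\<Sum>i\<in>UNIV. (x \<bullet> Rep_basis_index i) *\<^sub>R M $ i)"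

definition smul :: "'e::euclidean_space scaled_map \<Rightarrow> 'e scaled_map \<Rightarrow> 'e scaled_map" where
  "smul A B = (\<chi> i. lmap (fst B) (fst A $ i), snd A * snd B)"

definition sone :: "'e::euclidean_space scaled_map" where
  "sone = (\<chi> i. Rep_basis_index i, 1)"

definition form_index :: "nat \<Rightarrow> (nat \<Rightarrow> nat) \<Rightarrow> (nat \<times> 'e::euclidean_space list) set" where
  "form_index J m = (SIGMA j:{..<J}. basis_lists (m j))"

text \<open>The matrix entries of the action on coordinates of forms with respect to basis lists:
  \<open>snd A\<close> times the form evaluated at the images of a basis list is expanded in basis
  lists. Forms with different numbers do not mix.\<close>

definition form_rep :: "(nat \<Rightarrow> nat) \<Rightarrow> nat \<times> 'e list \<Rightarrow> nat \<times> 'e list \<Rightarrow> 'e::euclidean_space scaled_map \<Rightarrow> real" where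
  "form_rep m x y A = (if fst x = fst y
    then snd A * (\<Prod>i<m (fst x). lmap (fst A) (snd x ! i) \<bullet> snd y ! i) else 0)"

lemma linear_lmap: "linear (lmap M)"
  unfolding lmap_def
  by (intro linearI) (simp_all add: inner_add_left scaleR_left_distrib sum.distrib scaleR_sum_right)

lemma linear_lmap_left: "linear (\<lambda>M. lmap M x)"
  unfolding lmap_def
  by (intro linearI) (simp_all add: scaleR_right_distrib sum.distrib scaleR_sum_right mult.commute)

lemma lmap_of_linear:
  assumes "linear f"
  shows "lmap (\<chi> i. f (Rep_basis_index i)) = f"
proof
  fix x
  have "lmap (\<chi> i. f (Rep_basis_index i)) x = (\<Sum>b\<in>Basis. (x \<bullet> b) *\<^sub>R f b)"
    unfolding lmap_def using sum.reindex_bij_betw[OF bij_Rep_basis_index, of "\<lambda>b. (x \<bullet> b) *\<^sub>R f b"] by simp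
  then show "lmap (\<chi> i. f (Rep_basis_index i)) x = f x"
    using linear_euclidean_expansion[OF assms, of x] by simp
qed

lemma lmap_smul: "lmap (fst (smul A B)) x = lmap (fst B) (lmap (fst A) x)"
proof -
  have "lmap (fst B) (lmap (fst A) x) = (\<Sum>i\<in>UNIV. (x \<bullet> Rep_basis_index i) *\<^sub>R lmap (fst B) (fst A $ i))"
    by (simp add: lmap_def[of "fst A"] linear_sum[OF linear_lmap] linear_scale[OF linear_lmap])
  then show ?thesis by (simp add: smul_def lmap_def[of "\<chi> i. _ i"])
qed

lemma lmap_sone: "lmap (fst sone) x = x"
  by (simp add: sone_def lmap_of_linear[OF linear_ident])

lemma lmap_eqI:
  fixes M N :: "'e::euclidean_space ^ 'e basis_index"
  assumes "\<And>x. lmap M x = lmap N x"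
  shows "M = N"
proof -
  have "lmap M (Rep_basis_index k) = M $ k" for k and M :: "'e ^ 'e basis_index"
  proof -
    have "(Rep_basis_index k \<bullet> Rep_basis_index i) *\<^sub>R M $ i = (if i = k then M $ k else 0)" for i
      using Rep_basis_index[of k] Rep_basis_index[of i] Rep_basis_index_inject[of k i] by (auto simp: inner_Basis)
    then show ?thesis by (simp add: lmap_def)
  qed
  then show ?thesis using assms by (metis vec_eq_iff)
qed

lemma bounded_bilinear_smul: "bounded_bilinear (smul :: 'e::euclidean_space scaled_map \<Rightarrow> _)"
proof -
  have "linear (\<lambda>B. smul A B)" for A :: "'e scaled_map"
    unfolding smul_def
    by (intro linearI) (simp_all add: vec_eq_iff linear_add[OF linear_lmap_left] linear_scale[OF linear_lmap_left] distrib_left)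
  moreover have "linear (\<lambda>A. smul A B)" for B :: "'e scaled_map"
    unfolding smul_def
    by (intro linearI) (simp_all add: vec_eq_iff linear_add[OF linear_lmap] linear_scale[OF linear_lmap] distrib_right)
  ultimately show ?thesis
    by (simp add: bilinear_conv_bounded_bilinear[symmetric] bilinear_def)
qed

lemma finite_form_index: "finite (form_index J m)"
  unfolding form_index_def by (intro finite_SigmaI finite_basis_lists) simp

lemma Cinf_on_form_rep: "Cinf_on UNIV (form_rep m x y)" for x y :: "nat \<times> 'e::euclidean_space list"
proof -
  have "Cinf_on UNIV (\<lambda>A::'e scaled_map. lmap (fst A) b \<bullet> c)" for b c :: 'e
  proof -
    have "linear (\<lambda>A::'e scaled_map. lmap (fst A) b)"
      using linear_compose[OF linear_fst linear_lmap_left] by (simp add: o_def)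
    then have "bounded_linear (\<lambda>A::'e scaled_map. lmap (fst A) b)"
      by (rule linear_conv_bounded_linear[THEN iffD1])
    then show ?thesis
      by (intro Cinf_on_inner_const Cinf_on_bounded_linear open_UNIV)
  qed
  moreover have "Cinf_on UNIV (snd :: 'e scaled_map \<Rightarrow> real)"
    by (intro Cinf_on_bounded_linear bounded_linear_snd open_UNIV)
  ultimately show ?thesis
    unfolding form_rep_def[abs_def]
    by (cases "fst x = fst y") (auto intro!: Cinf_on_mult Cinf_on_prod)
qed

lemma sum_form_rep:
  assumes "fst x < J"
  shows "(\<Sum>y\<in>form_index J m. form_rep m x y A * f y)
    = (\<Sum>bs\<in>basis_lists (m (fst x)). snd A * (\<Prod>i<m (fst x). lmap (fst A) (snd x ! i) \<bullet> bs ! i) * f (fst x, bs))"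
proof -
  have "(\<Sum>y\<in>form_index J m. form_rep m x y A * f y)
      = (\<Sum>j<J. \<Sum>bs\<in>basis_lists (m j). form_rep m x (j, bs) A * f (j, bs))"
    unfolding form_index_def by (subst sum.Sigma) (auto simp: finite_basis_lists case_prod_unfold)
  also have "\<dots> = (\<Sum>j<J. if j = fst x then \<Sum>bs\<in>basis_lists (m (fst x)). form_rep m x (fst x, bs) A * f (fst x, bs) else 0)"
    by (rule sum.cong[OF refl]) (auto simp: form_rep_def)
  also have "\<dots> = (\<Sum>bs\<in>basis_lists (m (fst x)). form_rep m x (fst x, bs) A * f (fst x, bs))"
    using assms by simp
  finally show ?thesis by (simp add: form_rep_def)
qed

text \<open>Multiplicativity of the entries is the expansion in basis lists of a product of linear
  forms, evaluated at the images under the first map; finiteness of the index set comes from the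
  finite basis.\<close>

interpretation forms: smooth_representation "smul :: 'e::euclidean_space scaled_map \<Rightarrow> _" sone
  "form_index J m" "form_rep m" for J m
proof (rule smooth_representation.intro)
  show "smul (smul a b) c = smul a (smul b c)" for a b c :: "'e scaled_map"
  proof (rule prod_eqI)
    show "fst (smul (smul a b) c) = fst (smul a (smul b c))"
      by (rule lmap_eqI) (simp add: lmap_smul)
  qed (simp add: smul_def)
  show "smul sone a = a" for a :: "'e scaled_map"
  proof (rule prod_eqI)
    show "fst (smul sone a) = fst a" by (rule lmap_eqI) (simp add: lmap_smul lmap_sone)
  qed (simp add: smul_def sone_def)
  show "smul a sone = a" for a :: "'e scaled_map"
  proof (rule prod_eqI)
    show "fst (smul a sone) = fst a" by (rule lmap_eqI) (simp add: lmap_smul lmap_sone)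
  qed (simp add: smul_def sone_def)
  show "form_rep m x z (smul a b) = (\<Sum>y\<in>form_index J m. form_rep m x y a * form_rep m y z b)"
    if "x \<in> form_index J m" "z \<in> form_index J m" for x z :: "nat \<times> 'e list" and a b
  proof -
    obtain j bs l cs where x: "x = (j, bs)" "j < J" "length bs = m j" and z: "z = (l, cs)"
      using \<open>x \<in> form_index J m\<close> by (cases x; cases z) (auto simp: form_index_def)
    show ?thesis
    proof (cases "j = l")
      case True
      have ml: "multilinear (m j) (\<lambda>xs. \<Prod>i<m j. (\<lambda>v. lmap (fst b) v \<bullet> cs ! i) (xs ! i))"
        by (rule multilinear_prod)
          (auto intro!: linearI simp: linear_add[OF linear_lmap] linear_scale[OF linear_lmap] inner_add_left)
      have "form_rep m x z (smul a b) = snd a * snd b * (\<Prod>i<m j. lmap (fst b) (lmap (fst a) (bs ! i)) \<bullet> cs ! i)"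
        unfolding form_rep_def lmap_smul using True x z by (simp add: smul_def)
      also have "(\<Prod>i<m j. lmap (fst b) (lmap (fst a) (bs ! i)) \<bullet> cs ! i) = (\<Sum>ds\<in>basis_lists (m j).
          (\<Prod>i<m j. lmap (fst a) (bs ! i) \<bullet> ds ! i) * (\<Prod>i<m j. lmap (fst b) (ds ! i) \<bullet> cs ! i))"
        using multilinear_expand[OF ml, of "map (lmap (fst a)) bs"] x(3) by simp
      also have "snd a * snd b * \<dots> = (\<Sum>ds\<in>basis_lists (m j).
          snd a * (\<Prod>i<m j. lmap (fst a) (bs ! i) \<bullet> ds ! i) * form_rep m (j, ds) z b)"
        unfolding form_rep_def using True z by (simp add: sum_distrib_left mult_ac)
      also have "\<dots> = (\<Sum>y\<in>form_index J m. form_rep m x y a * form_rep m y z b)"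
        using sum_form_rep[of x J m a "\<lambda>y. form_rep m y z b"] x(1,2) by simp
      finally show ?thesis .
    next
      case False
      then show ?thesis using sum_form_rep[of x J m a "\<lambda>y. form_rep m y z b"] x z by (simp add: form_rep_def)
    qed
  qed
  show "form_rep m x z sone = (if x = z then 1 else 0)"
    if "x \<in> form_index J m" "z \<in> form_index J m" for x z :: "nat \<times> 'e list"
  proof -
    obtain j bs where x1: "x = (j, bs)" by (cases x)
    obtain l cs where z1: "z = (l, cs)" by (cases z)
    have x: "x = (j, bs)" "length bs = m j" "set bs \<subseteq> Basis" and z: "z = (l, cs)" "length cs = m l" "set cs \<subseteq> Basis"
      using that x1 z1 by (auto simp: form_index_def)
    have "(\<Prod>i<m j. bs ! i \<bullet> cs ! i) = (if bs = cs then 1 else 0)" if "j = l"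
    proof (cases "bs = cs")
      case True
      have "bs ! i \<bullet> cs ! i = 1" if "i < m j" for i
        using that x True by (metis inner_Basis nth_mem subsetD)
      then show ?thesis using True by simp
    next
      case False
      then obtain i where i: "i < m j" "bs ! i \<noteq> cs ! i" using x(2) z(2) \<open>j = l\<close> nth_equalityI by metis
      then have "bs ! i \<bullet> cs ! i = 0"
        using x z \<open>j = l\<close> by (metis inner_Basis nth_mem subsetD)
      then have "(\<Prod>i<m j. bs ! i \<bullet> cs ! i) = 0" using i(1) by (intro prod_zero) auto
      then show ?thesis using False by simp
    qed
    then show ?thesis by (auto simp: form_rep_def x z lmap_sone) (simp_all add: sone_def)
  qed
qed (simp_all add: bounded_bilinear_smul finite_form_index Cinf_on_form_rep)

definition form_coords :: "nat \<Rightarrow> (nat \<Rightarrow> nat) \<Rightarrow> (nat \<Rightarrow> 'e::euclidean_space list \<Rightarrow> real) \<Rightarrow> nat \<times> 'e list \<Rightarrow> real" where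
  "form_coords J m T x = (if x \<in> form_index J m then T (fst x) (snd x) else 0)"

lemma act_form_coords:
  assumes "\<And>j. j < J \<Longrightarrow> multilinear (m j) (T j)"
  shows "forms.act J m A (form_coords J m T) = form_coords J m (\<lambda>j xs. snd A * T j (map (lmap (fst A)) xs))"
proof
  fix x :: "nat \<times> 'a list"
  show "forms.act J m A (form_coords J m T) x = form_coords J m (\<lambda>j xs. snd A * T j (map (lmap (fst A)) xs)) x"
  proof (cases "x \<in> form_index J m")
    case True
    then obtain j bs where x: "x = (j, bs)" "j < J" "length bs = m j" by (auto simp: form_index_def)
    have "T j (map (lmap (fst A)) bs) = (\<Sum>cs\<in>basis_lists (m j). (\<Prod>i<m j. lmap (fst A) (bs ! i) \<bullet> cs ! i) * T j cs)"
      using multilinear_expand[OF assms[OF x(2)], of "map (lmap (fst A)) bs"] x(3) by simp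
    moreover have "form_coords J m T (j, cs) = T j cs" if "cs \<in> basis_lists (m j)" for cs
      using that x(2) by (simp add: form_coords_def form_index_def)
    ultimately show ?thesis
      using True sum_form_rep[of x J m A "form_coords J m T"] x
      by (simp add: forms.act_def form_coords_def[of J m "\<lambda>j xs. _ j xs"] sum_distrib_left mult_ac)
  qed (simp add: form_coords_def)
qed

lemma local_smooth_scaling:
  fixes T :: "'p::euclidean_space \<Rightarrow> nat \<Rightarrow> 'e::euclidean_space list \<Rightarrow> real"
  assumes S: "open S" "p0 \<in> S"
    and ml: "\<And>p j. p \<in> S \<Longrightarrow> j < J \<Longrightarrow> multilinear (m j) (T p j)"
    and smooth: "\<And>j bs. j < J \<Longrightarrow> length bs = m j \<Longrightarrow> set bs \<subseteq> Basis \<Longrightarrow> Cinf_on S (\<lambda>p. T p j bs)"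
    and iso: "\<And>p. p \<in> S \<Longrightarrow> \<exists>a. scaled_iso J m (T p) (T p0) a"
  shows "\<exists>S' s. open S' \<and> p0 \<in> S' \<and> S' \<subseteq> S \<and> Cinf_on S' s \<and> (\<forall>p\<in>S'. scaled_iso J m (T p) (T p0) (s p))"
proof -
  let ?t = "\<lambda>p. form_coords J m (T p)"
  have tC: "Cinf_on S (\<lambda>p. ?t p x)" for x
  proof (cases "x \<in> form_index J m")
    case True
    then show ?thesis using smooth[of "fst x" "snd x"] by (auto simp: form_coords_def form_index_def)
  qed (simp add: form_coords_def)
  have act: "forms.act J m A (?t p) = form_coords J m (\<lambda>j xs. snd A * T p j (map (lmap (fst A)) xs))"
    if "p \<in> S" for A p
    by (rule act_form_coords) (rule ml[OF that])
  have orbit: "\<exists>A A'. smul A A' = sone \<and> smul A' A = sone \<and> ?t p = forms.act J m A (?t p0)" if p: "p \<in> S" for p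
  proof -
    obtain a F where F: "a > 0" "linear F" "bij F" "\<forall>j<J. \<forall>xs. length xs = m j \<longrightarrow> T p0 j (map F xs) = a * T p j xs"
      using iso[OF p] unfolding scaled_iso_def by blast
    note lF = lmap_of_linear[OF F(2)] lmap_of_linear[OF linear_inv[OF F(2,3)]]
    \<comment> \<open>The action precomposes and multiplies, so a map \<open>F\<close> to the base
      point with factor \<open>a\<close> acts on the forms at \<open>p0\<close> with scalar
      \<open>1 / a\<close> and returns those at \<open>p\<close>.\<close>
    let ?A = "((\<chi> i. F (Rep_basis_index i)), 1 / a)" and ?A' = "((\<chi> i. inv F (Rep_basis_index i)), a)"
    have "smul ?A ?A' = sone" "smul ?A' ?A = sone"
      by (rule prod_eqI, rule lmap_eqI, simp add: lmap_smul lF lmap_sone F(3) bij_is_inj bij_is_surj surj_f_inv_f,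
          simp add: smul_def sone_def F(1) less_imp_neq[symmetric])+
    moreover have "?t p = forms.act J m ?A (?t p0)"
    proof -
      have "T p j xs = 1 / a * T p0 j (map F xs)" if "j < J" "length xs = m j" for j xs
        using F(1,4) that by simp
      then show ?thesis
        unfolding act[OF S(2)] by (auto simp: form_coords_def form_index_def fun_eq_iff lF)
    qed
    ultimately show ?thesis by blast
  qed
  have "\<exists>S' H. open S' \<and> p0 \<in> S' \<and> S' \<subseteq> S \<and> Cinf_on S' H \<and> (\<forall>p\<in>S'. norm (H p - sone) < 1 \<and>
      (\<exists>B. smul (H p) B = sone \<and> smul B (H p) = sone) \<and> forms.act J m (H p) (?t p) = ?t p0)"
    by (rule forms.local_slice[OF S tC orbit zero_less_one])
  then obtain S' H where S': "open S'" "p0 \<in> S'" "S' \<subseteq> S" "Cinf_on S' H"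
    and H: "\<forall>p\<in>S'. norm (H p - sone) < 1 \<and> (\<exists>B. smul (H p) B = sone \<and> smul B (H p) = sone) \<and>
      forms.act J m (H p) (?t p) = ?t p0"
    by (elim exE conjE) (rule that)
  have "scaled_iso J m (T p) (T p0) (snd (H p))" if p: "p \<in> S'" for p
  proof -
    obtain B where B: "smul (H p) B = sone" "smul B (H p) = sone" using H p by blast
    let ?h = "lmap (fst (H p))" and ?k = "lmap (fst B)" and ?s = "snd (H p)"
    have pS: "p \<in> S" using p S'(3) by blast
    have inv: "?h (?k x) = x" "?k (?h x) = x" for x
      using lmap_smul[of "H p" B x] lmap_smul[of B "H p" x] unfolding B lmap_sone by simp_all
    \<comment> \<open>Here the bound 1 in the use of \<open>local_slice\<close> pays off: the scalar
      part differs from 1 by less than 1 and is positive.\<close>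
    have "norm (snd z) \<le> norm z" for z :: "'e scaled_map" by (metis norm_snd_le prod.collapse)
    from this[of "H p - sone"] have "norm (?s - 1) \<le> norm (H p - sone)" by (simp add: sone_def)
    then have "?s > 0" using H p by fastforce
    \<comment> \<open>The slice gives the forms at \<open>p0\<close> as precompositions of those at
      \<open>p\<close> with \<open>?h\<close>, so the isomorphism from \<open>p\<close> to
      \<open>p0\<close> is the inverse map \<open>?k\<close>.\<close>
    moreover have "T p0 j (map ?k xs) = ?s * T p j xs" if j: "j < J" and xs: "length xs = m j" for j xs
    proof -
      have "?s * T p j (map ?h ys) = T p0 j ys" if "length ys = m j" for ys
      proof (rule multilinear_eq_on_span[of "m j" _ _ Basis])
        show "multilinear (m j) (\<lambda>ys. ?s * T p j (map ?h ys))"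
          by (intro multilinear_scale multilinear_map ml pS j linear_lmap)
        fix bs :: "'e list" assume "length bs = m j" "set bs \<subseteq> Basis"
        then have "(j, bs) \<in> form_index J m" using j by (simp add: form_index_def)
        then show "?s * T p j (map ?h bs) = T p0 j bs"
          using fun_cong[OF conjunct2[OF conjunct2[OF bspec[OF H p]]], of "(j, bs)"]
          unfolding act[OF pS] by (simp add: form_coords_def)
      qed (use ml S(2) j that in auto)
      from this[of "map ?k xs"] show ?thesis using xs by (simp add: o_def inv)
    qed
    moreover have "bij ?k" by (rule o_bij[of ?h]) (auto simp: inv)
    ultimately show ?thesis unfolding scaled_iso_def using linear_lmap by blast
  qed
  moreover have "Cinf_on S' (\<lambda>p. snd (H p))"
    by (rule Cinf_on_bounded_linear_compose[OF bounded_linear_snd S'(1,4)])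
  ultimately show ?thesis using S'(1-3) by blast
qed

section \<open>Curvature homogeneity\<close>

lemma ex_linear_iso:
  assumes "dim (UNIV :: 'v::real_vector set) = DIM('e::euclidean_space)"
  shows "\<exists>L :: 'e::euclidean_space \<Rightarrow> 'v::real_vector. linear L \<and> bij L"
proof -
  obtain B :: "'v set" where B: "independent B" "UNIV \<subseteq> span B" "card B = dim (UNIV :: 'v set)"
    using basis_exists[of "UNIV :: 'v set"] by metis
  then have cB: "card B = card (Basis :: 'e set)" using assms by simp
  \<comment> \<open>An infinite set has cardinality 0, so the positive dimension of the Euclidean
    space makes \<open>B\<close> finite.\<close>
  moreover have "card (Basis :: 'e set) > 0" by simp
  ultimately have fB: "finite B" by (metis card.infinite less_irrefl)
  obtain \<beta> where \<beta>: "bij_betw \<beta> (Basis :: 'e set) B"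
    using finite_same_card_bij[OF finite_Basis fB cB[symmetric]] by blast
  define L where "L x = (\<Sum>b\<in>Basis. (x \<bullet> b) *\<^sub>R \<beta> b)" for x :: 'e
  have lin: "linear L"
    unfolding L_def by (intro linearI) (simp_all add: inner_add_left scaleR_left_distrib sum.distrib scaleR_sum_right)
  have Lb: "L b = \<beta> b" if "b \<in> Basis" for b
  proof -
    have "L b = (\<Sum>c\<in>Basis. if c = b then \<beta> b else 0)"
      unfolding L_def using that by (intro sum.cong) (auto simp: inner_Basis)
    then show ?thesis using that by simp
  qed
  have "x = 0" if "L x = 0" for x
  proof (rule euclidean_eqI)
    fix b :: 'e assume b: "b \<in> Basis"
    let ?inv = "inv_into Basis \<beta>"
    have i: "?inv (\<beta> c) = c" if "c \<in> Basis" for c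
      using that \<beta> by (simp add: bij_betw_def inv_into_f_f)
    have "L x = (\<Sum>c\<in>Basis. (x \<bullet> ?inv (\<beta> c)) *\<^sub>R \<beta> c)"
      unfolding L_def by (rule sum.cong) (simp_all add: i)
    also have "\<dots> = (\<Sum>v\<in>B. (x \<bullet> ?inv v) *\<^sub>R v)"
      by (rule sum.reindex_bij_betw[OF \<beta>])
    finally have "(\<Sum>v\<in>B. (x \<bullet> ?inv v) *\<^sub>R v) = 0" using that by simp
    then have "x \<bullet> ?inv (\<beta> b) = 0"
      using independentD[OF B(1) fB order_refl] \<beta> b by (metis bij_betwE)
    then show "x \<bullet> b = 0 \<bullet> b" using i[OF b] by simp
  qed
  then have "inj L" using linear_injective_0[OF lin] by blast
  moreover have "B \<subseteq> range L"
  proof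
    fix v assume "v \<in> B"
    then obtain b where "b \<in> Basis" "v = \<beta> b" using \<beta> by (auto simp: bij_betw_def)
    then show "v \<in> range L" using Lb by (metis rangeI)
  qed
  then have "span B \<subseteq> range L"
    by (intro span_minimal linear_subspace_image[OF lin subspace_UNIV])
  then have "surj L" using B(2) by auto
  ultimately show ?thesis using lin unfolding bij_def by blast
qed

text \<open>Number 0 is the metric, and number \<open>j > 0\<close> is the covariant derivative of
  order \<open>j - 1\<close> of the curvature, with \<open>4 + (j - 1)\<close> arguments.\<close>

definition curvature_rank :: "nat \<Rightarrow> nat" where
  "curvature_rank j = (if j = 0 then 2 else 3 + j)"

section \<open>Comparison of the metric and curvature tensors at two points\<close>

context levi_civita_manifold
begin

definition tensors :: "'a \<Rightarrow> nat \<Rightarrow> 'e list \<Rightarrow> real" where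
  "tensors P j xs = (if j = 0 then g P (xs ! 0) (xs ! 1) else nabla_curv04 \<A> g D (j - 1) P xs)"

lemma multilinear_tensors: "multilinear (curvature_rank j) (tensors P j)"
proof (cases j)
  case 0
  have "linear (\<lambda>x. g P (xs[i := x] ! 0) (xs[i := x] ! 1))" if "length xs = 2" "i < 2" for xs :: "'e list" and i
  proof -
    have "i = 0 \<or> i = 1" using that by linarith
    then show ?thesis using that linear_g by (elim disjE) simp_all
  qed
  then show ?thesis using 0 by (simp add: multilinear_def curvature_rank_def tensors_def)
next
  case (Suc k)
  then show ?thesis
    using multilinear_nabla_curv04[of k P] by (simp add: curvature_rank_def tensors_def[abs_def])
qed

lemma smooth_tensors_frame:
  assumes c: "c \<in> \<A>" and bs: "length bs = curvature_rank j"
  shows "smooth_fun \<A> (fst c) (\<lambda>P. tensors P j (map (frame c P) bs))"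
proof (cases j)
  case 0
  then have "length bs = 2" using bs by (simp add: curvature_rank_def)
  then show ?thesis
    using 0 smooth_g[OF open_domain[OF c] smooth_frame[OF c] smooth_frame[OF c]] by (simp add: tensors_def)
next
  case (Suc k)
  then show ?thesis
    using smooth_nabla_frame[OF c, of bs k] bs by (simp add: curvature_rank_def tensors_def)
qed

abbreviation scaled_points :: "nat \<Rightarrow> 'a \<Rightarrow> 'a \<Rightarrow> real \<Rightarrow> bool" where
  "scaled_points r P Q \<equiv> scaled_iso (r + 2) curvature_rank (tensors P) (tensors Q)"

lemma scaled_points_iff:
  "scaled_points r P Q a \<longleftrightarrow> a > 0 \<and> (\<exists>F. linear F \<and> bij F \<and> (\<forall>x y. g Q (F x) (F y) = a * g P x y) \<and>
    (\<forall>k\<le>r. \<forall>xs. length xs = 4 + k \<longrightarrow> nabla_curv04 \<A> g D k Q (map F xs) = a * nabla_curv04 \<A> g D k P xs))"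
proof -
  have "(\<forall>j<r + 2. \<forall>xs. length xs = curvature_rank j \<longrightarrow> tensors Q j (map F xs) = a * tensors P j xs) \<longleftrightarrow>
    (\<forall>x y. g Q (F x) (F y) = a * g P x y) \<and>
    (\<forall>k\<le>r. \<forall>xs. length xs = 4 + k \<longrightarrow> nabla_curv04 \<A> g D k Q (map F xs) = a * nabla_curv04 \<A> g D k P xs)" (is "?L \<longleftrightarrow> ?R") for F
  proof
    assume L: ?L
    have "g Q (F x) (F y) = a * g P x y" for x y
      using L[rule_format, of 0 "[x, y]"] by (simp add: curvature_rank_def tensors_def)
    moreover have "nabla_curv04 \<A> g D k Q (map F xs) = a * nabla_curv04 \<A> g D k P xs"
      if "k \<le> r" "length xs = 4 + k" for k xs
      using L[rule_format, of "Suc k" xs] that by (simp add: curvature_rank_def tensors_def)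
    ultimately show ?R by blast
  next
    assume R: ?R
    show ?L
    proof (intro allI impI)
      fix j and xs :: "'e list" assume j: "j < r + 2" and xs: "length xs = curvature_rank j"
      show "tensors Q j (map F xs) = a * tensors P j xs"
      proof (cases j)
        case 0
        then show ?thesis using R xs by (simp add: curvature_rank_def tensors_def)
      next
        case (Suc k)
        then show ?thesis using R xs j by (simp add: curvature_rank_def tensors_def)
      qed
    qed
  qed
  then show ?thesis unfolding scaled_iso_def by simp
qed

text \<open>The homothety preserves the tensors with values in vectors; lowering the index pairs
  these values with the metric, which it multiplies by the square of its dilation. This square is
  the common factor.\<close>

lemma homothety_imp_scaled_points:
  assumes h: "homothety (g P) (g Q) h"
    and eq: "\<And>k xs. k \<le> r \<Longrightarrow> length xs = 3 + k \<Longrightarrow>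
      pullback1 h (nabla_curv13 \<A> D k Q) xs = nabla_curv13 \<A> D k P xs"
  shows "\<exists>a. scaled_points r P Q a"
proof -
  obtain c F where F: "c > 0" "linear F" "bij F" "\<And>x y. g Q (F x) (F y) = g P x y" "h = (\<lambda>x. c *\<^sub>R F x)"
    using h unfolding homothety_def linear_isometry_def by blast
  have lh: "linear h" unfolding F(5) by (rule linear_compose_scale_right[OF F(2)])
  have "bij (\<lambda>x::'e. c *\<^sub>R x)" using F(1) by (intro o_bij[of "\<lambda>x. (1 / c) *\<^sub>R x"]) (auto simp: fun_eq_iff)
  then have bh: "bij h" using bij_comp[OF F(3)] unfolding F(5) by (simp add: o_def)
  have gh: "g Q (h x) (h y) = c\<^sup>2 * g P x y" for x y
    by (simp add: F(4,5) linear_scale[OF linear_g(1)] linear_scale[OF linear_g(2)] power2_eq_square)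
  have "nabla_curv04 \<A> g D k Q (map h xs) = c\<^sup>2 * nabla_curv04 \<A> g D k P xs" if k: "k \<le> r" and xs: "length xs = 4 + k" for k xs
  proof -
    \<comment> \<open>Every list of 4+k arguments arises by inserting its fourth entry into the
      remaining ones, which links the lowered tensor to the one with values in vectors.\<close>
    define w where "w = xs ! 3"
    define ys where "ys = take 3 xs @ drop 4 xs"
    have len: "length ys = 3 + k" using xs by (simp add: ys_def)
    have "xs = take 3 xs @ drop 3 xs" by simp
    also have "drop 3 xs = xs ! 3 # drop 4 xs" using Cons_nth_drop_Suc[of 3 xs] xs by simp
    finally have xs_eq: "xs = insert4 w ys"
      using xs by (simp add: insert4_def w_def ys_def)
    have "inv h (nabla_curv13 \<A> D k Q (map h ys)) = nabla_curv13 \<A> D k P ys"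
      using eq[OF k len] by (simp add: pullback1_def)
    then have "nabla_curv13 \<A> D k Q (map h ys) = h (nabla_curv13 \<A> D k P ys)"
      using bh by (metis bij_inv_eq_iff)
    then show ?thesis
      using nabla_curv13_curv04[of "map h ys" k Q "h w"] nabla_curv13_curv04[OF len, of P w] len
      by (simp add: xs_eq map_insert4 gh)
  qed
  then have "scaled_points r P Q (c\<^sup>2)"
    unfolding scaled_points_iff using F(1) lh bh gh by auto
  then show ?thesis ..
qed

lemma smooth_scaling:
  assumes ex: "\<And>P Q. \<exists>a. scaled_points r P Q a"
  shows "\<exists>\<psi>. smooth_fun \<A> UNIV \<psi> \<and> (\<forall>P. scaled_points r P P0 (\<psi> P))"
proof (cases "\<exists>a. a \<noteq> 1 \<and> scaled_points r P0 P0 a")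
  case True
  then obtain a where a: "a \<noteq> 1" "scaled_points r P0 P0 a" by blast
  have "scaled_points r P P0 1" for P
  proof -
    obtain b where b: "scaled_points r P P0 b" using ex by blast
    then have "b > 0" by (simp add: scaled_iso_def)
    \<comment> \<open>The self-map of the base point is chosen to undo the factor of an arbitrary
      comparison map.\<close>
    then have "scaled_points r P0 P0 (1 / b)"
      by (intro scaled_iso_flow[OF multilinear_tensors a(2,1)]) simp
    from scaled_iso_trans[OF b this] show ?thesis using \<open>b > 0\<close> by simp
  qed
  then show ?thesis using smooth_fun_const[of UNIV 1] by blast
next
  case False
  have unique: "a = b" if "scaled_points r P P0 a" "scaled_points r P P0 b" for P a b
  proof -
    have "b * (1 / a) = 1" using scaled_iso_trans[OF scaled_iso_sym[OF that(1)] that(2)] False by blast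
    then show ?thesis by (simp add: field_simps split: if_splits)
  qed
  define \<psi> where "\<psi> P = (SOME a. scaled_points r P P0 a)" for P
  have \<psi>: "scaled_points r P P0 (\<psi> P)" for P
    unfolding \<psi>_def by (rule someI_ex[OF ex])
  have "smooth_fun \<A> UNIV \<psi>"
  proof (rule smooth_funI)
    fix c assume c: "c \<in> \<A>"
    define S where "S = snd c ` (UNIV \<inter> fst c)"
    have S: "open S" unfolding S_def by (rule open_coord_image[OF c open_UNIV])
    have inv: "chart_inv c p \<in> fst c" if "p \<in> S" for p using that c by (auto simp: S_def)
    \<comment> \<open>The tensors written in the frame of the chart, so that forms at different
      points live on one space and depend smoothly on \<open>p\<close>; passing to the frame has
      factor 1.\<close>
    let ?T = "\<lambda>p j xs. tensors (chart_inv c p) j (map (frame c (chart_inv c p)) xs)"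
    have to_frame: "scaled_iso J m (?T p) (tensors (chart_inv c p)) 1"
      "scaled_iso J m (tensors (chart_inv c p)) (?T p) 1" if "p \<in> S" for p J m
    proof -
      show 1: "scaled_iso J m (?T p) (tensors (chart_inv c p)) 1"
        unfolding scaled_iso_def using linear_frame[OF c inv[OF that]] bij_frame[OF c inv[OF that]] by auto
      show "scaled_iso J m (tensors (chart_inv c p)) (?T p) 1" using scaled_iso_sym[OF 1] by simp
    qed
    show "Cinf_on (snd c ` (UNIV \<inter> fst c)) (\<lambda>y. \<psi> (chart_inv c y))"
      unfolding S_def[symmetric]
    proof (rule Cinf_on_local)
      fix p0 assume p0: "p0 \<in> S"
      let ?P = "chart_inv c p0"
      have "\<exists>S' s. open S' \<and> p0 \<in> S' \<and> S' \<subseteq> S \<and> Cinf_on S' s \<and>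
        (\<forall>p\<in>S'. scaled_iso (r + 2) curvature_rank (?T p) (?T p0) (s p))"
      proof (rule local_smooth_scaling[OF S p0])
        show "multilinear (curvature_rank j) (?T p j)" if "p \<in> S" for p j
          by (rule multilinear_map[OF multilinear_tensors linear_frame[OF c inv[OF that]]])
        show "Cinf_on S (\<lambda>p. ?T p j bs)" if "length bs = curvature_rank j" for j bs
          using smooth_funD[OF smooth_tensors_frame[OF c that] c] by (simp add: S_def)
        show "\<exists>a. scaled_iso (r + 2) curvature_rank (?T p) (?T p0) a" if "p \<in> S" for p
          using ex[of "chart_inv c p" ?P] scaled_iso_trans[OF to_frame(1)[OF that]]
            scaled_iso_trans[OF _ to_frame(2)[OF p0]] by blast
      qed
      then obtain S' s where S': "open S'" "p0 \<in> S'" "S' \<subseteq> S" "Cinf_on S' s"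
        "\<forall>p\<in>S'. scaled_iso (r + 2) curvature_rank (?T p) (?T p0) (s p)"
        by (elim exE conjE)
      \<comment> \<open>Uniqueness of the factor identifies the chosen \<open>\<psi>\<close>, about
        whose dependence on the point nothing is known, with a constant multiple of the smooth local
        factor.\<close>
      have "\<psi> ?P * s p = \<psi> (chart_inv c p)" if p: "p \<in> S'" for p
      proof (rule unique[OF _ \<psi>])
        have pS: "p \<in> S" using p S'(3) by blast
        have "scaled_points r (chart_inv c p) ?P (1 * (s p * 1))"
          using scaled_iso_trans[OF scaled_iso_trans[OF to_frame(2)[OF pS] S'(5)[rule_format, OF p]] to_frame(1)[OF p0]] .
        from scaled_iso_trans[OF this \<psi>] show "scaled_points r (chart_inv c p) P0 (\<psi> ?P * s p)" by simp
      qed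
      then have "Cinf_on S' (\<lambda>y. \<psi> (chart_inv c y))"
        using Cinf_on_cong[OF S'(1) _ Cinf_on_mult[OF S'(1) Cinf_on_const[of _ "\<psi> ?P"] S'(4)]] by simp
      then show "\<exists>T. open T \<and> p0 \<in> T \<and> Cinf_on T (\<lambda>y. \<psi> (chart_inv c y))" using S' by blast
    qed
  qed
  then show ?thesis using \<psi> by blast
qed

end

section \<open>Curvature models\<close>

lemma model_isomorphic_curvature_iff:
  "model_isomorphic (curvature_model r \<eta> B) (curvature_model r \<phi> A) \<longleftrightarrow>
    (\<exists>F. linear F \<and> bij F \<and> (\<forall>x y. \<phi> (F x) (F y) = \<eta> x y) \<and>
      (\<forall>k\<le>r. \<forall>xs. length xs = 4 + k \<longrightarrow> A k (map F xs) = B k xs))"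
proof -
  have "(\<forall>xs. length xs = 2 \<longrightarrow> \<phi> (map F xs ! 0) (map F xs ! 1) = \<eta> (xs ! 0) (xs ! 1)) \<longleftrightarrow>
    (\<forall>x y. \<phi> (F x) (F y) = \<eta> x y)" for F
  proof
    assume *: "\<forall>xs. length xs = 2 \<longrightarrow> \<phi> (map F xs ! 0) (map F xs ! 1) = \<eta> (xs ! 0) (xs ! 1)"
    show "\<forall>x y. \<phi> (F x) (F y) = \<eta> x y"
    proof (intro allI)
      fix x y show "\<phi> (F x) (F y) = \<eta> x y" using *[rule_format, of "[x, y]"] by simp
    qed
  qed simp
  then show ?thesis
    unfolding model_isomorphic_def curvature_model_def
    by (simp add: list_all2_map1 list_all2_map2 list_all2_same less_Suc_eq_le Ball_def del: upt_Suc)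
qed

lemma model_space_curvature_iff:
  fixes \<phi> :: "'v::real_vector \<Rightarrow> 'v \<Rightarrow> real"
  shows "model_space (curvature_model r \<phi> A) \<longleftrightarrow> (\<exists>B :: 'v set. finite B \<and> span B = UNIV) \<and>
    multilinear 2 (\<lambda>xs. \<phi> (xs ! 0) (xs ! 1)) \<and> (\<forall>k\<le>r. multilinear (4 + k) (A k))"
proof -
  have "set [0..<Suc r] = {..r}" by (simp add: atLeast0LessThan lessThan_Suc_atMost del: upt_Suc)
  then have "set (curvature_model r \<phi> A)
      = insert (2, \<lambda>xs. \<phi> (xs ! 0) (xs ! 1)) ((\<lambda>k. (4 + k, A k)) ` {..r})"
    unfolding curvature_model_def by (simp only: list.set set_map)
  then show ?thesis unfolding model_space_def by auto
qed

lemma powr_half_power: "a > 0 \<Longrightarrow> a powr (real n / 2) = sqrt a ^ n"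
  by (simp add: powr_half_sqrt[symmetric] powr_realpow[symmetric] powr_powr)

theorem theorem1p5:
  fixes \<A> :: "('a::{t2_space,second_countable_topology}, 'e::euclidean_space) chart set"
    and g :: "'a \<Rightarrow> 'e \<Rightarrow> 'e \<Rightarrow> real"
    and D :: "('a, 'e) connection"
    and r :: nat
  assumes "smooth_atlas \<A>"
    and "pseudo_riemannian_metric \<A> g"
    and "levi_civita_connection \<A> g D"
    and "dim (UNIV :: 'v::real_vector set) = DIM('e)"
  shows "strongly_curvature_homogeneous13 \<A> g D r \<longleftrightarrow>
    (\<exists>(\<phi> :: 'v \<Rightarrow> 'v \<Rightarrow> real) (A :: nat \<Rightarrow> 'v list \<Rightarrow> real).
       nondegenerate_inner_product \<phi> \<and> model_space (curvature_model r \<phi> A) \<and>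
       (\<exists>\<psi> :: 'a \<Rightarrow> real. smooth_fun \<A> UNIV \<psi> \<and> (\<forall>P. \<psi> P > 0) \<and>
          (\<forall>P. model_isomorphic
             (curvature_model r (g P) (\<lambda>k. nabla_curv04 \<A> g D k P))
             (curvature_model r \<phi> (\<lambda>k xs. \<psi> P powr (real (k + 2) / 2) * A k xs)))))"
    (is "?L \<longleftrightarrow> ?R")
proof
  interpret levi_civita_manifold \<A> g D
    using assms(1-3) by unfold_locales
  assume ?L
  then have "\<exists>a. scaled_points r P Q a" for P Q
    unfolding strongly_curvature_homogeneous13_def using homothety_imp_scaled_points by metis
  \<comment> \<open>Any point may serve as base point; \<open>undefined\<close> is one because the
    type is inhabited.\<close>
  then obtain \<psi> where \<psi>: "smooth_fun \<A> UNIV \<psi>" "\<forall>P. scaled_points r P undefined (\<psi> P)"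
    using smooth_scaling[of r undefined] by blast
  define P0 :: 'a where "P0 = undefined"
  note iso = \<psi>(2)[folded P0_def]
  obtain L :: "'e \<Rightarrow> 'v" where L: "linear L" "bij L" using ex_linear_iso[OF assms(4)] by blast
  define K where "K = inv L"
  have K: "linear K" unfolding K_def by (rule linear_inv[OF L])
  have KL: "K (L x) = x" and LK: "L (K y) = y" for x y
    using L(2) by (simp_all add: K_def bij_is_inj bij_is_surj surj_f_inv_f)
  define \<phi> where "\<phi> x y = g P0 (K x) (K y)" for x y
  define A where "A k xs = nabla_curv04 \<A> g D k P0 (map K xs)" for k xs
  have "nondegenerate_inner_product \<phi>"
    unfolding nondegenerate_inner_product_def
  proof (intro conjI allI impI)
    show "linear (\<phi> x)" for x
      using linear_compose[OF K linear_g(1)] by (simp add: \<phi>_def[abs_def] o_def)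
    show "\<phi> x y = \<phi> y x" for x y by (simp add: \<phi>_def g_sym)
    fix x assume "\<forall>y. \<phi> x y = 0"
    then have "g P0 (K x) y = 0" for y using KL[of y] unfolding \<phi>_def by metis
    then have "K x = 0" using inner_g[of P0] by (simp add: nondegenerate_inner_product_def)
    then show "x = 0" using LK[of x] linear_0[OF L(1)] by simp
  qed
  moreover have "model_space (curvature_model r \<phi> A)"
  proof -
    have "finite (L ` Basis)" "span (L ` Basis) = UNIV" using L by (simp_all add: linear_span_image bij_is_surj)
    have "multilinear 2 (\<lambda>xs. tensors P0 0 (map K xs))"
      using multilinear_map[OF multilinear_tensors[of 0 P0] K] by (simp add: curvature_rank_def)
    moreover have "tensors P0 0 (map K xs) = \<phi> (xs ! 0) (xs ! 1)" if "length xs = 2" for xs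
      using that by (simp add: tensors_def \<phi>_def)
    ultimately have "multilinear 2 (\<lambda>xs. \<phi> (xs ! 0) (xs ! 1))"
      by (simp add: multilinear_def)
    moreover have "multilinear (4 + k) (A k)" for k
      unfolding A_def[abs_def] by (rule multilinear_map[OF multilinear_nabla_curv04 K])
    ultimately show ?thesis
      unfolding model_space_curvature_iff using \<open>finite (L ` Basis)\<close> \<open>span (L ` Basis) = UNIV\<close> by blast
  qed
  moreover have "\<psi> P > 0" for P using iso by (simp add: scaled_iso_def)
  moreover have "model_isomorphic (curvature_model r (g P) (\<lambda>k. nabla_curv04 \<A> g D k P))
     (curvature_model r \<phi> (\<lambda>k xs. \<psi> P powr (real (k + 2) / 2) * A k xs))" for P
  proof -
    obtain F where F: "\<psi> P > 0" "linear F" "bij F" "\<forall>x y. g P0 (F x) (F y) = \<psi> P * g P x y"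
      "\<forall>k\<le>r. \<forall>xs. length xs = 4 + k \<longrightarrow> nabla_curv04 \<A> g D k P0 (map F xs) = \<psi> P * nabla_curv04 \<A> g D k P xs"
      using iso[rule_format, of P] unfolding scaled_points_iff by blast
    define q where "q = sqrt (\<psi> P)"
    have q: "q > 0" "q\<^sup>2 = \<psi> P" using F(1) by (simp_all add: q_def)
    \<comment> \<open>Division by \<open>q\<close> turns the scaling by \<open>\<psi> P\<close> into
      an isometry, and \<open>L\<close> transports the tangent space at \<open>P0\<close> to the
      model.\<close>
    define F' where "F' x = L ((1 / q) *\<^sub>R F x)" for x
    have KF': "K (F' x) = (1 / q) *\<^sub>R F x" for x by (simp add: F'_def KL)
    have "linear F'"
      using linear_compose[OF linear_compose_scale_right[OF F(2)] L(1), of "1 / q"] by (simp add: F'_def[abs_def] o_def)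
    moreover have "bij F'"
    proof (rule o_bij[of "\<lambda>y. inv F (q *\<^sub>R K y)"])
      show "(\<lambda>y. inv F (q *\<^sub>R K y)) \<circ> F' = id"
        using q(1) F(3) by (simp add: fun_eq_iff KF' bij_is_inj)
      show "F' \<circ> (\<lambda>y. inv F (q *\<^sub>R K y)) = id"
        using q(1) F(3) by (simp add: fun_eq_iff F'_def bij_is_surj surj_f_inv_f LK)
    qed
    moreover have "\<phi> (F' x) (F' y) = g P x y" for x y
      using q F(4) by (simp add: \<phi>_def KF' linear_scale[OF linear_g(1)] linear_scale[OF linear_g(2)])
        (simp add: q(2)[symmetric] power2_eq_square)
    moreover have "\<psi> P powr (real (k + 2) / 2) * A k (map F' xs) = nabla_curv04 \<A> g D k P xs"
      if "k \<le> r" "length xs = 4 + k" for k xs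
    proof -
      have KF: "map K (map F' xs) = map (\<lambda>x. (1 / q) *\<^sub>R x) (map F xs)" by (simp add: KF')
      \<comment> \<open>Each of the 4+k arguments contributes \<open>1 / q\<close> and the factor of
        \<open>F\<close> contributes the square of \<open>q\<close>; the remaining negative power is
        compensated by the power k+2 of \<open>q\<close> in the model.\<close>
      have "A k (map F' xs) = (1 / q) ^ (4 + k) * (q\<^sup>2 * nabla_curv04 \<A> g D k P xs)"
        unfolding A_def KF
        using multilinear_scaleR_all[OF multilinear_nabla_curv04[of k P0], of "map F xs" "1 / q"] F(5) that
        by (simp add: q(2))
      moreover have "\<psi> P powr (real (k + 2) / 2) = q ^ (k + 2)"
        unfolding q_def by (rule powr_half_power[OF F(1)])
      ultimately show ?thesis
        using q(1) by (simp add: power_add power_divide power4_eq_xxxx power2_eq_square field_simps)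
    qed
    ultimately show ?thesis unfolding model_isomorphic_curvature_iff by blast
  qed
  ultimately show ?R using \<psi>(1) by blast
next
  interpret levi_civita_manifold \<A> g D
    using assms(1-3) by unfold_locales
  assume ?R
  then obtain \<phi> :: "'v \<Rightarrow> 'v \<Rightarrow> real" and A \<psi> where ms: "model_space (curvature_model r \<phi> A)"
    and pos: "\<forall>P. \<psi> P > 0" and iso: "\<forall>P. model_isomorphic
             (curvature_model r (g P) (\<lambda>k. nabla_curv04 \<A> g D k P))
             (curvature_model r \<phi> (\<lambda>k xs. \<psi> P powr (real (k + 2) / 2) * A k xs))"
    by blast
  have mA: "multilinear (4 + k) (A k)" if "k \<le> r" for k
    using ms that by (simp add: model_space_curvature_iff)
  show ?L
    unfolding strongly_curvature_homogeneous13_def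
  proof (intro allI)
    fix P Q
    obtain F where F: "linear F" "bij F" "\<forall>x y. \<phi> (F x) (F y) = g P x y"
      "\<forall>k\<le>r. \<forall>xs. length xs = 4 + k \<longrightarrow> \<psi> P powr (real (k + 2) / 2) * A k (map F xs) = nabla_curv04 \<A> g D k P xs"
      using iso[rule_format, of P] unfolding model_isomorphic_curvature_iff by blast
    obtain G where G: "linear G" "bij G" "\<forall>x y. \<phi> (G x) (G y) = g Q x y"
      "\<forall>k\<le>r. \<forall>xs. length xs = 4 + k \<longrightarrow> \<psi> Q powr (real (k + 2) / 2) * A k (map G xs) = nabla_curv04 \<A> g D k Q xs"
      using iso[rule_format, of Q] unfolding model_isomorphic_curvature_iff by blast
    define p where "p = sqrt (\<psi> P)"
    define q where "q = sqrt (\<psi> Q)"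
    have pq: "p > 0" "q > 0" using pos by (simp_all add: p_def q_def)
    \<comment> \<open>The ratio for which the powers k+2 of \<open>p\<close> and \<open>q\<close> in
      the two models match for all \<open>k\<close>; of the 4+k factors \<open>c\<close> two remain,
      and these are the scaling of the metric.\<close>
    define c where "c = p / q"
    have c: "c > 0" using pq by (simp add: c_def)
    define E where "E x = inv G (F x)" for x
    have GE: "G (E x) = F x" for x using G(2) by (simp add: E_def bij_is_surj surj_f_inv_f)
    have E: "linear E" "bij E"
      using linear_compose[OF F(1) linear_inv[OF G(1,2)]] bij_comp[OF F(2) bij_imp_bij_inv[OF G(2)]]
      by (simp_all add: E_def[abs_def] o_def)
    have gE: "g Q (E x) (E y) = g P x y" for x y
      using F(3) G(3) GE by metis
    define h where "h x = c *\<^sub>R E x" for x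
    have gh: "g Q (h x) (h y) = c\<^sup>2 * g P x y" for x y
      by (simp add: h_def linear_scale[OF linear_g(1)] linear_scale[OF linear_g(2)] gE power2_eq_square)
    have hh: "h (inv E ((1 / c) *\<^sub>R x)) = x" "inv E ((1 / c) *\<^sub>R h x) = x" for x
      using c E(2) by (simp_all add: h_def bij_is_surj surj_f_inv_f bij_is_inj)
    have bh: "bij h" by (rule o_bij[of "\<lambda>x. inv E ((1 / c) *\<^sub>R x)"]) (simp_all add: fun_eq_iff hh)
    have hom: "homothety (g P) (g Q) h"
      unfolding homothety_def linear_isometry_def using c E gE h_def by blast
    have nabla: "nabla_curv04 \<A> g D k Q (map h ys) = c\<^sup>2 * nabla_curv04 \<A> g D k P ys"
      if k: "k \<le> r" and ys: "length ys = 4 + k" for k ys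
    proof -
      have Gh: "map G (map h ys) = map (\<lambda>x. c *\<^sub>R x) (map F ys)"
        by (simp add: h_def linear_scale[OF G(1)] GE)
      have "A k (map G (map h ys)) = c ^ (4 + k) * A k (map F ys)"
        unfolding Gh using multilinear_scaleR_all[OF mA[OF k], of "map F ys" c] ys by simp
      then have "nabla_curv04 \<A> g D k Q (map h ys) = q ^ (k + 2) * (c ^ (4 + k) * A k (map F ys))"
        using G(4)[rule_format, OF k, of "map h ys"] ys pos powr_half_power[of "\<psi> Q" "k + 2"]
        by (simp add: q_def)
      moreover have "nabla_curv04 \<A> g D k P ys = p ^ (k + 2) * A k (map F ys)"
        using F(4)[rule_format, OF k ys] pos powr_half_power[of "\<psi> P" "k + 2"] by (simp add: p_def)
      ultimately show ?thesis
        using pq by (simp add: c_def power_add power_divide power4_eq_xxxx power2_eq_square field_simps)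
    qed
    have "pullback1 h (nabla_curv13 \<A> D k Q) xs = nabla_curv13 \<A> D k P xs" if k: "k \<le> r" and xs: "length xs = 3 + k" for k xs
    \<comment> \<open>The two vectors are compared through the nondegenerate metric. Lowering the
      index at both points produces the same square of \<open>c\<close>, which cancels.\<close>
    proof (rule g_eqI[of P])
      fix w
      let ?u = "nabla_curv13 \<A> D k Q (map h xs)"
      have "c\<^sup>2 * g P (inv h ?u) w = g Q ?u (h w)"
        using bh by (simp add: gh[symmetric] bij_is_surj surj_f_inv_f)
      also have "\<dots> = c\<^sup>2 * nabla_curv04 \<A> g D k P (insert4 w xs)"
        using nabla_curv13_curv04[of "map h xs" k Q "h w"] nabla[OF k, of "insert4 w xs"] xs
        by (simp add: map_insert4 length_insert4)
      finally show "g P (pullback1 h (nabla_curv13 \<A> D k Q) xs) w = g P (nabla_curv13 \<A> D k P xs) w"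
        using c nabla_curv13_curv04[OF xs, of P w] by (simp add: pullback1_def)
    qed
    then show "\<exists>h. homothety (g P) (g Q) h \<and> (\<forall>k\<le>r. \<forall>xs. length xs = 3 + k \<longrightarrow>
           pullback1 h (nabla_curv13 \<A> D k Q) xs = nabla_curv13 \<A> D k P xs)"
      using hom by blast
  qed
qed

end
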